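(* Let $\boldsymbol{Y}$ be the solution of the inertial Langevin equation and $(\boldsymbol{X}_k)$ the Geometric Langevin Algorithm (GLA) with step-size $h$, driven by the same Brownian motion $\boldsymbol{W}$ and started from the same point $\boldsymbol{x}\in\mathbb{R}^{2n}$, as defined in the context. Assume that the potential energy $U\in C^\infty(\mathbb{R}^n,\mathbb{R})$ satisfies (U1) and (U2) and that the variational integrator $\theta_h$ satisfies (V1) and (V2). Then for any $T>0$ there exist $h_c>0$ and $C(T)>0$ such that for all $0<h<h_c$, all $\boldsymbol{x}\in\mathbb{R}^{2n}$ and all $t\in[0,T]$, $$\left(\mathbb{E}^{\boldsymbol{x}}\left\{\left|\boldsymbol{X}_{\lfloor t/h\rfloor}-\boldsymbol{Y}(\lfloor t/h\rfloor h)\right|^2\right\}\right)^{1/2}\le C(T)\,(1+|\boldsymbol{x}|^2)^{1/2}\,h .$$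
   Context: Setting. Fix $n\ge 1$, $\beta>0$, $\gamma>0$, a symmetric positive definite $n\times n$ matrix $\boldsymbol{M}$, and $U\in C^\infty(\mathbb{R}^n,\mathbb{R})$. The Hamiltonian on $\mathbb{R}^{2n}$ is $H(\boldsymbol{q},\boldsymbol{p})=\frac12\boldsymbol{p}^T\boldsymbol{M}^{-1}\boldsymbol{p}+U(\boldsymbol{q})$. Inertial Langevin equation. $\boldsymbol{Y}(t)=(\boldsymbol{Q}(t),\boldsymbol{P}(t))$ solves $$d\boldsymbol{Q}=\boldsymbol{M}^{-1}\boldsymbol{P}\,dt,\qquad d\boldsymbol{P}=-\nabla U(\boldsymbol{Q})\,dt-\gamma\boldsymbol{M}^{-1}\boldsymbol{P}\,dt+\sqrt{2\gamma\beta^{-1}}\,d\boldsymbol{W},\qquad \boldsymbol{Y}(0)=\boldsymbol{x}\in\mathbb{R}^{2n},$$ where $\boldsymbol{W}$ is a standard $n$-dimensional Brownian motion. Maps. $\vartheta_t$ is the exact time-$t$ flow of Hamilton's equations $\dot{\boldsymbol{Q}}=\boldsymbol{M}^{-1}\boldsymbol{P}$, $\dot{\boldsymbol{P}}=-\nabla U(\boldsymbol{Q})$. The Ornstein-Uhlenbeck flow is $$\psi_{t+h,t}(\boldsymbol{q},\boldsymbol{p})=\Big(\boldsymbol{q},\;e^{-\gamma\boldsymbol{M}^{-1}h}\boldsymbol{p}+\sqrt{2\beta^{-1}\gamma}\int_t^{t+h}e^{-\gamma\boldsymbol{M}^{-1}(t+h-s)}\,d\boldsymbol{W}(s)\Big).$$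 For each step-size $h$, $\theta_h:\mathbb{R}^{2n}\to\mathbb{R}^{2n}$ is a variational integrator with order of accuracy $p\ge1$ (an integer). GLA. With $t_k=kh$, $\boldsymbol{X}_0=\boldsymbol{x}$ and $\boldsymbol{X}_{k+1}=\theta_h\circ\psi_{t_k+h,t_k}(\boldsymbol{X}_k)$. $\mathbb{E}^{\boldsymbol{x}}$ denotes expectation given initial condition $\boldsymbol{x}$. Assumptions on $U$: (U1) there is $A_0>0$ with $|\nabla U(\boldsymbol{q}_0)-\nabla U(\boldsymbol{q}_1)|\le A_0|\boldsymbol{q}_0-\boldsymbol{q}_1|$ for all $\boldsymbol{q}_0,\boldsymbol{q}_1\in\mathbb{R}^n$; (U2) there is $A_1>0$ with $U(\boldsymbol{q})\ge A_1(1+|\boldsymbol{q}|^2)$ for all $\boldsymbol{q}\in\mathbb{R}^n$. Assumptions on $\theta_h$: (V1) $\theta_h$ is the discrete Hamiltonian map of a hyperregular smooth discrete Lagrangian $L_d(\boldsymbol{q}_0,\boldsymbol{q}_1,h)$ on $\mathbb{R}^n\times\mathbb{R}^n\times\mathbb{R}^+$: $\theta_h(\boldsymbol{q}_0,\boldsymbol{p}_0)=(\boldsymbol{q}_1,\boldsymbol{p}_1)$ is determined by $\boldsymbol{p}_0=-D_1L_d(\boldsymbol{q}_0,\boldsymbol{q}_1,h)$, $\boldsymbol{p}_1=D_2L_d(\boldsymbol{q}_0,\boldsymbol{q}_1,h)$. Hyperregularity means that for every $h>0$, $|\det D_{12}L_d(\boldsymbol{q}_0,\boldsymbol{q}_1,h)|>0$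 for all $\boldsymbol{q}_0,\boldsymbol{q}_1\in\mathbb{R}^n$, and the discrete Legendre transforms $(\boldsymbol{q}_0,\boldsymbol{q}_1)\mapsto(\boldsymbol{q}_0,-D_1L_d(\boldsymbol{q}_0,\boldsymbol{q}_1,h))$ and $(\boldsymbol{q}_0,\boldsymbol{q}_1)\mapsto(\boldsymbol{q}_1,D_2L_d(\boldsymbol{q}_0,\boldsymbol{q}_1,h))$ are diffeomorphisms of $\mathbb{R}^{2n}$ (so $\theta_h$ is a well-defined symplectic diffeomorphism); (V2) there are $B_0>0$ and $h_0>0$ such that for all $0<h<h_0$, $|\theta_h(\boldsymbol{x})-\vartheta_h(\boldsymbol{x})|\le B_0(1+|\boldsymbol{x}|^2)^{1/2}h^{p+1}$ for all $\boldsymbol{x}\in\mathbb{R}^{2n}$. *)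

theory Defs
  imports "HOL-Probability.Probability"
begin

section \<open>Smooth maps\<close>

primrec Ck_on :: "nat \<Rightarrow> 'a::real_normed_vector set \<Rightarrow> ('a \<Rightarrow> 'b::real_normed_vector) \<Rightarrow> bool" where
  "Ck_on 0 S f \<longleftrightarrow> continuous_on S f"
| "Ck_on (Suc k) S f \<longleftrightarrow> (\<forall>x\<in>S. f differentiable (at x)) \<and>
     (\<forall>v. Ck_on k S (\<lambda>x. frechet_derivative f (at x) v))"

text \<open>Only used for open \<open>S\<close> in finite-dimensional spaces, where \<open>Ck_on k S f\<close> says that all
  iterated directional derivatives up to order \<open>k\<close> exist and are continuous.\<close>

definition smooth_on :: "'a::real_normed_vector set \<Rightarrow> ('a \<Rightarrow> 'b::real_normed_vector) \<Rightarrow> bool" where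
  "smooth_on S f \<longleftrightarrow> (\<forall>k. Ck_on k S f)"

definition diffeomorphism :: "('a::real_normed_vector \<Rightarrow> 'a) \<Rightarrow> bool" where
  "diffeomorphism f \<longleftrightarrow> bij f \<and> smooth_on UNIV f \<and> smooth_on UNIV (inv f)"

definition grad :: "(real^'n \<Rightarrow> real) \<Rightarrow> real^'n \<Rightarrow> real^'n" where
  "grad f x = (\<chi> i. frechet_derivative f (at x) (axis i 1))"


section \<open>Matrices\<close>

definition sym_pos_def :: "real^'n^'n \<Rightarrow> bool" where
  "sym_pos_def A \<longleftrightarrow> transpose A = A \<and> (\<forall>v. v \<noteq> 0 \<longrightarrow> v \<bullet> (A *v v) > 0)"

text \<open>The product \<open>*\<close> and the power \<open>^\<close> of the library are componentwise on vectors, so powers of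
  a matrix are written as iterates of \<open>**\<close>.\<close>

definition mexp :: "real^'n^'n \<Rightarrow> real^'n^'n" where
  "mexp A = (\<Sum>k. (1 / fact k) *\<^sub>R (((**) A ^^ k) (mat 1)))"


section \<open>Brownian motion and integrals of deterministic functions against it\<close>

text \<open>A process on \<open>[0, \<infinity>)\<close> is a function of \<open>real\<close> time of which only the values at
  nonnegative times matter. The fifth and sixth clauses below say that
  \<open>W t - W s\<close> is \<open>N(0, (t - s) I)\<close>-distributed; the second argument of \<open>normal_density\<close> is the
  standard deviation.\<close>

definition brownian_motion :: "'w measure \<Rightarrow> (real \<Rightarrow> 'w \<Rightarrow> real^'n) \<Rightarrow> bool" where
  "brownian_motion M W \<longleftrightarrow>
     prob_space M \<and>
     (\<forall>t\<ge>0. W t \<in> borel_measurable M) \<and>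
     (AE \<omega> in M. W 0 \<omega> = 0) \<and>
     (AE \<omega> in M. continuous_on {0..} (\<lambda>t. W t \<omega>)) \<and>
     (\<forall>s t. 0 \<le> s \<and> s < t \<longrightarrow>
        prob_space.indep_vars M (\<lambda>_. borel) (\<lambda>i \<omega>. (W t \<omega> - W s \<omega>) $ i) UNIV) \<and>
     (\<forall>s t i. 0 \<le> s \<and> s < t \<longrightarrow>
        distributed M lborel (\<lambda>\<omega>. (W t \<omega> - W s \<omega>) $ i) (normal_density 0 (sqrt (t - s)))) \<and>
     (\<forall>m (\<tau> :: nat \<Rightarrow> real). 0 \<le> \<tau> 0 \<and> (\<forall>i<m. \<tau> i < \<tau> (Suc i)) \<longrightarrow>
        prob_space.indep_vars M (\<lambda>_. borel) (\<lambda>i \<omega>. W (\<tau> (Suc i)) \<omega> - W (\<tau> i) \<omega>) {..<m})"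

text \<open>\<open>J\<close> is (a version of) the Ito integral of the deterministic matrix function \<open>f\<close> against
  \<open>W\<close> over \<open>[a, b]\<close>: the mean-square limit of the integrals of some step functions that converge
  to \<open>f\<close> in \<open>L\<^sup>2[a, b]\<close>. The \<open>j\<close>-th step function has value \<open>A j i\<close> on
  \<open>(\<tau> j i, \<tau> j (Suc i)]\<close> for \<open>i < N j\<close>. By the Ito isometry, \<open>J\<close> is determined almost surely
  and the choice of approximating step functions is irrelevant.\<close>

definition has_wiener_integral ::
  "'w measure \<Rightarrow> (real \<Rightarrow> 'w \<Rightarrow> real^'n) \<Rightarrow> (real \<Rightarrow> real^'n^'n) \<Rightarrow> real \<Rightarrow> real \<Rightarrow>
   ('w \<Rightarrow> real^'n) \<Rightarrow> bool" where
  "has_wiener_integral M W f a b J \<longleftrightarrow>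
     J \<in> borel_measurable M \<and>
     (\<exists>(N :: nat \<Rightarrow> nat) (\<tau> :: nat \<Rightarrow> nat \<Rightarrow> real) (A :: nat \<Rightarrow> nat \<Rightarrow> real^'n^'n).
        (\<forall>j. \<tau> j 0 = a \<and> \<tau> j (N j) = b \<and> (\<forall>i<N j. \<tau> j i < \<tau> j (Suc i))) \<and>
        (\<lambda>j. \<Sum>i<N j. \<integral>\<^sup>+s\<in>{\<tau> j i<..\<tau> j (Suc i)}. ennreal ((norm (A j i - f s))\<^sup>2) \<partial>lborel)
          \<longlonglongrightarrow> 0 \<and>
        (\<lambda>j. \<integral>\<^sup>+\<omega>. ennreal ((norm ((\<Sum>i<N j. A j i *v (W (\<tau> j (Suc i)) \<omega> - W (\<tau> j i) \<omega>))
                - J \<omega>))\<^sup>2) \<partial>M)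
          \<longlonglongrightarrow> 0)"


section \<open>Inertial Langevin dynamics\<close>

text \<open>Phase space. The library norm of the product type is the Euclidean norm
  \<open>(|q|\<^sup>2 + |p|\<^sup>2)\<^sup>1\<^sup>/\<^sup>2\<close> of \<open>\<real>\<^sup>2\<^sup>n\<close>.\<close>

type_synonym 'n phase = "(real^'n) \<times> (real^'n)"

text \<open>The mass matrix is called \<open>Ma\<close>, as \<open>M\<close> denotes the probability space.
  The noise is additive, so the stochastic term of the integrated equation is a multiple of
  \<open>W t - W 0\<close>. Only measurability of \<open>Y t\<close> is asked for: adaptedness is not needed to make sense
  of the equation (and follows from pathwise uniqueness when \<open>grad U\<close> is Lipschitz).\<close>

definition langevin_solution ::
  "'w measure \<Rightarrow> (real \<Rightarrow> 'w \<Rightarrow> real^'n) \<Rightarrow> real^'n^'n \<Rightarrow> (real^'n \<Rightarrow> real) \<Rightarrow> real \<Rightarrow> real \<Rightarrow>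
   'n phase \<Rightarrow> (real \<Rightarrow> 'w \<Rightarrow> 'n phase) \<Rightarrow> bool" where
  "langevin_solution M W Ma U \<beta> \<gamma> x Y \<longleftrightarrow>
     (\<forall>t\<ge>0. Y t \<in> borel_measurable M) \<and>
     (AE \<omega> in M. continuous_on {0..} (\<lambda>t. Y t \<omega>)) \<and>
     (AE \<omega> in M. \<forall>t\<ge>0.
        fst (Y t \<omega>) = fst x + integral {0..t} (\<lambda>s. matrix_inv Ma *v snd (Y s \<omega>)) \<and>
        snd (Y t \<omega>) = snd x
          - integral {0..t} (\<lambda>s. grad U (fst (Y s \<omega>)))
          - integral {0..t} (\<lambda>s. \<gamma> *\<^sub>R (matrix_inv Ma *v snd (Y s \<omega>)))
          + sqrt (2 * \<gamma> / \<beta>) *\<^sub>R (W t \<omega> - W 0 \<omega>))"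

definition hamiltonian_flow ::
  "real^'n^'n \<Rightarrow> (real^'n \<Rightarrow> real) \<Rightarrow> (real \<Rightarrow> 'n phase \<Rightarrow> 'n phase) \<Rightarrow> bool" where
  "hamiltonian_flow Ma U \<phi> \<longleftrightarrow>
     (\<forall>x. \<phi> 0 x = x \<and>
        (\<forall>t. ((\<lambda>s. \<phi> s x) has_vector_derivative
               (matrix_inv Ma *v snd (\<phi> t x), - grad U (fst (\<phi> t x)))) (at t)))"


section \<open>Variational integrators\<close>

definition D1 :: "(real^'n \<Rightarrow> real^'n \<Rightarrow> real \<Rightarrow> real) \<Rightarrow> real^'n \<Rightarrow> real^'n \<Rightarrow> real \<Rightarrow> real^'n" where
  "D1 L q0 q1 h = grad (\<lambda>q. L q q1 h) q0"

definition D2 :: "(real^'n \<Rightarrow> real^'n \<Rightarrow> real \<Rightarrow> real) \<Rightarrow> real^'n \<Rightarrow> real^'n \<Rightarrow> real \<Rightarrow> real^'n" where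
  "D2 L q0 q1 h = grad (\<lambda>q. L q0 q h) q1"

definition D12 :: "(real^'n \<Rightarrow> real^'n \<Rightarrow> real \<Rightarrow> real) \<Rightarrow> real^'n \<Rightarrow> real^'n \<Rightarrow> real \<Rightarrow> real^'n^'n" where
  "D12 L q0 q1 h = jacobian (\<lambda>q. D1 L q0 q h) (at q1)"

definition smooth_discrete_lagrangian :: "(real^'n \<Rightarrow> real^'n \<Rightarrow> real \<Rightarrow> real) \<Rightarrow> bool" where
  "smooth_discrete_lagrangian L \<longleftrightarrow> smooth_on (UNIV \<times> UNIV \<times> {0<..}) (\<lambda>(q0, q1, h). L q0 q1 h)"

definition hyperregular :: "(real^'n \<Rightarrow> real^'n \<Rightarrow> real \<Rightarrow> real) \<Rightarrow> bool" where
  "hyperregular L \<longleftrightarrow>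
     (\<forall>h>0. (\<forall>q0 q1. \<bar>det (D12 L q0 q1 h)\<bar> > 0) \<and>
        diffeomorphism (\<lambda>(q0, q1). (q0, - D1 L q0 q1 h)) \<and>
        diffeomorphism (\<lambda>(q0, q1). (q1, D2 L q0 q1 h)))"

definition discrete_hamiltonian_map ::
  "(real^'n \<Rightarrow> real^'n \<Rightarrow> real \<Rightarrow> real) \<Rightarrow> (real \<Rightarrow> 'n phase \<Rightarrow> 'n phase) \<Rightarrow> bool" where
  "discrete_hamiltonian_map L \<theta> \<longleftrightarrow>
     (\<forall>h>0. \<forall>q0 p0 q1 p1.
        \<theta> h (q0, p0) = (q1, p1) \<longleftrightarrow> p0 = - D1 L q0 q1 h \<and> p1 = D2 L q0 q1 h)"


section \<open>The Geometric Langevin Algorithm\<close>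

text \<open>The Ornstein-Uhlenbeck map over a step of length \<open>h\<close>, given the value \<open>J\<close> of the stochastic
  integral over that step.\<close>

definition ou_map :: "real^'n^'n \<Rightarrow> real \<Rightarrow> real \<Rightarrow> real \<Rightarrow> real^'n \<Rightarrow> 'n phase \<Rightarrow> 'n phase" where
  "ou_map Ma \<beta> \<gamma> h J = (\<lambda>(q, p).
     (q, mexp (- (\<gamma> * h) *\<^sub>R matrix_inv Ma) *v p + sqrt (2 * \<gamma> / \<beta>) *\<^sub>R J))"

definition gla ::
  "'w measure \<Rightarrow> (real \<Rightarrow> 'w \<Rightarrow> real^'n) \<Rightarrow> real^'n^'n \<Rightarrow> real \<Rightarrow> real \<Rightarrow>
   (real \<Rightarrow> 'n phase \<Rightarrow> 'n phase) \<Rightarrow> real \<Rightarrow> 'n phase \<Rightarrow> (nat \<Rightarrow> 'w \<Rightarrow> 'n phase) \<Rightarrow> bool" where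
  "gla M W Ma \<beta> \<gamma> \<theta> h x X \<longleftrightarrow>
     (\<forall>\<omega>\<in>space M. X 0 \<omega> = x) \<and>
     (\<forall>k. \<exists>J. has_wiener_integral M W
               (\<lambda>s. mexp (- (\<gamma> * (real k * h + h - s)) *\<^sub>R matrix_inv Ma))
               (real k * h) (real k * h + h) J \<and>
             (\<forall>\<omega>\<in>space M. X (Suc k) \<omega> = \<theta> h (ou_map Ma \<beta> \<gamma> h (J \<omega>) (X k \<omega>))))"

end

theory Submission
  imports Defs
begin

text \<open>Write \<open>A\<close> for the inverse mass matrix, \<open>\<sigma> = (2 \<gamma> / \<beta>)\<^sup>1\<^sup>/\<^sup>2\<close> and \<open>F\<close> for the Lipschitz drift of
  the equation. Expanding both the algorithm and the solution over one step gives, path by path,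
  \<open>e\<^sub>k\<^sub>+\<^sub>1 = e\<^sub>k + h (F X\<^sub>k - F Y\<^sub>k) + n\<^sub>k + r\<^sub>k\<close> for the error \<open>e\<^sub>k\<close>, where \<open>r\<^sub>k\<close> is of order \<open>h\<^sup>2\<close> and
  \<open>n\<^sub>k\<close> is linear in \<open>h J\<^sub>k\<close>, in \<open>J\<^sub>k - \<Delta>W\<^sub>k\<close> and in the integral of \<open>W - W t\<^sub>k\<close> over the cell, \<open>J\<^sub>k\<close> being the
  Wiener integral of the Ornstein-Uhlenbeck step. The terms \<open>n\<^sub>k\<close> are only of order \<open>h\<^sup>3\<^sup>/\<^sup>2\<close> in mean
  square, but contributions of different cells are orthogonal, so that their sum is of order \<open>h\<close>.
  A pathwise discrete Gronwall inequality, applied before taking mean squares, then concludes.\<close>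

section \<open>Domination in mean square\<close>

text \<open>The usual mean-square recursion squares the error after each step and discards the cross
  term between the error and the new noise, which requires adapted processes. Neither
  \<open>langevin_solution\<close> nor \<open>gla\<close> supplies a filtration. The way round is
  that the noise is additive: \<open>n\<^sub>k\<close> is built from the driving path and the Wiener
  integrals alone, never from \<open>X\<^sub>k\<close> or \<open>Y\<^sub>k\<close>, so its sums can
  be squared by themselves. Every estimate before that point is made for a single path and kept
  linear in the noise, so that Minkowski's inequality can carry it over to mean squares. The force
  contributes no term of order \<open>h\<^sup>3\<^sup>/\<^sup>2\<close>, because the position has no
  noise of its own; a Lipschitz gradient is therefore enough for first order. A Wiener integral is
  given only as a limit of step sums. Orthogonality between time steps is therefore used for
  approximating step functions, whose cells over all time steps form one non-overlapping
  family.\<close>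

text \<open>The measurable majorant \<open>g\<close> is there because \<open>f\<close> will be a pathwise integral of a process
  with merely almost surely continuous paths, which need not be measurable.\<close>

definition L2_dominated :: "'w measure \<Rightarrow> ('w \<Rightarrow> 'b::real_normed_vector) \<Rightarrow> real \<Rightarrow> bool" where
  "L2_dominated M f c \<longleftrightarrow> (\<exists>g. g \<in> borel_measurable M \<and>
     (AE \<omega> in M. ennreal ((norm (f \<omega>))\<^sup>2) \<le> g \<omega>) \<and> (\<integral>\<^sup>+\<omega>. g \<omega> \<partial>M) \<le> ennreal (c\<^sup>2))"

lemma L2_dominatedI:
  fixes f :: "'w \<Rightarrow> 'b::{real_normed_vector, second_countable_topology}"
  assumes "f \<in> borel_measurable M" "(\<integral>\<^sup>+\<omega>. ennreal ((norm (f \<omega>))\<^sup>2) \<partial>M) \<le> ennreal (c\<^sup>2)"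
  shows "L2_dominated M f c"
  unfolding L2_dominated_def using assms
  by (intro exI[of _ "\<lambda>\<omega>. ennreal ((norm (f \<omega>))\<^sup>2)"]) auto

text \<open>\<open>h\<close> itself may be non-measurable: it inherits the majorant of
  \<open>f\<close>. This is how a pathwise estimate becomes a mean-square one.\<close>

lemma L2_dominated_mono:
  assumes "L2_dominated M f c" "AE \<omega> in M. norm (h \<omega>) \<le> norm (f \<omega>)" "0 \<le> c" "c \<le> d"
  shows "L2_dominated M h d"
proof -
  obtain g where g: "g \<in> borel_measurable M" "AE \<omega> in M. ennreal ((norm (f \<omega>))\<^sup>2) \<le> g \<omega>"
    "(\<integral>\<^sup>+\<omega>. g \<omega> \<partial>M) \<le> ennreal (c\<^sup>2)"
    using assms(1) unfolding L2_dominated_def by blast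
  have "AE \<omega> in M. ennreal ((norm (h \<omega>))\<^sup>2) \<le> g \<omega>"
    using g(2) assms(2)
  proof eventually_elim
    case (elim \<omega>)
    have "(norm (h \<omega>))\<^sup>2 \<le> (norm (f \<omega>))\<^sup>2" using elim by (intro power_mono) auto
    then show ?case using elim(1) by (meson ennreal_leI order_trans)
  qed
  moreover have "ennreal (c\<^sup>2) \<le> ennreal (d\<^sup>2)" using assms by (intro ennreal_leI power_mono) auto
  ultimately show ?thesis using g unfolding L2_dominated_def by (meson order_trans)
qed

lemma L2_dominated_scaleR:
  assumes "L2_dominated M f c" "0 \<le> a"
  shows "L2_dominated M (\<lambda>\<omega>. a *\<^sub>R f \<omega>) (a * c)"
proof -
  obtain g where g: "g \<in> borel_measurable M" "AE \<omega> in M. ennreal ((norm (f \<omega>))\<^sup>2) \<le> g \<omega>"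
    "(\<integral>\<^sup>+\<omega>. g \<omega> \<partial>M) \<le> ennreal (c\<^sup>2)"
    using assms(1) unfolding L2_dominated_def by blast
  have "AE \<omega> in M. ennreal ((norm (a *\<^sub>R f \<omega>))\<^sup>2) \<le> ennreal (a\<^sup>2) * g \<omega>"
    using g(2)
    by eventually_elim (auto simp: power_mult_distrib ennreal_mult intro!: mult_left_mono)
  moreover have "(\<integral>\<^sup>+\<omega>. ennreal (a\<^sup>2) * g \<omega> \<partial>M) \<le> ennreal ((a * c)\<^sup>2)"
    using g by (auto simp: nn_integral_cmult power_mult_distrib ennreal_mult intro!: mult_left_mono)
  ultimately show ?thesis using g(1) unfolding L2_dominated_def
    by (intro exI[of _ "\<lambda>\<omega>. ennreal (a\<^sup>2) * g \<omega>"]) auto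
qed

text \<open>Cauchy-Schwarz with free weights; the defect is a square divided by
  \<open>a * b\<close>.\<close>

lemma square_sum_le_weighted:
  fixes u v a b :: real
  assumes "a > 0" "b > 0"
  shows "(u + v)\<^sup>2 \<le> (a + b) * (u\<^sup>2 / a + v\<^sup>2 / b)"
proof -
  have "(a + b) * (u\<^sup>2 / a + v\<^sup>2 / b) - (u + v)\<^sup>2 = (b * u - a * v)\<^sup>2 / (a * b)"
    using assms by (simp add: field_simps power2_eq_square)
  moreover have "\<dots> \<ge> 0" using assms by simp
  ultimately show ?thesis by linarith
qed

text \<open>Minkowski's inequality, argued on majorants: weighting the pointwise inequality by the
  two constants themselves integrates to \<open>(a + b) * (a + b)\<close>. The constants act as
  divisors, hence their strict positivity here and the positive padding of several constants
  below.\<close>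

lemma L2_dominated_add:
  assumes "L2_dominated M f a" "L2_dominated M h b" "a > 0" "b > 0"
  shows "L2_dominated M (\<lambda>\<omega>. f \<omega> + h \<omega>) (a + b)"
proof -
  obtain g where g[measurable]: "g \<in> borel_measurable M"
    and g2: "AE \<omega> in M. ennreal ((norm (f \<omega>))\<^sup>2) \<le> g \<omega>"
    "(\<integral>\<^sup>+\<omega>. g \<omega> \<partial>M) \<le> ennreal (a\<^sup>2)"
    using assms(1) unfolding L2_dominated_def by blast
  obtain k where k[measurable]: "k \<in> borel_measurable M"
    and k2: "AE \<omega> in M. ennreal ((norm (h \<omega>))\<^sup>2) \<le> k \<omega>"
    "(\<integral>\<^sup>+\<omega>. k \<omega> \<partial>M) \<le> ennreal (b\<^sup>2)"
    using assms(2) unfolding L2_dominated_def by blast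
  define G where "G \<omega> = ennreal (a + b) * (ennreal (1 / a) * g \<omega> + ennreal (1 / b) * k \<omega>)" for \<omega>
  have [measurable]: "G \<in> borel_measurable M" unfolding G_def by measurable
  have "AE \<omega> in M. ennreal ((norm (f \<omega> + h \<omega>))\<^sup>2) \<le> G \<omega>"
    using g2(1) k2(1)
  proof eventually_elim
    case (elim \<omega>)
    have "(norm (f \<omega> + h \<omega>))\<^sup>2 \<le> (norm (f \<omega>) + norm (h \<omega>))\<^sup>2"
      by (intro power_mono norm_triangle_ineq) auto
    also have "\<dots> \<le> (a + b) * ((norm (f \<omega>))\<^sup>2 / a + (norm (h \<omega>))\<^sup>2 / b)"
      by (rule square_sum_le_weighted) fact+
    finally have "ennreal ((norm (f \<omega> + h \<omega>))\<^sup>2) \<le>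
        ennreal ((a + b) * (1 / a * (norm (f \<omega>))\<^sup>2 + 1 / b * (norm (h \<omega>))\<^sup>2))"
      by (intro ennreal_leI) simp
    also have "\<dots> = ennreal (a + b) * (ennreal (1 / a) * ennreal ((norm (f \<omega>))\<^sup>2)
        + ennreal (1 / b) * ennreal ((norm (h \<omega>))\<^sup>2))"
      using assms by (simp add: ennreal_mult[symmetric] ennreal_plus[symmetric] del: ennreal_plus)
    also have "\<dots> \<le> G \<omega>" unfolding G_def using elim by (intro mult_left_mono add_mono) auto
    finally show ?case .
  qed
  moreover have "(\<integral>\<^sup>+\<omega>. G \<omega> \<partial>M) \<le> ennreal ((a + b)\<^sup>2)"
  proof -
    have "(\<integral>\<^sup>+\<omega>. G \<omega> \<partial>M) = ennreal (a + b) * (ennreal (1 / a) * (\<integral>\<^sup>+\<omega>. g \<omega> \<partial>M)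
        + ennreal (1 / b) * (\<integral>\<^sup>+\<omega>. k \<omega> \<partial>M))"
      unfolding G_def by (simp add: nn_integral_cmult nn_integral_add)
    also have "\<dots> \<le> ennreal (a + b) * (ennreal (1 / a) * ennreal (a\<^sup>2) + ennreal (1 / b) * ennreal (b\<^sup>2))"
      using g2 k2 by (intro mult_left_mono add_mono) auto
    also have "\<dots> = ennreal ((a + b) * (1 / a * a\<^sup>2 + 1 / b * b\<^sup>2))"
      using assms by (simp add: ennreal_mult[symmetric] ennreal_plus[symmetric] del: ennreal_plus)
    also have "(a + b) * (1 / a * a\<^sup>2 + 1 / b * b\<^sup>2) = (a + b)\<^sup>2"
      using assms by (simp add: power2_eq_square)
    finally show ?thesis .
  qed
  ultimately show ?thesis unfolding L2_dominated_def by (intro exI[of _ G]) auto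
qed

lemma L2_dominated_zero: "L2_dominated M (\<lambda>_. 0) c"
  unfolding L2_dominated_def by (intro exI[of _ "\<lambda>_. 0"]) auto

lemma L2_dominated_sum:
  assumes "finite I" "\<And>i. i \<in> I \<Longrightarrow> L2_dominated M (f i) (c i)" "\<And>i. i \<in> I \<Longrightarrow> c i > 0"
  shows "L2_dominated M (\<lambda>\<omega>. \<Sum>i\<in>I. f i \<omega>) (\<Sum>i\<in>I. c i)"
  using assms
proof (induction rule: finite_induct)
  case empty
  then show ?case by (simp add: L2_dominated_zero)
next
  case (insert i I)
  show ?case
  \<comment> \<open>An empty sum has constant 0, which \<open>L2_dominated_add\<close> does not
    accept.\<close>
  proof (cases "I = {}")
    case True
    then show ?thesis using insert by simp
  next
    case False
    then have "(\<Sum>i\<in>I. c i) > 0" using insert by (intro sum_pos) auto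
    then show ?thesis using insert L2_dominated_add[of M "f i" "c i"] by simp
  qed
qed

text \<open>Fatou's lemma for the majorants: their lower limit is measurable and dominates, although
  nothing is known about measurability of \<open>F\<close>.\<close>

lemma L2_dominated_lim:
  assumes "\<And>m::nat. L2_dominated M (f m) c" "AE \<omega> in M. (\<lambda>m. f m \<omega>) \<longlonglongrightarrow> F \<omega>"
  shows "L2_dominated M F c"
proof -
  have "\<forall>m. \<exists>g. g \<in> borel_measurable M \<and>
     (AE \<omega> in M. ennreal ((norm (f m \<omega>))\<^sup>2) \<le> g \<omega>) \<and> (\<integral>\<^sup>+\<omega>. g \<omega> \<partial>M) \<le> ennreal (c\<^sup>2)"
    using assms(1) unfolding L2_dominated_def by blast
  then obtain g where g[measurable]: "\<And>m. g m \<in> borel_measurable M"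
    and g2: "\<And>m. AE \<omega> in M. ennreal ((norm (f m \<omega>))\<^sup>2) \<le> g m \<omega>"
     "\<And>m. (\<integral>\<^sup>+\<omega>. g m \<omega> \<partial>M) \<le> ennreal (c\<^sup>2)" by metis
  have "AE \<omega> in M. \<forall>m. ennreal ((norm (f m \<omega>))\<^sup>2) \<le> g m \<omega>"
    using g2(1) by (simp add: AE_all_countable)
  then have "AE \<omega> in M. ennreal ((norm (F \<omega>))\<^sup>2) \<le> liminf (\<lambda>m. g m \<omega>)"
    using assms(2)
  proof eventually_elim
    case (elim \<omega>)
    have "(\<lambda>m. ennreal ((norm (f m \<omega>))\<^sup>2)) \<longlonglongrightarrow> ennreal ((norm (F \<omega>))\<^sup>2)"
      by (intro tendsto_ennrealI tendsto_power tendsto_norm elim)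
    then have "ennreal ((norm (F \<omega>))\<^sup>2) = liminf (\<lambda>m. ennreal ((norm (f m \<omega>))\<^sup>2))"
      by (rule lim_imp_Liminf[OF sequentially_bot, symmetric])
    also have "\<dots> \<le> liminf (\<lambda>m. g m \<omega>)" using elim by (intro Liminf_mono) auto
    finally show ?case .
  qed
  moreover have "(\<integral>\<^sup>+\<omega>. liminf (\<lambda>m. g m \<omega>) \<partial>M) \<le> ennreal (c\<^sup>2)"
  proof -
    have "(\<integral>\<^sup>+\<omega>. liminf (\<lambda>m. g m \<omega>) \<partial>M) \<le> liminf (\<lambda>m. \<integral>\<^sup>+\<omega>. g m \<omega> \<partial>M)"
      by (rule nn_integral_liminf) simp
    also have "\<dots> \<le> liminf (\<lambda>m. ennreal (c\<^sup>2))" by (intro Liminf_mono) (use g2 in auto)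
    finally show ?thesis by (simp add: Liminf_const)
  qed
  ultimately show ?thesis unfolding L2_dominated_def
    by (intro exI[of _ "\<lambda>\<omega>. liminf (\<lambda>m. g m \<omega>)"]) auto
qed

lemma L2_dominated_integrable:
  fixes f :: "'w \<Rightarrow> 'b::{real_normed_vector, second_countable_topology}"
  assumes "f \<in> borel_measurable M" "L2_dominated M f c" "c \<ge> 0"
  shows "integrable M (\<lambda>\<omega>. (norm (f \<omega>))\<^sup>2)" "sqrt (\<integral>\<omega>. (norm (f \<omega>))\<^sup>2 \<partial>M) \<le> c"
proof -
  note [measurable] = assms(1)
  obtain g where g: "g \<in> borel_measurable M" "AE \<omega> in M. ennreal ((norm (f \<omega>))\<^sup>2) \<le> g \<omega>"
    "(\<integral>\<^sup>+\<omega>. g \<omega> \<partial>M) \<le> ennreal (c\<^sup>2)"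
    using assms(2) unfolding L2_dominated_def by blast
  have le: "(\<integral>\<^sup>+\<omega>. ennreal ((norm (f \<omega>))\<^sup>2) \<partial>M) \<le> ennreal (c\<^sup>2)"
    using nn_integral_mono_AE[OF g(2)] g(3) by (rule order_trans)
  show int: "integrable M (\<lambda>\<omega>. (norm (f \<omega>))\<^sup>2)"
    using le by (intro integrableI_bounded) (auto simp: le_less_trans)
  have "ennreal (\<integral>\<omega>. (norm (f \<omega>))\<^sup>2 \<partial>M) \<le> ennreal (c\<^sup>2)"
    using le nn_integral_eq_integral[OF int] by simp
  then have "(\<integral>\<omega>. (norm (f \<omega>))\<^sup>2 \<partial>M) \<le> c\<^sup>2"
    by (simp add: ennreal_le_iff)
  then show "sqrt (\<integral>\<omega>. (norm (f \<omega>))\<^sup>2 \<partial>M) \<le> c"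
    using assms(3) by (simp add: real_le_lsqrt)
qed

section \<open>Pathwise integrals as limits of Riemann sums\<close>

lemma integral_eq_sum_cells:
  fixes f :: "real \<Rightarrow> 'b::banach"
  assumes "continuous_on {a..a + real m * d} f" "d \<ge> 0"
  shows "integral {a..a + real m * d} f = (\<Sum>i<m. integral {a + real i * d..a + real (Suc i) * d} f)"
  using assms
proof (induction m)
  case (Suc m)
  have le: "a + real m * d \<le> a + real (Suc m) * d" "a \<le> a + real m * d"
    using Suc.prems(2) by (auto simp: algebra_simps)
  have "integral {a..a + real (Suc m) * d} f =
      integral {a..a + real m * d} f + integral {a + real m * d..a + real (Suc m) * d} f"
    by (rule Henstock_Kurzweil_Integration.integral_combine[symmetric])
      (use le Suc.prems in \<open>auto intro: integrable_continuous_real\<close>)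
  moreover have "continuous_on {a..a + real m * d} f"
    using Suc.prems(1) by (rule continuous_on_subset) (use le in auto)
  ultimately show ?case using Suc.IH Suc.prems(2) by simp
qed auto

text \<open>Exhibits a pathwise integral as a limit of finite combinations of values at fixed times,
  to which Minkowski's inequality and Fatou's lemma apply. By uniform continuity the error of a cell
  is at most \<open>e\<close> times its length.\<close>

lemma riemann_sum_tendsto:
  fixes f :: "real \<Rightarrow> 'b::euclidean_space"
  assumes cont: "continuous_on {a..b} f" and "a < b"
  shows "(\<lambda>m. \<Sum>i<Suc m. ((b - a) / Suc m) *\<^sub>R f (a + real i * ((b - a) / Suc m)))
    \<longlonglongrightarrow> integral {a..b} f"
proof (rule LIMSEQ_I)
  fix r :: real assume "r > 0"
  \<comment> \<open>The 2 leaves a total error of \<open>r / 2\<close>, strictly below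
    \<open>r\<close>.\<close>
  define e where "e = r / (2 * (b - a))"
  have e: "e > 0" using \<open>r > 0\<close> \<open>a < b\<close> by (simp add: e_def)
  have "uniformly_continuous_on {a..b} f" using cont by (intro compact_uniformly_continuous) auto
  then obtain \<delta> where \<delta>: "\<delta> > 0" "\<And>s t. s \<in> {a..b} \<Longrightarrow> t \<in> {a..b} \<Longrightarrow> dist t s < \<delta> \<Longrightarrow> dist (f t) (f s) < e"
    unfolding uniformly_continuous_on_def using e by metis
  obtain n0 :: nat where n0: "(b - a) / \<delta> < real n0" using reals_Archimedean2 by blast
  show "\<exists>no. \<forall>n\<ge>no. norm ((\<Sum>i<Suc n. ((b - a) / Suc n) *\<^sub>R f (a + real i * ((b - a) / Suc n)))
      - integral {a..b} f) < r"
  proof (intro exI allI impI)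
    fix n assume "n \<ge> n0"
    define d where "d = (b - a) / Suc n"
    have d: "d > 0" "real (Suc n) * d = b - a" using \<open>a < b\<close> by (auto simp: d_def)
    have ab: "a + real (Suc n) * d = b" using d(2) by linarith
    have "(b - a) / \<delta> < real (Suc n)" using n0 \<open>n \<ge> n0\<close> by linarith
    then have "d < \<delta>" using \<delta>(1) by (simp add: d_def field_simps)
    have "integral {a..b} f = (\<Sum>i<Suc n. integral {a + real i * d..a + real (Suc i) * d} f)"
      by (rule integral_eq_sum_cells[of a "Suc n" d f, unfolded ab]) (use cont d in auto)
    then have "norm ((\<Sum>i<Suc n. d *\<^sub>R f (a + real i * d)) - integral {a..b} f) =
        norm (\<Sum>i<Suc n. integral {a + real i * d..a + real (Suc i) * d} f - d *\<^sub>R f (a + real i * d))"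
      by (simp only: sum_subtractf norm_minus_commute)
    also have "\<dots> \<le> (\<Sum>i<Suc n. e * d)"
    proof (rule sum_norm_le)
      fix i assume i: "i \<in> {..<Suc n}"
      let ?c = "a + real i * d" and ?c' = "a + real (Suc i) * d"
      have le: "?c' = ?c + d" by (simp add: algebra_simps)
      have "real (Suc i) * d \<le> real (Suc n) * d" using i d by (intro mult_right_mono) auto
      then have "?c' \<le> b" using d(2) by linarith
      moreover have "a \<le> ?c" using d by simp
      ultimately have sub: "{?c..?c'} \<subseteq> {a..b}" unfolding atLeastatMost_subset_iff by blast
      have int: "f integrable_on {?c..?c'}"
        using continuous_on_subset[OF cont sub] by (rule integrable_continuous_real)
      have "norm (integral {?c..?c'} (\<lambda>t. f t - f ?c)) \<le> e * (?c' - ?c)"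
      proof (rule integral_bound)
        show "?c \<le> ?c'" using le d by simp
        show "continuous_on {?c..?c'} (\<lambda>t. f t - f ?c)"
          by (intro continuous_intros continuous_on_subset[OF cont sub])
        fix t assume t: "t \<in> {?c..?c'}"
        have "?c \<in> {?c..?c'}" using le d by simp
        then have "?c \<in> {a..b}" "t \<in> {a..b}" using sub t by blast+
        then have "dist (f t) (f ?c) < e" using t le \<open>d < \<delta>\<close> by (intro \<delta>(2)) (auto simp: dist_real_def)
        then show "norm (f t - f ?c) \<le> e" by (simp add: dist_norm)
      qed
      moreover have "integral {?c..?c'} (\<lambda>t. f t - f ?c) = integral {?c..?c'} f - d *\<^sub>R f ?c"
        using int le d by (subst Henstock_Kurzweil_Integration.integral_diff) (auto simp: content_real)
      ultimately show "norm (integral {?c..?c'} f - d *\<^sub>R f ?c) \<le> e * d" using le by simp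
    qed
    also have "\<dots> = e * (b - a)" using d by (simp add: mult.left_commute)
    also have "\<dots> < r" using \<open>a < b\<close> \<open>r > 0\<close> by (simp add: e_def field_simps)
    finally show "norm ((\<Sum>i<Suc n. ((b - a) / Suc n) *\<^sub>R f (a + real i * ((b - a) / Suc n)))
      - integral {a..b} f) < r" by (simp only: d_def)
  qed
qed

text \<open>Minkowski's integral inequality for a process with continuous paths: Riemann sums obey
  the finite inequality with weights adding up to \<open>b - a\<close>, and domination passes to the
  limit.\<close>

lemma L2_dominated_integral:
  fixes Z :: "real \<Rightarrow> 'w \<Rightarrow> 'b::euclidean_space"
  assumes "a < b" "c > 0" "AE \<omega> in M. continuous_on {a..b} (\<lambda>t. Z t \<omega>)"
    "\<And>t. t \<in> {a..b} \<Longrightarrow> L2_dominated M (Z t) c"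
  shows "L2_dominated M (\<lambda>\<omega>. integral {a..b} (\<lambda>t. Z t \<omega>)) ((b - a) * c)"
proof (rule L2_dominated_lim)
  let ?R = "\<lambda>m \<omega>. \<Sum>i<Suc m. ((b - a) / Suc m) *\<^sub>R Z (a + real i * ((b - a) / Suc m)) \<omega>"
  show "AE \<omega> in M. (\<lambda>m. ?R m \<omega>) \<longlonglongrightarrow> integral {a..b} (\<lambda>t. Z t \<omega>)"
    using assms(3) by eventually_elim (rule riemann_sum_tendsto[OF _ assms(1)])
  fix m :: nat
  have "L2_dominated M (?R m) (\<Sum>i<Suc m. ((b - a) / Suc m) * c)"
  proof (rule L2_dominated_sum)
    fix i assume i: "i \<in> {..<Suc m}"
    have "real i * ((b - a) / Suc m) \<le> real (Suc m) * ((b - a) / Suc m)"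
      using i assms(1) by (intro mult_right_mono) auto
    then have "a + real i * ((b - a) / Suc m) \<in> {a..b}" using assms(1) by auto
    then show "L2_dominated M (\<lambda>\<omega>. ((b - a) / Suc m) *\<^sub>R Z (a + real i * ((b - a) / Suc m)) \<omega>)
        (((b - a) / Suc m) * c)"
      using assms by (intro L2_dominated_scaleR) auto
  qed (use assms in auto)
  also have "(\<Sum>i<Suc m. ((b - a) / Suc m) * c) = (b - a) * c" by simp
  finally show "L2_dominated M (?R m) ((b - a) * c)" .
qed

section \<open>Increments of Brownian motion\<close>

lemma brownian_motionD:
  assumes "brownian_motion M W"
  shows "prob_space M" "\<And>t. t \<ge> 0 \<Longrightarrow> W t \<in> borel_measurable M" "AE \<omega> in M. continuous_on {0..} (\<lambda>t. W t \<omega>)"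
    "\<And>s t. 0 \<le> s \<Longrightarrow> s < t \<Longrightarrow>
       prob_space.indep_vars M (\<lambda>_. borel) (\<lambda>i \<omega>. (W t \<omega> - W s \<omega>) $ i) UNIV"
    "\<And>s t i. 0 \<le> s \<Longrightarrow> s < t \<Longrightarrow>
       distributed M lborel (\<lambda>\<omega>. (W t \<omega> - W s \<omega>) $ i) (normal_density 0 (sqrt (t - s)))"
    "\<And>m (\<tau> :: nat \<Rightarrow> real). 0 \<le> \<tau> 0 \<Longrightarrow> (\<And>i. i < m \<Longrightarrow> \<tau> i < \<tau> (Suc i)) \<Longrightarrow>
       prob_space.indep_vars M (\<lambda>_. borel) (\<lambda>i \<omega>. W (\<tau> (Suc i)) \<omega> - W (\<tau> i) \<omega>) {..<m}"
  using assms unfolding brownian_motion_def by blast+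

lemma (in prob_space) normal_distributed_square:
  assumes "0 < \<sigma>" "distributed M lborel X (normal_density 0 \<sigma>)"
  shows "integrable M X" "integrable M (\<lambda>\<omega>. (X \<omega>)\<^sup>2)" "expectation X = 0" "expectation (\<lambda>\<omega>. (X \<omega>)\<^sup>2) = \<sigma>\<^sup>2"
proof -
  note D = assms(2)
  have nn: "\<And>x. 0 \<le> normal_density 0 \<sigma> x" by simp
  show "integrable M X"
    using distributed_integrable[OF D, of "\<lambda>x. x"] integrable_normal_moment[OF assms(1), of 0 1] by simp
  show "integrable M (\<lambda>\<omega>. (X \<omega>)\<^sup>2)"
    using distributed_integrable[OF D, of "\<lambda>x. x\<^sup>2"] integrable_normal_moment[OF assms(1), of 0 2] by simp
  show E: "expectation X = 0" using normal_distributed_expectation[OF assms] .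
  show "expectation (\<lambda>\<omega>. (X \<omega>)\<^sup>2) = \<sigma>\<^sup>2" using normal_distributed_variance[OF assms] E by simp
qed

context
  fixes M :: "'w measure" and W :: "real \<Rightarrow> 'w \<Rightarrow> real^'n"
  assumes BM: "brownian_motion M W"
begin

interpretation prob_space M by (rule brownian_motionD(1)[OF BM])

lemmas W_measurable = brownian_motionD(2)[OF BM]

lemma increment_moments:
  assumes "0 \<le> s" "s < t"
  shows "integrable M (\<lambda>\<omega>. (W t \<omega> - W s \<omega>) $ i)"
    "integrable M (\<lambda>\<omega>. ((W t \<omega> - W s \<omega>) $ i)\<^sup>2)"
    "expectation (\<lambda>\<omega>. (W t \<omega> - W s \<omega>) $ i) = 0"
    "expectation (\<lambda>\<omega>. ((W t \<omega> - W s \<omega>) $ i)\<^sup>2) = t - s"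
  using normal_distributed_square[OF _ brownian_motionD(5)[OF BM assms, of i]] assms by auto

lemma increment_components_uncorrelated:
  assumes "0 \<le> s" "s < t" "i \<noteq> j"
  shows "integrable M (\<lambda>\<omega>. (W t \<omega> - W s \<omega>) $ i * (W t \<omega> - W s \<omega>) $ j)"
    "expectation (\<lambda>\<omega>. (W t \<omega> - W s \<omega>) $ i * (W t \<omega> - W s \<omega>) $ j) = 0"
proof -
  let ?X = "\<lambda>i \<omega>. (W t \<omega> - W s \<omega>) $ i"
  have ind: "indep_vars (\<lambda>_. borel) ?X {i, j}"
    by (rule indep_vars_subset[OF brownian_motionD(4)[OF BM assms(1,2)]]) simp
  have int: "\<And>k. k \<in> {i, j} \<Longrightarrow> integrable M (?X k)" using increment_moments(1)[OF assms(1,2)] by simp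
  show "integrable M (\<lambda>\<omega>. ?X i \<omega> * ?X j \<omega>)"
    using indep_vars_integrable[OF _ ind int] assms(3) by simp
  show "expectation (\<lambda>\<omega>. ?X i \<omega> * ?X j \<omega>) = 0"
    using indep_vars_lebesgue_integral[OF _ ind int] assms increment_moments(3)[OF assms(1,2)] by simp
qed

text \<open>\<open>brownian_motion\<close> gives independence along consecutive increments of one
  strictly increasing sequence, so both increments are placed in such a sequence, as its first and
  last member.\<close>

lemma disjoint_increments_uncorrelated:
  assumes "0 \<le> s" "s < t" "t \<le> u" "u < v"
  shows "integrable M (\<lambda>\<omega>. (W t \<omega> - W s \<omega>) $ i * (W v \<omega> - W u \<omega>) $ j)"
    "expectation (\<lambda>\<omega>. (W t \<omega> - W s \<omega>) $ i * (W v \<omega> - W u \<omega>) $ j) = 0"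
proof -
  obtain m :: nat and \<tau> :: "nat \<Rightarrow> real" where \<tau>: "0 \<le> \<tau> 0" "\<And>i. i < m \<Longrightarrow> \<tau> i < \<tau> (Suc i)"
    "\<tau> 0 = s" "\<tau> (Suc 0) = t" "\<tau> (m - 1) = u" "\<tau> m = v" "m \<ge> 2"
  \<comment> \<open>For \<open>t = u\<close> the increments are adjacent; otherwise a middle
    increment from \<open>t\<close> to \<open>u\<close> fills the gap.\<close>
  proof (cases "t = u")
    case True
    then show ?thesis using assms
      by (intro that[of "\<lambda>i. if i = 0 then s else if i = 1 then t else v" 2]) (auto simp: less_2_cases_iff)
  next
    case False
    then show ?thesis using assms
      by (intro that[of "\<lambda>i. if i = 0 then s else if i = 1 then t else if i = 2 then u else v" 3])
        (auto simp: numeral_3_eq_3 less_Suc_eq)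
  qed
  define k where "k = m - 1"
  have k: "k \<noteq> 0" "Suc k = m" "k < m" "0 < m" using \<tau>(7) by (auto simp: k_def)
  let ?D = "\<lambda>l \<omega>. W (\<tau> (Suc l)) \<omega> - W (\<tau> l) \<omega>"
  \<comment> \<open>Each increment is read off in its own coordinate, so the coordinate depends on
    the index of the family.\<close>
  define c where "c l = (if l = 0 then i else j)" for l :: nat
  have "indep_vars (\<lambda>_. borel) ?D {..<m}" by (rule brownian_motionD(6)[OF BM \<tau>(1,2)])
  then have "indep_vars (\<lambda>_. borel) ?D {0, k}" by (rule indep_vars_subset) (use k in auto)
  then have ind: "indep_vars (\<lambda>_. borel) (\<lambda>l \<omega>. ?D l \<omega> $ c l) {0, k}"
    by (rule indep_vars_compose2[where Y = "\<lambda>l x. x $ c l"]) simp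
  have eq: "\<tau> (Suc k) = v" "\<tau> k = u" "\<tau> (Suc 0) = t" "\<tau> 0 = s" "c 0 = i" "c k = j"
    using \<tau> k by (auto simp: c_def k_def)
  have int: "\<And>l. l \<in> {0, k} \<Longrightarrow> integrable M (\<lambda>\<omega>. ?D l \<omega> $ c l)"
    using increment_moments(1) assms eq by auto
  have z: "expectation (\<lambda>\<omega>. (W t \<omega> - W s \<omega>) $ i) = 0" by (rule increment_moments(3)) fact+
  show "integrable M (\<lambda>\<omega>. (W t \<omega> - W s \<omega>) $ i * (W v \<omega> - W u \<omega>) $ j)"
    using indep_vars_integrable[OF _ ind int] k(1) eq by simp
  show "expectation (\<lambda>\<omega>. (W t \<omega> - W s \<omega>) $ i * (W v \<omega> - W u \<omega>) $ j) = 0"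
    using indep_vars_lebesgue_integral[OF _ ind int] k(1) eq z by simp
qed

end

section \<open>Orthogonality and the Ito isometry for step functions\<close>

lemma integral_square_sum_orthogonal:
  fixes f :: "'i \<Rightarrow> 'w \<Rightarrow> real"
  assumes "finite I" "\<And>i j. i \<in> I \<Longrightarrow> j \<in> I \<Longrightarrow> integrable M (\<lambda>\<omega>. f i \<omega> * f j \<omega>)"
    "\<And>i j. i \<in> I \<Longrightarrow> j \<in> I \<Longrightarrow> i \<noteq> j \<Longrightarrow> (\<integral>\<omega>. f i \<omega> * f j \<omega> \<partial>M) = 0"
  shows "integrable M (\<lambda>\<omega>. (\<Sum>i\<in>I. f i \<omega>)\<^sup>2)"
    "(\<integral>\<omega>. (\<Sum>i\<in>I. f i \<omega>)\<^sup>2 \<partial>M) = (\<Sum>i\<in>I. \<integral>\<omega>. (f i \<omega>)\<^sup>2 \<partial>M)"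
proof -
  have eq: "(\<Sum>i\<in>I. f i \<omega>)\<^sup>2 = (\<Sum>i\<in>I. \<Sum>j\<in>I. f i \<omega> * f j \<omega>)" for \<omega>
    by (simp add: power2_eq_square sum_product)
  show "integrable M (\<lambda>\<omega>. (\<Sum>i\<in>I. f i \<omega>)\<^sup>2)"
    unfolding eq using assms by (intro Bochner_Integration.integrable_sum) auto
  have "(\<integral>\<omega>. (\<Sum>i\<in>I. f i \<omega>)\<^sup>2 \<partial>M) = (\<Sum>i\<in>I. \<Sum>j\<in>I. \<integral>\<omega>. f i \<omega> * f j \<omega> \<partial>M)"
    unfolding eq using assms
    by (subst Bochner_Integration.integral_sum) (auto intro!: Bochner_Integration.integrable_sum
        sum.cong Bochner_Integration.integral_sum)
  also have "\<dots> = (\<Sum>i\<in>I. \<Sum>j\<in>I. if i = j then \<integral>\<omega>. (f i \<omega>)\<^sup>2 \<partial>M else 0)"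
    using assms(3) by (intro sum.cong refl) (auto simp: power2_eq_square)
  also have "\<dots> = (\<Sum>i\<in>I. \<integral>\<omega>. (f i \<omega>)\<^sup>2 \<partial>M)" using assms(1) by (simp add: sum.delta)
  finally show "(\<integral>\<omega>. (\<Sum>i\<in>I. f i \<omega>)\<^sup>2 \<partial>M) = (\<Sum>i\<in>I. \<integral>\<omega>. (f i \<omega>)\<^sup>2 \<partial>M)" .
qed

lemma norm_vec_square: "(norm (v :: 'b::real_normed_vector^'n))\<^sup>2 = (\<Sum>i\<in>UNIV. (norm (v $ i))\<^sup>2)"
  by (simp add: norm_vec_def L2_set_def sum_nonneg)

text \<open>In each row, the terms indexed by interval and coordinate are pairwise orthogonal:
  within an interval by independence of coordinates, across intervals by independence of increments.
  The library norm of a matrix is the Frobenius norm, which makes the identity exact. Gaps between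
  the intervals are allowed because shortened grid cells, and cells of many partitions at once, are
  summed later.\<close>

lemma ito_isometry_step:
  fixes W :: "real \<Rightarrow> 'w \<Rightarrow> real^'n" and A :: "'i \<Rightarrow> real^'n^'n"
  assumes BM: "brownian_motion M W" and "finite I"
    and ab: "\<And>i. i \<in> I \<Longrightarrow> 0 \<le> a i \<and> a i < b i"
    and disj: "\<And>i j. i \<in> I \<Longrightarrow> j \<in> I \<Longrightarrow> i \<noteq> j \<Longrightarrow> b i \<le> a j \<or> b j \<le> a i"
  shows "(\<integral>\<^sup>+\<omega>. ennreal ((norm (\<Sum>i\<in>I. A i *v (W (b i) \<omega> - W (a i) \<omega>)))\<^sup>2) \<partial>M)
    = ennreal (\<Sum>i\<in>I. (norm (A i))\<^sup>2 * (b i - a i))"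
proof -
  \<comment> \<open>Contribution to row \<open>r\<close> of the pair \<open>p\<close> of an interval
    and a coordinate.\<close>
  define f where "f r p \<omega> = A (fst p) $ r $ (snd p) * (W (b (fst p)) \<omega> - W (a (fst p)) \<omega>) $ (snd p)" for r p \<omega>
  let ?P = "I \<times> (UNIV :: 'n set)"
  have comp: "(\<Sum>i\<in>I. A i *v (W (b i) \<omega> - W (a i) \<omega>)) $ r = (\<Sum>p\<in>?P. f r p \<omega>)" for \<omega> r
    by (simp add: f_def sum_component matrix_vector_mult_def sum.cartesian_product split_def)
  have ff: "f r p \<omega> * f r q \<omega> = (A (fst p) $ r $ snd p * A (fst q) $ r $ snd q) *
      ((W (b (fst p)) \<omega> - W (a (fst p)) \<omega>) $ (snd p) * (W (b (fst q)) \<omega> - W (a (fst q)) \<omega>) $ (snd q))"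
    for r p q \<omega> by (simp add: f_def)
  have int: "integrable M (\<lambda>\<omega>. f r p \<omega> * f r q \<omega>) \<and> (p \<noteq> q \<longrightarrow> (\<integral>\<omega>. f r p \<omega> * f r q \<omega> \<partial>M) = 0)"
    if p: "p \<in> ?P" and q: "q \<in> ?P" for r p q
  proof -
    let ?D = "\<lambda>p \<omega>. (W (b (fst p)) \<omega> - W (a (fst p)) \<omega>) $ (snd p)"
    have pI: "fst p \<in> I" "fst q \<in> I" using p q by auto
    have "integrable M (\<lambda>\<omega>. ?D p \<omega> * ?D q \<omega>) \<and> (p \<noteq> q \<longrightarrow> (\<integral>\<omega>. ?D p \<omega> * ?D q \<omega> \<partial>M) = 0)"
    proof (cases "fst p = fst q")
      case True
      show ?thesis
      proof (cases "snd p = snd q")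
        case True
        then show ?thesis using increment_moments(2)[OF BM, of "a (fst p)" "b (fst p)"] ab[OF pI(1)] \<open>fst p = fst q\<close>
          by (simp add: power2_eq_square prod_eq_iff)
      next
        case False
        then show ?thesis
          using increment_components_uncorrelated[OF BM, of "a (fst p)" "b (fst p)" "snd p" "snd q"] ab[OF pI(1)] True
          by simp
      qed
    next
      case False
      from disj[OF pI False] show ?thesis
      proof
        assume "b (fst p) \<le> a (fst q)"
        then show ?thesis using disjoint_increments_uncorrelated[OF BM, of "a (fst p)" "b (fst p)" "a (fst q)" "b (fst q)"]
          ab[OF pI(1)] ab[OF pI(2)] by auto
      next
        assume "b (fst q) \<le> a (fst p)"
        then show ?thesis using disjoint_increments_uncorrelated[OF BM, of "a (fst q)" "b (fst q)" "a (fst p)" "b (fst p)" "snd q" "snd p"]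
          ab[OF pI(1)] ab[OF pI(2)] by (simp add: mult.commute)
      qed
    qed
    then show ?thesis unfolding ff by auto
  qed
  have fin: "finite ?P" using \<open>finite I\<close> by simp
  note orth = integral_square_sum_orthogonal[OF fin, of M "f r" for r]
  have ir: "integrable M (\<lambda>\<omega>. (\<Sum>p\<in>?P. f r p \<omega>)\<^sup>2)" for r using int by (intro orth(1)) auto
  have er: "(\<integral>\<omega>. (\<Sum>p\<in>?P. f r p \<omega>)\<^sup>2 \<partial>M) = (\<Sum>i\<in>I. (\<Sum>u\<in>UNIV. (A i $ r $ u)\<^sup>2) * (b i - a i))" for r
  proof -
    have "(\<integral>\<omega>. (\<Sum>p\<in>?P. f r p \<omega>)\<^sup>2 \<partial>M) = (\<Sum>p\<in>?P. \<integral>\<omega>. (f r p \<omega>)\<^sup>2 \<partial>M)"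
      using int by (intro orth(2)) auto
    also have "\<dots> = (\<Sum>p\<in>?P. (A (fst p) $ r $ snd p)\<^sup>2 * (b (fst p) - a (fst p)))"
    proof (intro sum.cong refl)
      fix p assume "p \<in> ?P"
      then have "fst p \<in> I" by auto
      then show "(\<integral>\<omega>. (f r p \<omega>)\<^sup>2 \<partial>M) = (A (fst p) $ r $ snd p)\<^sup>2 * (b (fst p) - a (fst p))"
        using increment_moments(4)[OF BM, of "a (fst p)" "b (fst p)" "snd p"] ab[of "fst p"]
        by (simp add: f_def power_mult_distrib)
    qed
    also have "\<dots> = (\<Sum>i\<in>I. \<Sum>u\<in>UNIV. (A i $ r $ u)\<^sup>2 * (b i - a i))"
      by (simp add: sum.cartesian_product split_def)
    finally show ?thesis by (simp add: sum_distrib_right)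
  qed
  have n: "(norm (\<Sum>i\<in>I. A i *v (W (b i) \<omega> - W (a i) \<omega>)))\<^sup>2 = (\<Sum>r\<in>UNIV. (\<Sum>p\<in>?P. f r p \<omega>)\<^sup>2)" for \<omega>
    unfolding norm_vec_square comp by simp
  have "(\<integral>\<^sup>+\<omega>. ennreal ((norm (\<Sum>i\<in>I. A i *v (W (b i) \<omega> - W (a i) \<omega>)))\<^sup>2) \<partial>M)
     = ennreal (\<integral>\<omega>. (\<Sum>r\<in>UNIV. (\<Sum>p\<in>?P. f r p \<omega>)\<^sup>2) \<partial>M)"
    unfolding n using ir by (intro nn_integral_eq_integral Bochner_Integration.integrable_sum) (auto intro!: AE_I2 sum_nonneg)
  also have "(\<integral>\<omega>. (\<Sum>r\<in>UNIV. (\<Sum>p\<in>?P. f r p \<omega>)\<^sup>2) \<partial>M) =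
      (\<Sum>r\<in>UNIV. \<Sum>i\<in>I. (\<Sum>u\<in>UNIV. (A i $ r $ u)\<^sup>2) * (b i - a i))"
    using ir er by (subst Bochner_Integration.integral_sum) auto
  also have "\<dots> = (\<Sum>i\<in>I. (norm (A i))\<^sup>2 * (b i - a i))"
    unfolding norm_vec_square by (subst sum.swap) (simp add: sum_distrib_right)
  finally show ?thesis .
qed

lemma borel_measurable_matrix_vector_mult:
  fixes A :: "real^'n^'m"
  assumes "f \<in> borel_measurable M"
  shows "(\<lambda>\<omega>. A *v f \<omega>) \<in> borel_measurable M"
proof -
  have "(*v) A \<in> borel_measurable borel"
    by (intro borel_measurable_continuous_onI) (rule linear_continuous_on_compose[OF continuous_on_id], simp)
  from measurable_compose[OF assms this] show ?thesis .
qed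

lemma L2_dominated_step:
  fixes W :: "real \<Rightarrow> 'w \<Rightarrow> real^'n" and A :: "'i \<Rightarrow> real^'n^'n"
  assumes BM: "brownian_motion M W" and "finite I"
    and ab: "\<And>i. i \<in> I \<Longrightarrow> 0 \<le> a i \<and> a i < b i"
    and disj: "\<And>i j. i \<in> I \<Longrightarrow> j \<in> I \<Longrightarrow> i \<noteq> j \<Longrightarrow> b i \<le> a j \<or> b j \<le> a i"
    and le: "(\<Sum>i\<in>I. (norm (A i))\<^sup>2 * (b i - a i)) \<le> c\<^sup>2"
  shows "L2_dominated M (\<lambda>\<omega>. \<Sum>i\<in>I. A i *v (W (b i) \<omega> - W (a i) \<omega>)) c"
proof (rule L2_dominatedI)
  show "(\<lambda>\<omega>. \<Sum>i\<in>I. A i *v (W (b i) \<omega> - W (a i) \<omega>)) \<in> borel_measurable M"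
  proof (intro borel_measurable_sum)
    fix i assume "i \<in> I"
    then have [measurable]: "W (b i) \<in> borel_measurable M" "W (a i) \<in> borel_measurable M"
      using W_measurable[OF BM] ab[of i] by auto
    show "(\<lambda>\<omega>. A i *v (W (b i) \<omega> - W (a i) \<omega>)) \<in> borel_measurable M"
      by (intro borel_measurable_matrix_vector_mult) measurable
  qed
  show "(\<integral>\<^sup>+\<omega>. ennreal ((norm (\<Sum>i\<in>I. A i *v (W (b i) \<omega> - W (a i) \<omega>)))\<^sup>2) \<partial>M) \<le> ennreal (c\<^sup>2)"
    using ito_isometry_step[OF BM \<open>finite I\<close> ab disj] le by (auto intro: ennreal_leI)
qed

section \<open>The matrix exponential\<close>

text \<open>Cauchy-Schwarz in every row; the norm of \<open>A\<close> is the Frobenius norm.\<close>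

lemma norm_matrix_vector_mult_le: "norm (A *v x) \<le> norm (A :: real^'n^'m) * norm x"
proof -
  have "(norm (A *v x))\<^sup>2 = (\<Sum>i\<in>UNIV. (A $ i \<bullet> x)\<^sup>2)"
    by (simp add: norm_vec_square matrix_vector_mult_def inner_vec_def)
  also have "\<dots> \<le> (\<Sum>i\<in>UNIV. (norm (A $ i) * norm x)\<^sup>2)"
    by (intro sum_mono abs_le_square_iff[THEN iffD1]) (simp add: Cauchy_Schwarz_ineq2)
  also have "\<dots> = (norm A * norm x)\<^sup>2"
    unfolding power_mult_distrib by (simp only: norm_vec_square[of A] sum_distrib_right)
  finally show ?thesis by (rule power2_le_imp_le) simp
qed

lemma norm_transpose: "norm (transpose A) = norm (A :: real^'n^'m)"
proof -
  have "(norm (transpose A))\<^sup>2 = (norm A)\<^sup>2"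
    unfolding norm_vec_square transpose_def by (subst sum.swap) simp
  then show ?thesis by simp
qed

text \<open>Every row of \<open>A ** B\<close> is the transpose of \<open>B\<close> applied to a row
  of \<open>A\<close>, which reduces the claim to the matrix-vector bound.\<close>

lemma norm_matrix_matrix_mult_le: "norm (A ** B) \<le> norm (A :: real^'n^'m) * norm (B :: real^'k^'n)"
proof -
  have row: "(A ** B) $ i = transpose B *v (A $ i)" for i
    by (simp add: vec_eq_iff matrix_matrix_mult_def matrix_vector_mult_def transpose_def mult.commute)
  have "(norm (A ** B))\<^sup>2 = (\<Sum>i\<in>UNIV. (norm (transpose B *v (A $ i)))\<^sup>2)"
    unfolding norm_vec_square[of "A ** B"] row ..
  also have "\<dots> \<le> (\<Sum>i\<in>UNIV. (norm B * norm (A $ i))\<^sup>2)"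
    using norm_matrix_vector_mult_le[of "transpose B"]
    by (intro sum_mono power_mono) (auto simp: norm_transpose)
  also have "\<dots> = (norm A * norm B)\<^sup>2"
    unfolding power_mult_distrib by (simp only: norm_vec_square[of A] sum_distrib_left mult.commute)
  finally show ?thesis by (rule power2_le_imp_le) simp
qed

text \<open>The factor \<open>norm (mat 1)\<close> cannot be dropped: the Frobenius norm of the
  identity is the square root of the dimension.\<close>

lemma norm_matrix_power_le:
  "norm (((**) A ^^ k) (mat 1)) \<le> norm (A :: real^'n^'n) ^ k * norm (mat 1 :: real^'n^'n)"
proof (induction k)
  case (Suc k)
  have "norm (((**) A ^^ Suc k) (mat 1)) \<le> norm A * norm (((**) A ^^ k) (mat 1))"
    by (simp add: norm_matrix_matrix_mult_le)
  also have "\<dots> \<le> norm A * (norm A ^ k * norm (mat 1 :: real^'n^'n))"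
    by (intro mult_left_mono Suc) simp
  finally show ?case by (simp add: mult.assoc)
qed simp

text \<open>The first two terms of the series are removed, and
  \<open>fact (k + 2) \<ge> fact k\<close> bounds the tail by \<open>(norm A)\<^sup>2\<close> times
  the full exponential series.\<close>

lemma mexp_second_order:
  "norm (mexp A - mat 1 - A) \<le> (norm A)\<^sup>2 * (norm (mat 1 :: real^'n^'n) * exp (norm (A :: real^'n^'n)))"
proof -
  define t where "t k = (1 / fact k) *\<^sub>R (((**) A ^^ k) (mat 1))" for k
  let ?n = "norm (mat 1 :: real^'n^'n)"
  have sume: "(\<lambda>k. norm A ^ k / fact k) sums exp (norm A)"
    using exp_converges[of "norm A"] by (simp add: divide_inverse_commute)
  have nt: "norm (t k) \<le> ?n * (norm A ^ k / fact k)" for k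
    using norm_matrix_power_le[of k A] by (simp add: t_def field_simps)
  have summ: "summable t"
    by (rule summable_comparison_test'[OF sums_summable[OF sums_mult[OF sume]] nt])
  have "mexp A = (\<Sum>k. t k)" by (simp only: mexp_def t_def)
  also have "\<dots> = (\<Sum>k. t (k + 2)) + (\<Sum>k<2. t k)" by (rule suminf_split_initial_segment[OF summ])
  also have "(\<Sum>k<2. t k) = mat 1 + A" by (simp add: t_def eval_nat_numeral)
  finally have eq: "mexp A - mat 1 - A = (\<Sum>k. t (k + 2))" by simp
  have b: "norm (t (k + 2)) \<le> (norm A)\<^sup>2 * ?n * (norm A ^ k / fact k)" for k
  proof -
    have "norm (t (k + 2)) \<le> ?n * (norm A ^ (k + 2) / fact (k + 2))" by (rule nt)
    also have "\<dots> \<le> ?n * (norm A ^ (k + 2) / fact k)"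
      by (intro mult_left_mono divide_left_mono fact_mono) auto
    finally show ?thesis by (simp add: power_add mult_ac power2_eq_square)
  qed
  have "norm (\<Sum>k. t (k + 2)) \<le> (\<Sum>k. (norm A)\<^sup>2 * ?n * (norm A ^ k / fact k))"
    by (rule norm_suminf_le[OF b sums_summable[OF sums_mult[OF sume]]])
  also have "\<dots> = (norm A)\<^sup>2 * ?n * exp (norm A)"
    using sums_mult[OF sume] by (simp add: sums_iff)
  finally show ?thesis unfolding eq by (simp add: mult.assoc)
qed

section \<open>Wiener integrals of integrands close to the identity\<close>

lemma has_wiener_integral_approx:
  assumes "has_wiener_integral M W f a b J" "\<epsilon> > 0"
  obtains N \<tau> A where "\<tau> 0 = a" "\<tau> N = b" "\<And>i. i < N \<Longrightarrow> \<tau> i < \<tau> (Suc i)"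
    "(\<Sum>i<N. \<integral>\<^sup>+s\<in>{\<tau> i<..\<tau> (Suc i)}. ennreal ((norm (A i - f s))\<^sup>2) \<partial>lborel) \<le> ennreal \<epsilon>"
    "(\<integral>\<^sup>+\<omega>. ennreal ((norm ((\<Sum>i<N. A i *v (W (\<tau> (Suc i)) \<omega> - W (\<tau> i) \<omega>)) - J \<omega>))\<^sup>2) \<partial>M) \<le> ennreal \<epsilon>"
proof -
  obtain N :: "nat \<Rightarrow> nat" and \<tau> :: "nat \<Rightarrow> nat \<Rightarrow> real" and A where *:
    "\<And>j. \<tau> j 0 = a \<and> \<tau> j (N j) = b \<and> (\<forall>i<N j. \<tau> j i < \<tau> j (Suc i))"
    "(\<lambda>j. \<Sum>i<N j. \<integral>\<^sup>+s\<in>{\<tau> j i<..\<tau> j (Suc i)}. ennreal ((norm (A j i - f s))\<^sup>2) \<partial>lborel) \<longlonglongrightarrow> 0"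
    "(\<lambda>j. \<integral>\<^sup>+\<omega>. ennreal ((norm ((\<Sum>i<N j. A j i *v (W (\<tau> j (Suc i)) \<omega> - W (\<tau> j i) \<omega>))
                - J \<omega>))\<^sup>2) \<partial>M) \<longlonglongrightarrow> 0"
    using assms(1) unfolding has_wiener_integral_def by blast
  have e: "(0::ennreal) < ennreal \<epsilon>" using assms(2) by simp
  have "eventually (\<lambda>j. (\<Sum>i<N j. \<integral>\<^sup>+s\<in>{\<tau> j i<..\<tau> j (Suc i)}. ennreal ((norm (A j i - f s))\<^sup>2) \<partial>lborel) < ennreal \<epsilon>
     \<and> (\<integral>\<^sup>+\<omega>. ennreal ((norm ((\<Sum>i<N j. A j i *v (W (\<tau> j (Suc i)) \<omega> - W (\<tau> j i) \<omega>))
                - J \<omega>))\<^sup>2) \<partial>M) < ennreal \<epsilon>) sequentially"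
    by (intro eventually_conj order_tendstoD(2)[OF *(2) e] order_tendstoD(2)[OF *(3) e])
  then obtain j where "(\<Sum>i<N j. \<integral>\<^sup>+s\<in>{\<tau> j i<..\<tau> j (Suc i)}. ennreal ((norm (A j i - f s))\<^sup>2) \<partial>lborel) < ennreal \<epsilon>"
     "(\<integral>\<^sup>+\<omega>. ennreal ((norm ((\<Sum>i<N j. A j i *v (W (\<tau> j (Suc i)) \<omega> - W (\<tau> j i) \<omega>))
                - J \<omega>))\<^sup>2) \<partial>M) < ennreal \<epsilon>"
    by (auto simp: eventually_sequentially)
  then show ?thesis using *(1)[of j] by (intro that[of "\<tau> j" "N j" "A j"]) auto
qed

lemma partition_mono:
  fixes \<tau> :: "nat \<Rightarrow> real"
  assumes "\<And>i. i < N \<Longrightarrow> \<tau> i < \<tau> (Suc i)" "i \<le> j" "j \<le> N"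
  shows "\<tau> i \<le> \<tau> j"
  using assms(2,3)
proof (induction rule: dec_induct)
  case (step n)
  then show ?case using assms(1)[of n] by simp
qed simp

text \<open>Comparing the integrand \<open>|A\<^sub>i - f|\<^sup>2\<close> with the constant \<open>|A\<^sub>i - 1|\<^sup>2 / 2 - c\<^sup>2\<close> from below avoids
  any measurability assumption on \<open>f\<close>.\<close>

lemma step_function_near_identity:
  fixes A :: "nat \<Rightarrow> real^'n^'n"
  assumes mono: "\<And>i. i < N \<Longrightarrow> \<tau> i < \<tau> (Suc i)" and "\<epsilon> > 0"
    and approx: "(\<Sum>i<N. \<integral>\<^sup>+s\<in>{\<tau> i<..\<tau> (Suc i)}. ennreal ((norm (A i - f s))\<^sup>2) \<partial>lborel) \<le> ennreal \<epsilon>"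
    and near: "\<And>s. s \<in> {\<tau> 0<..\<tau> N} \<Longrightarrow> norm (f s - mat 1) \<le> c"
  shows "(\<Sum>i<N. (norm (A i - mat 1))\<^sup>2 * (\<tau> (Suc i) - \<tau> i)) \<le> 2 * \<epsilon> + 2 * c\<^sup>2 * (\<tau> N - \<tau> 0)"
proof -
  define q where "q i = max 0 ((norm (A i - mat 1))\<^sup>2 / 2 - c\<^sup>2)" for i
  have "(\<Sum>i<N. ennreal (q i * (\<tau> (Suc i) - \<tau> i))) \<le>
      (\<Sum>i<N. \<integral>\<^sup>+s\<in>{\<tau> i<..\<tau> (Suc i)}. ennreal ((norm (A i - f s))\<^sup>2) \<partial>lborel)"
  proof (rule sum_mono)
    fix i assume i: "i \<in> {..<N}"
    then have lt: "\<tau> i < \<tau> (Suc i)" using mono by simp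
    have "ennreal (q i * (\<tau> (Suc i) - \<tau> i)) = (\<integral>\<^sup>+s\<in>{\<tau> i<..\<tau> (Suc i)}. ennreal (q i) \<partial>lborel)"
      using lt by (simp add: nn_integral_cmult_indicator ennreal_mult q_def)
    also have "\<dots> \<le> (\<integral>\<^sup>+s\<in>{\<tau> i<..\<tau> (Suc i)}. ennreal ((norm (A i - f s))\<^sup>2) \<partial>lborel)"
    proof (rule nn_integral_mono)
      fix s
      show "ennreal (q i) * indicator {\<tau> i<..\<tau> (Suc i)} s \<le> ennreal ((norm (A i - f s))\<^sup>2) * indicator {\<tau> i<..\<tau> (Suc i)} s"
      proof (cases "s \<in> {\<tau> i<..\<tau> (Suc i)}")
        case True
        have "\<tau> 0 \<le> \<tau> i" "\<tau> (Suc i) \<le> \<tau> N" using i by (auto intro!: partition_mono[of N \<tau>] mono)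
        then have n: "norm (f s - mat 1) \<le> c" using True by (intro near) auto
        have "norm (A i - mat 1) \<le> norm (A i - f s) + c"
          using n norm_triangle_ineq[of "A i - f s" "f s - mat 1"] by simp
        then have "(norm (A i - mat 1))\<^sup>2 \<le> (norm (A i - f s) + c)\<^sup>2" by (intro power_mono) auto
        also have "\<dots> \<le> 2 * (norm (A i - f s))\<^sup>2 + 2 * c\<^sup>2"
          using sum_squares_bound[of "norm (A i - f s)" c] by (simp add: power2_sum)
        finally have "q i \<le> (norm (A i - f s))\<^sup>2" by (simp add: q_def)
        then show ?thesis using True by (simp add: ennreal_leI)
      qed simp
    qed
    finally show "ennreal (q i * (\<tau> (Suc i) - \<tau> i)) \<le>
      (\<integral>\<^sup>+s\<in>{\<tau> i<..\<tau> (Suc i)}. ennreal ((norm (A i - f s))\<^sup>2) \<partial>lborel)" .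
  qed
  also note approx
  finally have "ennreal (\<Sum>i<N. q i * (\<tau> (Suc i) - \<tau> i)) \<le> ennreal \<epsilon>"
    using mono by (subst sum_ennreal[symmetric]) (auto simp: q_def less_imp_le)
  then have qs: "(\<Sum>i<N. q i * (\<tau> (Suc i) - \<tau> i)) \<le> \<epsilon>" using \<open>\<epsilon> > 0\<close> by (simp add: ennreal_le_iff)
  have "(\<Sum>i<N. (norm (A i - mat 1))\<^sup>2 * (\<tau> (Suc i) - \<tau> i)) \<le>
      (\<Sum>i<N. (2 * q i + 2 * c\<^sup>2) * (\<tau> (Suc i) - \<tau> i))"
  proof (intro sum_mono mult_right_mono)
    fix i assume "i \<in> {..<N}"
    then show "0 \<le> \<tau> (Suc i) - \<tau> i" using mono[of i] by simp
    have "(norm (A i - mat 1))\<^sup>2 / 2 - c\<^sup>2 \<le> q i" by (simp add: q_def)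
    then show "(norm (A i - mat 1))\<^sup>2 \<le> 2 * q i + 2 * c\<^sup>2" by simp
  qed
  also have "\<dots> = 2 * (\<Sum>i<N. q i * (\<tau> (Suc i) - \<tau> i)) + 2 * c\<^sup>2 * (\<Sum>i<N. \<tau> (Suc i) - \<tau> i)"
    by (simp only: distrib_right sum.distrib sum_distrib_left mult.assoc)
  also have "(\<Sum>i<N. \<tau> (Suc i) - \<tau> i) = \<tau> N - \<tau> 0" by (rule sum_lessThan_telescope)
  finally show ?thesis using qs by linarith
qed

text \<open>Each \<open>J k\<close> is replaced by a step sum \<open>S k\<close> so close to it that
  even the triangle inequality over all \<open>k\<close> costs only \<open>c * sqrt T\<close>. The
  difference of \<open>S k\<close> and the Brownian increment is the integral of a step function
  \<open>A - 1\<close>; the isometry over all cells at once bounds the sum of these by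
  \<open>2 * (c * sqrt T)\<close>. The number of intervals thus drops out and only their total
  length remains.\<close>

lemma L2_dominated_wiener_sum:
  fixes W :: "real \<Rightarrow> 'w \<Rightarrow> real^'n"
  assumes BM: "brownian_motion M W" and "finite I"
    and wi: "\<And>k. k \<in> I \<Longrightarrow> has_wiener_integral M W (f k) (a k) (b k) (J k)"
    and ab: "\<And>k. k \<in> I \<Longrightarrow> 0 \<le> a k \<and> a k < b k"
    and disj: "\<And>k l. k \<in> I \<Longrightarrow> l \<in> I \<Longrightarrow> k \<noteq> l \<Longrightarrow> b k \<le> a l \<or> b l \<le> a k"
    and near: "\<And>k s. k \<in> I \<Longrightarrow> s \<in> {a k<..b k} \<Longrightarrow> norm (f k s - mat 1) \<le> c"
    and "c > 0" "T > 0" and T: "(\<Sum>k\<in>I. b k - a k) \<le> T"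
  shows "L2_dominated M (\<lambda>\<omega>. \<Sum>k\<in>I. J k \<omega> - (W (b k) \<omega> - W (a k) \<omega>)) (3 * (c * sqrt T))"
proof -
  \<comment> \<open>The extra 1 keeps \<open>K\<close> positive when \<open>I\<close> is
    empty.\<close>
  define K where "K = real (card I) + 1"
  define e where "e = c * sqrt T / K"
  \<comment> \<open>The first bound makes each \<open>J k - S k\<close> at most \<open>e\<close> in
    mean square norm; the second keeps the sum of the defects \<open>\<epsilon>\<close> in the
    isometry below \<open>c\<^sup>2 * T\<close>.\<close>
  define \<epsilon> where "\<epsilon> = min (e\<^sup>2) (c\<^sup>2 * T / K)"
  have K: "K > 0" "real (card I) \<le> K" by (auto simp: K_def add_nonneg_pos)
  have cT: "c * sqrt T > 0" using assms by simp
  have e: "e > 0" "\<epsilon> > 0" using K cT assms by (auto simp: e_def \<epsilon>_def)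
  let ?P = "\<lambda>k s. case s of (N :: nat, \<tau> :: nat \<Rightarrow> real, A :: nat \<Rightarrow> real^'n^'n) \<Rightarrow>
    \<tau> 0 = a k \<and> \<tau> N = b k \<and> (\<forall>i<N. \<tau> i < \<tau> (Suc i)) \<and>
    (\<Sum>i<N. \<integral>\<^sup>+s\<in>{\<tau> i<..\<tau> (Suc i)}. ennreal ((norm (A i - f k s))\<^sup>2) \<partial>lborel) \<le> ennreal \<epsilon> \<and>
    (\<integral>\<^sup>+\<omega>. ennreal ((norm ((\<Sum>i<N. A i *v (W (\<tau> (Suc i)) \<omega> - W (\<tau> i) \<omega>)) - J k \<omega>))\<^sup>2) \<partial>M) \<le> ennreal \<epsilon>"
  have "\<forall>k\<in>I. \<exists>s. ?P k s"
  proof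
    fix k assume "k \<in> I"
    obtain N \<tau> A where s: "\<tau> 0 = a k" "\<tau> N = b k" "\<And>i. i < N \<Longrightarrow> \<tau> i < \<tau> (Suc i)"
      "(\<Sum>i<N. \<integral>\<^sup>+s\<in>{\<tau> i<..\<tau> (Suc i)}. ennreal ((norm (A i - f k s))\<^sup>2) \<partial>lborel) \<le> ennreal \<epsilon>"
      "(\<integral>\<^sup>+\<omega>. ennreal ((norm ((\<Sum>i<N. A i *v (W (\<tau> (Suc i)) \<omega> - W (\<tau> i) \<omega>)) - J k \<omega>))\<^sup>2) \<partial>M) \<le> ennreal \<epsilon>"
      by (rule has_wiener_integral_approx[OF wi[OF \<open>k \<in> I\<close>] e(2)]) (rule that; simp)
    then have "?P k (N, \<tau>, A)" by simp
    then show "\<exists>s. ?P k s" ..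
  qed
  from bchoice[OF this] obtain s where s: "\<forall>k\<in>I. ?P k (s k)" ..
  define N \<tau> A where "N k = fst (s k)" and "\<tau> k = fst (snd (s k))" and "A k = snd (snd (s k))" for k
  have st: "\<tau> k 0 = a k" "\<tau> k (N k) = b k" "\<And>i. i < N k \<Longrightarrow> \<tau> k i < \<tau> k (Suc i)"
    "(\<Sum>i<N k. \<integral>\<^sup>+s\<in>{\<tau> k i<..\<tau> k (Suc i)}. ennreal ((norm (A k i - f k s))\<^sup>2) \<partial>lborel) \<le> ennreal \<epsilon>"
    "(\<integral>\<^sup>+\<omega>. ennreal ((norm ((\<Sum>i<N k. A k i *v (W (\<tau> k (Suc i)) \<omega> - W (\<tau> k i) \<omega>)) - J k \<omega>))\<^sup>2) \<partial>M) \<le> ennreal \<epsilon>"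
    if "k \<in> I" for k
    using bspec[OF s that] by (simp_all add: N_def \<tau>_def A_def split_def)
  define S where "S k \<omega> = (\<Sum>i<N k. A k i *v (W (\<tau> k (Suc i)) \<omega> - W (\<tau> k i) \<omega>))" for k \<omega>
  have bounds: "a k \<le> \<tau> k i" "\<tau> k i \<le> b k" if "k \<in> I" "i \<le> N k" for k i
    using partition_mono[of "N k" "\<tau> k" 0 i] partition_mono[of "N k" "\<tau> k" i "N k"] st(1-3)[OF that(1)] that
    by auto
  have Wm: "W (\<tau> k i) \<in> borel_measurable M" if "k \<in> I" "i \<le> N k" for k i
    using bounds[OF that] ab[OF that(1)] by (intro W_measurable[OF BM]) auto
  have 1: "L2_dominated M (\<lambda>\<omega>. J k \<omega> - S k \<omega>) e" if k: "k \<in> I" for k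
  proof (rule L2_dominatedI)
    have [measurable]: "J k \<in> borel_measurable M" using wi[OF k] by (simp add: has_wiener_integral_def)
    have [measurable]: "S k \<in> borel_measurable M" unfolding S_def
    proof (intro borel_measurable_sum)
      fix i assume "i \<in> {..<N k}"
      then have [measurable]: "W (\<tau> k (Suc i)) \<in> borel_measurable M" "W (\<tau> k i) \<in> borel_measurable M"
        using Wm[OF k] by auto
      show "(\<lambda>\<omega>. A k i *v (W (\<tau> k (Suc i)) \<omega> - W (\<tau> k i) \<omega>)) \<in> borel_measurable M"
        by (intro borel_measurable_matrix_vector_mult) measurable
    qed
    show "(\<lambda>\<omega>. J k \<omega> - S k \<omega>) \<in> borel_measurable M" by measurable
    have "(\<integral>\<^sup>+\<omega>. ennreal ((norm (J k \<omega> - S k \<omega>))\<^sup>2) \<partial>M) \<le> ennreal \<epsilon>"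
      using st(5)[OF k] unfolding S_def[symmetric] by (simp add: norm_minus_commute)
    also have "\<dots> \<le> ennreal (e\<^sup>2)" by (intro ennreal_leI) (simp add: \<epsilon>_def)
    finally show "(\<integral>\<^sup>+\<omega>. ennreal ((norm (J k \<omega> - S k \<omega>))\<^sup>2) \<partial>M) \<le> ennreal (e\<^sup>2)" .
  qed
  have "L2_dominated M (\<lambda>\<omega>. \<Sum>k\<in>I. J k \<omega> - S k \<omega>) (\<Sum>k\<in>I. e)"
    using 1 e \<open>finite I\<close> by (intro L2_dominated_sum) auto
  moreover have "(\<Sum>k\<in>I. e) \<le> c * sqrt T"
  proof -
    have "(\<Sum>k\<in>I. e) = real (card I) * e" by simp
    also have "\<dots> \<le> K * e" using K e by (intro mult_right_mono) auto
    finally show ?thesis using K by (simp add: e_def)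
  qed
  moreover have "0 \<le> (\<Sum>k\<in>I. e)" using e by (simp add: sum_nonneg)
  ultimately have X: "L2_dominated M (\<lambda>\<omega>. \<Sum>k\<in>I. J k \<omega> - S k \<omega>) (c * sqrt T)"
    by (elim L2_dominated_mono) auto
  \<comment> \<open>All cells of all partitions together, as one non-overlapping family.\<close>
  let ?P = "SIGMA k:I. {..<N k}"
  have "L2_dominated M (\<lambda>\<omega>. \<Sum>p\<in>?P. (A (fst p) (snd p) - mat 1) *v
      (W (\<tau> (fst p) (Suc (snd p))) \<omega> - W (\<tau> (fst p) (snd p)) \<omega>)) (2 * (c * sqrt T))"
  proof (rule L2_dominated_step[OF BM])
    show "finite ?P" using \<open>finite I\<close> by auto
    fix p assume p: "p \<in> ?P"
    have "0 \<le> a (fst p)" "a (fst p) \<le> \<tau> (fst p) (snd p)" using p ab bounds by auto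
    then show "0 \<le> \<tau> (fst p) (snd p) \<and> \<tau> (fst p) (snd p) < \<tau> (fst p) (Suc (snd p))"
      using p st(3) by auto
    fix q assume q: "q \<in> ?P" and "p \<noteq> q"
    have pI: "fst p \<in> I" "snd p < N (fst p)" and qI: "fst q \<in> I" "snd q < N (fst q)" using p q by auto
    show "\<tau> (fst p) (Suc (snd p)) \<le> \<tau> (fst q) (snd q) \<or> \<tau> (fst q) (Suc (snd q)) \<le> \<tau> (fst p) (snd p)"
    proof (cases "fst p = fst q")
      case False
      have "a (fst p) \<le> \<tau> (fst p) (snd p)" "a (fst q) \<le> \<tau> (fst q) (snd q)"
        "\<tau> (fst p) (Suc (snd p)) \<le> b (fst p)" "\<tau> (fst q) (Suc (snd q)) \<le> b (fst q)"
        using bounds pI qI by auto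
      then show ?thesis using disj[OF pI(1) qI(1) False] by linarith
    next
      case True
      then have "snd p \<noteq> snd q" using \<open>p \<noteq> q\<close> by (simp add: prod_eq_iff)
      then have "Suc (snd p) \<le> snd q \<or> Suc (snd q) \<le> snd p" by linarith
      then show ?thesis
        using partition_mono[of "N (fst p)" "\<tau> (fst p)" "Suc (snd p)" "snd q"]
          partition_mono[of "N (fst p)" "\<tau> (fst p)" "Suc (snd q)" "snd p"] st(3)[OF pI(1)] pI qI True by auto
    qed
  next
    have "(\<Sum>p\<in>?P. (norm (A (fst p) (snd p) - mat 1))\<^sup>2 * (\<tau> (fst p) (Suc (snd p)) - \<tau> (fst p) (snd p)))
      = (\<Sum>k\<in>I. \<Sum>i<N k. (norm (A k i - mat 1))\<^sup>2 * (\<tau> k (Suc i) - \<tau> k i))"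
      using \<open>finite I\<close> by (simp add: sum.Sigma split_def)
    also have "\<dots> \<le> (\<Sum>k\<in>I. 2 * \<epsilon> + 2 * c\<^sup>2 * (b k - a k))"
    proof (rule sum_mono)
      fix k assume k: "k \<in> I"
      show "(\<Sum>i<N k. (norm (A k i - mat 1))\<^sup>2 * (\<tau> k (Suc i) - \<tau> k i)) \<le> 2 * \<epsilon> + 2 * c\<^sup>2 * (b k - a k)"
        using step_function_near_identity[of "N k" "\<tau> k" \<epsilon> "A k" "f k" c] st(1-4)[OF k] near[OF k] e(2) by simp
    qed
    also have "\<dots> = 2 * (real (card I) * \<epsilon>) + 2 * c\<^sup>2 * (\<Sum>k\<in>I. b k - a k)"
      by (simp add: sum.distrib sum_distrib_left)
    also have "\<dots> \<le> 2 * (c\<^sup>2 * T) + 2 * c\<^sup>2 * T"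
    proof (intro add_mono mult_left_mono T)
      have "real (card I) * \<epsilon> \<le> K * (c\<^sup>2 * T / K)" using K e by (intro mult_mono) (auto simp: \<epsilon>_def)
      then show "real (card I) * \<epsilon> \<le> c\<^sup>2 * T" using K by simp
    qed auto
    also have "\<dots> = (2 * (c * sqrt T))\<^sup>2" using \<open>T > 0\<close> by (simp add: power_mult_distrib)
    finally show "(\<Sum>p\<in>?P. (norm (A (fst p) (snd p) - mat 1))\<^sup>2 * (\<tau> (fst p) (Suc (snd p)) - \<tau> (fst p) (snd p)))
      \<le> (2 * (c * sqrt T))\<^sup>2" .
  qed
  moreover have "(\<Sum>p\<in>?P. (A (fst p) (snd p) - mat 1) *v
      (W (\<tau> (fst p) (Suc (snd p))) \<omega> - W (\<tau> (fst p) (snd p)) \<omega>)) = (\<Sum>k\<in>I. S k \<omega> - (W (b k) \<omega> - W (a k) \<omega>))" for \<omega>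
  proof -
    have "(\<Sum>p\<in>?P. (A (fst p) (snd p) - mat 1) *v
      (W (\<tau> (fst p) (Suc (snd p))) \<omega> - W (\<tau> (fst p) (snd p)) \<omega>)) =
      (\<Sum>k\<in>I. \<Sum>i<N k. (A k i - mat 1) *v (W (\<tau> k (Suc i)) \<omega> - W (\<tau> k i) \<omega>))"
      using \<open>finite I\<close> by (simp add: sum.Sigma split_def)
    also have "\<dots> = (\<Sum>k\<in>I. S k \<omega> - (W (b k) \<omega> - W (a k) \<omega>))"
    proof (intro sum.cong refl)
      fix k assume k: "k \<in> I"
      \<comment> \<open>By telescoping, the Brownian increment is a step sum on the same partition,
        with the identity as its matrix.\<close>
      have "(\<Sum>i<N k. W (\<tau> k (Suc i)) \<omega> - W (\<tau> k i) \<omega>) = W (b k) \<omega> - W (a k) \<omega>"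
        using sum_lessThan_telescope[of "\<lambda>i. W (\<tau> k i) \<omega>" "N k"] st(1,2)[OF k] by simp
      then show "(\<Sum>i<N k. (A k i - mat 1) *v (W (\<tau> k (Suc i)) \<omega> - W (\<tau> k i) \<omega>)) = S k \<omega> - (W (b k) \<omega> - W (a k) \<omega>)"
        by (simp only: S_def matrix_vector_mult_diff_rdistrib matrix_vector_mul_lid sum_subtractf)
    qed
    finally show ?thesis .
  qed
  ultimately have Y: "L2_dominated M (\<lambda>\<omega>. \<Sum>k\<in>I. S k \<omega> - (W (b k) \<omega> - W (a k) \<omega>)) (2 * (c * sqrt T))" by simp
  have "L2_dominated M (\<lambda>\<omega>. (\<Sum>k\<in>I. J k \<omega> - S k \<omega>) + (\<Sum>k\<in>I. S k \<omega> - (W (b k) \<omega> - W (a k) \<omega>)))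
      (c * sqrt T + 2 * (c * sqrt T))"
    by (rule L2_dominated_add[OF X Y]) (use cT in auto)
  moreover have "(\<Sum>k\<in>I. J k \<omega> - S k \<omega>) + (\<Sum>k\<in>I. S k \<omega> - (W (b k) \<omega> - W (a k) \<omega>)) =
      (\<Sum>k\<in>I. J k \<omega> - (W (b k) \<omega> - W (a k) \<omega>))" for \<omega>
    by (simp add: sum_subtractf)
  ultimately show ?thesis by simp
qed

section \<open>Gronwall inequalities and one-step expansions\<close>

text \<open>The induction runs on the partial sums of \<open>e\<close>, which satisfy a linear
  recursion with factor \<open>1 + c\<close>. The bound stays linear in the individual
  \<open>a i\<close> and assumes no monotonicity of \<open>a\<close>, as the random sources are
  later estimated one by one in mean square.\<close>

lemma discrete_gronwall:
  fixes e a :: "nat \<Rightarrow> real"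
  assumes "c \<ge> 0" "\<And>j. a j \<ge> 0" "\<And>j. j \<le> k \<Longrightarrow> e j \<le> a j + c * (\<Sum>i<j. e i)"
  shows "e k \<le> a k + c * (1 + c) ^ k * (\<Sum>i<k. a i)"
proof -
  have "(\<Sum>i<j. e i) \<le> (1 + c) ^ j * (\<Sum>i<j. a i)" if "j \<le> k" for j
    using that
  proof (induction j)
    case (Suc j)
    let ?S = "\<Sum>i<j. e i" and ?A = "\<Sum>i<j. a i"
    have "(\<Sum>i<Suc j. e i) \<le> (1 + c) * ?S + a j"
      using assms(3)[of j] Suc.prems by (simp add: distrib_right)
    also have "\<dots> \<le> (1 + c) * ((1 + c) ^ j * ?A) + a j"
      using Suc assms(1) by (intro add_right_mono mult_left_mono) auto
    also have "a j \<le> (1 + c) ^ Suc j * a j"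
      using assms one_le_power[of "1 + c" "Suc j"] mult_right_mono[of 1 "(1 + c) ^ Suc j" "a j"] by simp
    finally show ?case by (simp add: distrib_left mult.assoc)
  qed simp
  from mult_left_mono[OF this[of k] assms(1)] show ?thesis
    using assms(3)[of k] by (simp add: mult.assoc)
qed

text \<open>Linearity in \<open>\<alpha>\<close> is the point: \<open>\<alpha>\<close> will contain
  the driving path, and the bound can then be taken in mean square.\<close>

lemma gronwall_integral:
  fixes y \<alpha> :: "real \<Rightarrow> real"
  assumes cont: "continuous_on {0..T} y" "continuous_on {0..T} \<alpha>"
    and "\<Lambda> \<ge> 0" and nonneg: "\<And>t. t \<in> {0..T} \<Longrightarrow> \<alpha> t \<ge> 0"
    and le: "\<And>t. t \<in> {0..T} \<Longrightarrow> y t \<le> \<alpha> t + \<Lambda> * integral {0..t} y"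
    and t: "t \<in> {0..T}"
  shows "y t \<le> \<alpha> t + \<Lambda> * exp (\<Lambda> * t) * integral {0..t} \<alpha>"
proof -
  define V where "V s = integral {0..s} y" for s
  \<comment> \<open>Discounting the integral \<open>V\<close> of \<open>y\<close> by
    \<open>exp (- \<Lambda> * s)\<close> makes the derivative of \<open>G\<close> nonnegative, since
    \<open>y s - \<Lambda> * V s \<le> \<alpha> s\<close>. As \<open>G 0 = 0\<close>, this gives the
    bound on \<open>V t\<close>.\<close>
  define G where "G s = integral {0..s} \<alpha> - exp (- \<Lambda> * s) * V s" for s
  define G' where "G' s = \<alpha> s - exp (- \<Lambda> * s) * (y s - \<Lambda> * V s)" for s
  have der: "(G has_vector_derivative G' s) (at s within {0..t})" if s: "s \<in> {0..t}" for s
  proof -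
    have sub: "{0..t} \<subseteq> {0..T}" using t by auto
    note [derivative_intros] =
      integral_has_real_derivative[OF continuous_on_subset[OF cont(1) sub] s, folded V_def]
      integral_has_real_derivative[OF continuous_on_subset[OF cont(2) sub] s]
    have "(G has_real_derivative G' s) (at s within {0..t})"
      unfolding G_def G'_def by (auto intro!: derivative_eq_intros simp: algebra_simps)
    then show ?thesis by (simp add: has_real_derivative_iff_has_vector_derivative)
  qed
  have G'_nonneg: "G' s \<ge> 0" if s: "s \<in> {0..t}" for s
  proof -
    have sT: "s \<in> {0..T}" using s t by auto
    have "exp (- \<Lambda> * s) * (y s - \<Lambda> * V s) \<le> exp (- \<Lambda> * s) * \<alpha> s"
      using le[OF sT] by (intro mult_left_mono) (auto simp: V_def)
    also have "\<dots> \<le> 1 * \<alpha> s" using nonneg[OF sT] s \<open>\<Lambda> \<ge> 0\<close> by (intro mult_right_mono) auto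
    finally show ?thesis by (simp add: G'_def)
  qed
  have "(G' has_integral (G t - G 0)) {0..t}"
    using t der by (intro fundamental_theorem_of_calculus) auto
  then have "0 \<le> G t - G 0" using G'_nonneg by (rule has_integral_nonneg)
  then have "exp (- \<Lambda> * t) * V t \<le> integral {0..t} \<alpha>" by (simp add: G_def V_def)
  then have "exp (\<Lambda> * t) * (exp (- \<Lambda> * t) * V t) \<le> exp (\<Lambda> * t) * integral {0..t} \<alpha>"
    by (intro mult_left_mono) auto
  then have "V t \<le> exp (\<Lambda> * t) * integral {0..t} \<alpha>"
    by (simp add: mult.assoc[symmetric] exp_add[symmetric])
  then have "\<Lambda> * V t \<le> \<Lambda> * exp (\<Lambda> * t) * integral {0..t} \<alpha>"
    using mult_left_mono[OF _ \<open>\<Lambda> \<ge> 0\<close>] by (simp add: mult.assoc)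
  then show ?thesis using le[OF t] by (simp add: V_def)
qed

text \<open>The largest displacement \<open>m\<close> on \<open>[0, h]\<close> satisfies
  \<open>m \<le> h * norm (F (v 0)) + h * (\<Lambda> * m)\<close>. The smallness of
  \<open>\<Lambda> * h\<close> lets the last term be absorbed, so \<open>m\<close> is of order
  \<open>h\<close>, and the drift varies by at most \<open>\<Lambda> * m\<close>.\<close>

lemma flow_second_order:
  fixes v :: "real \<Rightarrow> 'b::real_normed_vector"
  assumes der: "\<And>t. (v has_vector_derivative F (v t)) (at t)"
    and lip: "\<And>x y. norm (F x - F y) \<le> \<Lambda> * norm (x - y)" and "\<Lambda> \<ge> 0"
    and "0 \<le> h" "\<Lambda> * h \<le> 1 / 2"
  shows "norm (v h - v 0 - h *\<^sub>R F (v 0)) \<le> 2 * \<Lambda> * h\<^sup>2 * norm (F (v 0))"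
proof -
  have cont: "continuous_on S v" for S
    using der by (meson continuous_at_imp_continuous_on has_vector_derivative_continuous)
  have "continuous_on {0..h} (\<lambda>t. norm (v t - v 0))" by (intro continuous_intros cont)
  then obtain s where s: "s \<in> {0..h}" and max: "\<And>t. t \<in> {0..h} \<Longrightarrow> norm (v t - v 0) \<le> norm (v s - v 0)"
    using continuous_attains_sup[of "{0..h}" "\<lambda>t. norm (v t - v 0)"] \<open>0 \<le> h\<close> by auto
  define m where "m = norm (v s - v 0)"
  have lin: "norm (v t - v 0 - t *\<^sub>R F (v 0)) \<le> t * (\<Lambda> * m)" if t: "t \<in> {0..h}" for t
  proof -
    have "norm (v t - v 0 - (t - 0) *\<^sub>R F (v 0)) \<le> norm (t - 0) * (\<Lambda> * m)"
    proof (rule vector_differentiable_bound_linearization[where S = "{0..t}" and f' = "\<lambda>t. F (v t)"])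
      show "(v has_vector_derivative F (v u)) (at u within {0..t})" for u
        using der by (rule has_vector_derivative_at_within)
      show "norm (F (v u) - F (v 0)) \<le> \<Lambda> * m" if "u \<in> {0..t}" for u
        using lip[of "v u" "v 0"] max[of u] that t \<open>\<Lambda> \<ge> 0\<close> mult_left_mono[of _ m \<Lambda>]
        unfolding m_def by (meson atLeastAtMost_iff order_trans mult_left_mono)
    qed (use t in \<open>auto simp: closed_segment_eq_real_ivl\<close>)
    then show ?thesis using t by simp
  qed
  have "m \<le> norm (s *\<^sub>R F (v 0)) + norm (v s - v 0 - s *\<^sub>R F (v 0))"
    using norm_triangle_ineq[of "s *\<^sub>R F (v 0)" "v s - v 0 - s *\<^sub>R F (v 0)"] by (simp add: m_def)
  also have "\<dots> \<le> h * norm (F (v 0)) + h * (\<Lambda> * m)"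
  proof (intro add_mono)
    show "norm (s *\<^sub>R F (v 0)) \<le> h * norm (F (v 0))" using s by (simp add: mult_right_mono)
    have "s * (\<Lambda> * m) \<le> h * (\<Lambda> * m)" using s \<open>\<Lambda> \<ge> 0\<close> by (intro mult_right_mono) (auto simp: m_def)
    then show "norm (v s - v 0 - s *\<^sub>R F (v 0)) \<le> h * (\<Lambda> * m)" using lin[OF s] by linarith
  qed
  also have "h * (\<Lambda> * m) \<le> m / 2"
    using mult_right_mono[OF \<open>\<Lambda> * h \<le> 1 / 2\<close>, of m] by (simp add: m_def mult_ac)
  finally have m: "m \<le> 2 * h * norm (F (v 0))" by simp
  have "norm (v h - v 0 - h *\<^sub>R F (v 0)) \<le> h * (\<Lambda> * m)" using lin[of h] \<open>0 \<le> h\<close> by simp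
  also have "\<dots> \<le> h * (\<Lambda> * (2 * h * norm (F (v 0))))"
    using m \<open>0 \<le> h\<close> \<open>\<Lambda> \<ge> 0\<close> by (intro mult_left_mono) auto
  finally show ?thesis by (simp add: power2_eq_square mult_ac)
qed

section \<open>Lipschitz and growth properties of the drift\<close>

locale langevin_coefficients =
  fixes A :: "real^'n^'n" and g :: "real^'n \<Rightarrow> real^'n" and \<gamma> \<sigma> A0 :: real
  assumes \<gamma>: "\<gamma> > 0" and \<sigma>: "\<sigma> > 0" and A0: "A0 > 0"
    and lip: "\<And>a b. norm (g a - g b) \<le> A0 * norm (a - b)"
begin

definition drift :: "'n phase \<Rightarrow> 'n phase" where
  "drift x = (A *v snd x, - g (fst x) - \<gamma> *\<^sub>R (A *v snd x))"

text \<open>The part of \<open>drift\<close> produced by the integrator; the friction part comes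
  from the Ornstein-Uhlenbeck factor.\<close>

definition hamiltonian_drift :: "'n phase \<Rightarrow> 'n phase" where
  "hamiltonian_drift x = (A *v snd x, - g (fst x))"

lemma g_growth: "norm (g q) \<le> A0 * norm q + norm (g 0)"
  using lip[of q 0] norm_triangle_ineq[of "g q - g 0" "g 0"] by simp

lemma norm_fst_diff: "norm (fst x - fst y) \<le> norm (x - y)"
  by (metis fst_diff norm_fst_le prod.collapse)

lemma norm_snd_diff: "norm (snd x - snd y) \<le> norm (x - y)"
  by (metis snd_diff norm_snd_le prod.collapse)

lemma norm_A_snd_diff: "norm (A *v snd x - A *v snd y) \<le> norm A * norm (x - y)"
proof -
  have "A *v snd x - A *v snd y = A *v (snd x - snd y)"
    by (simp add: matrix_vector_mult_diff_distrib)
  also have "norm \<dots> \<le> norm A * norm (snd x - snd y)" by (rule norm_matrix_vector_mult_le)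
  also have "\<dots> \<le> norm A * norm (x - y)" by (intro mult_left_mono norm_snd_diff) simp
  finally show ?thesis .
qed

lemma norm_g_fst_diff: "norm (g (fst x) - g (fst y)) \<le> A0 * norm (x - y)"
  using lip[of "fst x" "fst y"] mult_left_mono[OF norm_fst_diff[of x y], of A0] A0 by linarith

lemma hamiltonian_drift_lipschitz:
  "norm (hamiltonian_drift x - hamiltonian_drift y) \<le> (norm A + A0) * norm (x - y)"
proof -
  have "norm (hamiltonian_drift x - hamiltonian_drift y) \<le>
      norm (A *v snd x - A *v snd y) + norm (- g (fst x) - - g (fst y))"
    unfolding hamiltonian_drift_def by (simp only: diff_Pair norm_Pair_le)
  also have "norm (- g (fst x) - - g (fst y)) = norm (g (fst x) - g (fst y))"
    by (simp add: norm_minus_commute)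
  finally show ?thesis using norm_A_snd_diff[of x y] norm_g_fst_diff[of x y] by (simp add: distrib_right)
qed

lemma drift_lipschitz:
  "norm (drift x - drift y) \<le> (norm A + A0 + \<gamma> * norm A) * norm (x - y)"
proof -
  have "drift x - drift y = hamiltonian_drift x - hamiltonian_drift y
      - (0, \<gamma> *\<^sub>R (A *v snd x - A *v snd y))"
    by (simp add: drift_def hamiltonian_drift_def algebra_simps)
  then have "norm (drift x - drift y) \<le> norm (hamiltonian_drift x - hamiltonian_drift y)
      + norm (0 :: real^'n, \<gamma> *\<^sub>R (A *v snd x - A *v snd y))"
    by (metis norm_triangle_ineq4)
  moreover have "norm (0 :: real^'n, \<gamma> *\<^sub>R (A *v snd x - A *v snd y)) \<le> \<gamma> * (norm A * norm (x - y))"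
    using \<gamma> norm_A_snd_diff[of x y] by (simp add: norm_Pair mult_left_mono)
  ultimately show ?thesis using hamiltonian_drift_lipschitz[of x y] by (simp add: distrib_right)
qed

lemma hamiltonian_flow_second_order:
  assumes "\<And>x. \<phi> 0 x = x" "\<And>x t. ((\<lambda>s. \<phi> s x) has_vector_derivative hamiltonian_drift (\<phi> t x)) (at t)"
  shows "\<exists>C>0. \<exists>h1>0. \<forall>h x. 0 < h \<and> h < h1 \<longrightarrow>
    norm (\<phi> h x - x - h *\<^sub>R hamiltonian_drift x) \<le> C * h\<^sup>2 * (1 + norm x)"
proof (intro exI conjI allI impI; (elim conjE)?)
  let ?\<Lambda> = "norm A + A0"
  let ?c = "?\<Lambda> + norm (g 0)"
  have \<Lambda>: "?\<Lambda> > 0" using A0 by (simp add: add_nonneg_pos)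
  show "2 * ?\<Lambda> * ?c > 0" using \<Lambda> by (simp add: add_pos_nonneg)
  \<comment> \<open>This step-size limit is the absorption condition of
    \<open>flow_second_order\<close>.\<close>
  show "1 / (2 * ?\<Lambda>) > 0" using \<Lambda> by simp
  fix h x assume h: "0 < h" "h < 1 / (2 * ?\<Lambda>)"
  then have "?\<Lambda> * h \<le> 1 / 2" using \<Lambda> by (simp add: field_simps)
  from flow_second_order[OF assms(2) hamiltonian_drift_lipschitz _ _ this, of x] h \<Lambda>
  have "norm (\<phi> h x - x - h *\<^sub>R hamiltonian_drift x) \<le> 2 * ?\<Lambda> * h\<^sup>2 * norm (hamiltonian_drift x)"
    by (simp add: assms(1))
  also have "\<dots> \<le> 2 * ?\<Lambda> * h\<^sup>2 * (?c * (1 + norm x))"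
  proof (intro mult_left_mono)
    have "norm (hamiltonian_drift x) \<le> norm (hamiltonian_drift x - hamiltonian_drift 0) + norm (hamiltonian_drift 0)"
      using norm_triangle_ineq[of "hamiltonian_drift x - hamiltonian_drift 0" "hamiltonian_drift 0"] by simp
    also have "\<dots> \<le> ?\<Lambda> * norm x + norm (g 0)"
      using hamiltonian_drift_lipschitz[of x 0] by (simp add: hamiltonian_drift_def norm_Pair)
    also have "\<dots> \<le> ?c * (1 + norm x)" using A0 by (simp add: algebra_simps add_nonneg_nonneg)
    finally show "norm (hamiltonian_drift x) \<le> ?c * (1 + norm x)" .
  qed (use \<Lambda> in auto)
  finally show "norm (\<phi> h x - x - h *\<^sub>R hamiltonian_drift x) \<le> 2 * ?\<Lambda> * ?c * h\<^sup>2 * (1 + norm x)"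
    by (simp add: mult_ac)
qed

end

section \<open>One-step expansions of the algorithm and of a solution path\<close>

lemma matrix_vector_mult_integral:
  fixes A :: "real^'n^'m"
  assumes "f integrable_on S"
  shows "integral S (\<lambda>s. A *v f s) = A *v integral S f" "(\<lambda>s. A *v f s) integrable_on S"
proof -
  have bl: "bounded_linear ((*v) A)" by (simp add: linear_conv_bounded_linear[symmetric])
  show "integral S (\<lambda>s. A *v f s) = A *v integral S f"
    using integral_linear[OF assms bl] by (simp add: o_def)
  show "(\<lambda>s. A *v f s) integrable_on S"
    using integrable_linear[OF assms bl] by (simp add: o_def)
qed

lemma continuous_on_matrix_vector_mult:
  fixes A :: "real^'n^'m"
  assumes "continuous_on S f"
  shows "continuous_on S (\<lambda>s. A *v f s)"
  using bounded_linear.continuous_on[OF matrix_vector_mul_bounded_linear assms] .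

context langevin_coefficients
begin

lemma continuous_on_g: "continuous_on S g"
proof -
  have "lipschitz_on A0 UNIV g" using lip A0 by (intro lipschitz_onI) (auto simp: dist_norm)
  then show ?thesis using lipschitz_on_continuous_on continuous_on_subset by blast
qed

text \<open>The map \<open>\<theta> h\<close> is replaced by the flow \<open>\<phi> h\<close>, and
  that by an Euler step from the Ornstein-Uhlenbeck image \<open>x'\<close>. The friction in
  \<open>drift\<close> is the first-order term of \<open>E h\<close>; the position noise arises
  because the Euler step transports the random momentum kick into the position. Every replacement
  costs \<open>h\<^sup>2\<close>.\<close>

lemma splitting_step_expansion:
  fixes E :: "real \<Rightarrow> real^'n^'n" and \<theta> \<phi> :: "real \<Rightarrow> 'n phase \<Rightarrow> 'n phase"
  assumes E1: "\<And>h. 0 < h \<Longrightarrow> h \<le> 1 \<Longrightarrow> norm (E h - mat 1) \<le> e1 * h"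
    and E2: "\<And>h. 0 < h \<Longrightarrow> h \<le> 1 \<Longrightarrow> norm (E h - mat 1 + (\<gamma> * h) *\<^sub>R A) \<le> e2 * h\<^sup>2"
    and \<phi>: "\<And>h x. 0 < h \<Longrightarrow> h < h1 \<Longrightarrow> norm (\<phi> h x - x - h *\<^sub>R hamiltonian_drift x) \<le> C1 * h\<^sup>2 * (1 + norm x)"
    and \<theta>: "\<And>h x. 0 < h \<Longrightarrow> h < h1 \<Longrightarrow> norm (\<theta> h x - \<phi> h x) \<le> B * h\<^sup>2 * (1 + norm x)"
    and pos: "C1 > 0" "B > 0" "e1 \<ge> 0" "e2 \<ge> 0"
  shows "\<exists>C>0. \<forall>h x J. 0 < h \<and> h < h1 \<and> h \<le> 1 \<longrightarrow>
       norm (\<theta> h (fst x, E h *v snd x + \<sigma> *\<^sub>R J) - (x + h *\<^sub>R drift x + (h *\<^sub>R \<sigma> *\<^sub>R (A *v J), \<sigma> *\<^sub>R J)))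
         \<le> C * h\<^sup>2 * (1 + norm x + norm J)"
proof (intro exI conjI allI impI; (elim conjE)?)
  define c where "c = 2 + e1 + \<sigma>"
  have c: "c > 0" "c \<ge> 1 + (1 + e1)" "c \<ge> \<sigma>" "c \<ge> 1" using pos \<sigma> by (auto simp: c_def)
  show "(B + C1) * c + (norm A * e1 + e2) > 0"
    using pos c by (intro add_pos_nonneg mult_pos_pos add_nonneg_nonneg mult_nonneg_nonneg) auto
  fix h :: real and x :: "'n phase" and J :: "real^'n" assume h: "0 < h" "h < h1" "h \<le> 1"
  define p' where "p' = E h *v snd x + \<sigma> *\<^sub>R J"
  define x' where "x' = (fst x, p')"
  have fs: "norm (fst x) \<le> norm x" "norm (snd x) \<le> norm x"
    using norm_fst_diff[of x 0] norm_snd_diff[of x 0] by simp_all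
  have d1: "p' - snd x - \<sigma> *\<^sub>R J = (E h - mat 1) *v snd x"
    by (simp add: p'_def matrix_vector_mult_diff_rdistrib)
  have n1: "norm ((E h - mat 1) *v snd x) \<le> e1 * h * norm x"
    using norm_matrix_vector_mult_le[of "E h - mat 1" "snd x"] E1[OF h(1,3)] fs(2)
      mult_mono[of "norm (E h - mat 1)" "e1 * h" "norm (snd x)" "norm x"] h pos by auto
  have d2: "p' - snd x - \<sigma> *\<^sub>R J + (h * \<gamma>) *\<^sub>R (A *v snd x) = (E h - mat 1 + (\<gamma> * h) *\<^sub>R A) *v snd x"
    by (simp add: p'_def matrix_vector_mult_diff_rdistrib matrix_vector_mult_add_rdistrib
        scaleR_matrix_vector_assoc[symmetric] mult.commute)
  have n2: "norm ((E h - mat 1 + (\<gamma> * h) *\<^sub>R A) *v snd x) \<le> e2 * h\<^sup>2 * norm x"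
    using norm_matrix_vector_mult_le[of "E h - mat 1 + (\<gamma> * h) *\<^sub>R A" "snd x"] E2[OF h(1,3)] fs(2)
      mult_mono[of "norm (E h - mat 1 + (\<gamma> * h) *\<^sub>R A)" "e2 * h\<^sup>2" "norm (snd x)" "norm x"] h pos by auto
  have nx': "1 + norm x' \<le> c * (1 + norm x + norm J)"
  proof -
    have "norm x' \<le> norm (fst x) + norm p'" unfolding x'_def by (rule norm_Pair_le)
    moreover have "norm p' \<le> norm (snd x) + norm (\<sigma> *\<^sub>R J) + norm ((E h - mat 1) *v snd x)"
      using norm_triangle_ineq[of "snd x + \<sigma> *\<^sub>R J" "(E h - mat 1) *v snd x"] norm_triangle_ineq[of "snd x" "\<sigma> *\<^sub>R J"]
        d1 by (simp add: algebra_simps)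
    moreover have "e1 * h * norm x \<le> e1 * norm x" using h pos by (intro mult_right_mono mult_right_le_one_le) auto
    ultimately have "1 + norm x' \<le> 1 + (1 + (1 + e1)) * norm x + \<sigma> * norm J"
      using fs n1 \<sigma> by (simp add: algebra_simps)
    also have "\<dots> \<le> c * 1 + c * norm x + c * norm J"
      using c by (intro add_mono mult_right_mono) auto
    finally show ?thesis by (simp add: algebra_simps)
  qed
  have t1: "norm (\<theta> h x' - \<phi> h x') \<le> B * h\<^sup>2 * (c * (1 + norm x + norm J))"
    using \<theta>[OF h(1,2), of x'] nx' pos by (meson less_imp_le mult_left_mono mult_nonneg_nonneg order_trans zero_le_power2)
  have t2: "norm (\<phi> h x' - x' - h *\<^sub>R hamiltonian_drift x') \<le> C1 * h\<^sup>2 * (c * (1 + norm x + norm J))"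
    using \<phi>[OF h(1,2), of x'] nx' pos by (meson less_imp_le mult_left_mono mult_nonneg_nonneg order_trans zero_le_power2)
  \<comment> \<open>An exact identity: the force cancels because the Ornstein-Uhlenbeck map leaves
    the position unchanged.\<close>
  have eq3: "x' + h *\<^sub>R hamiltonian_drift x' - (x + h *\<^sub>R drift x + (h *\<^sub>R \<sigma> *\<^sub>R (A *v J), \<sigma> *\<^sub>R J))
      = (h *\<^sub>R (A *v ((E h - mat 1) *v snd x)), (E h - mat 1 + (\<gamma> * h) *\<^sub>R A) *v snd x)"
    unfolding d1[symmetric] d2[symmetric]
    by (cases x) (simp add: x'_def drift_def hamiltonian_drift_def matrix_vector_mult_diff_distrib
        algebra_simps matrix_vector_mult_scaleR)
  have "norm (h *\<^sub>R (A *v ((E h - mat 1) *v snd x))) \<le> h * (norm A * (e1 * h * norm x))"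
    using norm_matrix_vector_mult_le[of A "(E h - mat 1) *v snd x"] mult_left_mono[OF n1, of "norm A"] h by simp
  then have t3: "norm (x' + h *\<^sub>R hamiltonian_drift x' - (x + h *\<^sub>R drift x + (h *\<^sub>R \<sigma> *\<^sub>R (A *v J), \<sigma> *\<^sub>R J)))
      \<le> h * (norm A * (e1 * h * norm x)) + e2 * h\<^sup>2 * norm x"
    unfolding eq3 using n2 norm_Pair_le[of "h *\<^sub>R (A *v ((E h - mat 1) *v snd x))"] by (smt (verit))
  have t3': "h * (norm A * (e1 * h * norm x)) + e2 * h\<^sup>2 * norm x \<le> (norm A * e1 + e2) * h\<^sup>2 * (1 + norm x + norm J)"
  proof -
    have "h * (norm A * (e1 * h * norm x)) + e2 * h\<^sup>2 * norm x = (norm A * e1 + e2) * h\<^sup>2 * norm x"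
      by (simp add: power2_eq_square algebra_simps)
    also have "\<dots> \<le> (norm A * e1 + e2) * h\<^sup>2 * (1 + norm x + norm J)" using pos by (intro mult_left_mono) auto
    finally show ?thesis .
  qed
  have "\<theta> h x' - (x + h *\<^sub>R drift x + (h *\<^sub>R \<sigma> *\<^sub>R (A *v J), \<sigma> *\<^sub>R J)) =
     (\<theta> h x' - \<phi> h x') + (\<phi> h x' - x' - h *\<^sub>R hamiltonian_drift x') +
     (x' + h *\<^sub>R hamiltonian_drift x' - (x + h *\<^sub>R drift x + (h *\<^sub>R \<sigma> *\<^sub>R (A *v J), \<sigma> *\<^sub>R J)))" by simp
  also have "norm \<dots> \<le> B * h\<^sup>2 * (c * (1 + norm x + norm J)) + C1 * h\<^sup>2 * (c * (1 + norm x + norm J)) +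
      (norm A * e1 + e2) * h\<^sup>2 * (1 + norm x + norm J)"
    by (intro norm_triangle_mono t1 t2 order_trans[OF t3 t3'])
  also have "\<dots> = ((B + C1) * c + (norm A * e1 + e2)) * h\<^sup>2 * (1 + norm x + norm J)"
    by (simp add: algebra_simps)
  finally show "norm (\<theta> h (fst x, E h *v snd x + \<sigma> *\<^sub>R J) - (x + h *\<^sub>R drift x + (h *\<^sub>R \<sigma> *\<^sub>R (A *v J), \<sigma> *\<^sub>R J)))
         \<le> ((B + C1) * c + (norm A * e1 + e2)) * h\<^sup>2 * (1 + norm x + norm J)"
    by (simp only: x'_def p'_def)
qed

text \<open>Additive noise turns the equation into an integral equation for each fixed continuous
  driving path \<open>w\<close>; all estimates before the mean squares concern one such
  path.\<close>

definition langevin_path :: "'n phase \<Rightarrow> (real \<Rightarrow> real^'n) \<Rightarrow> (real \<Rightarrow> 'n phase) \<Rightarrow> bool" where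
  "langevin_path x w y \<longleftrightarrow> continuous_on {0..} w \<and> continuous_on {0..} y \<and> (\<forall>t\<ge>0.
     fst (y t) = fst x + integral {0..t} (\<lambda>s. A *v snd (y s)) \<and>
     snd (y t) = snd x - integral {0..t} (\<lambda>s. g (fst (y s)))
       - integral {0..t} (\<lambda>s. \<gamma> *\<^sub>R (A *v snd (y s))) + \<sigma> *\<^sub>R (w t - w 0))"

text \<open>Linear growth constant of the momentum component of the drift.\<close>

definition drift_growth :: real where
  "drift_growth = A0 + norm (g 0) + \<gamma> * norm A"

lemma drift_growth_nonneg: "0 \<le> drift_growth"
  unfolding drift_growth_def using A0 \<gamma> by (simp add: add_nonneg_nonneg)

context
  fixes x w y assumes path: "langevin_path x w y"
begin

lemma path_continuous:
  assumes "S \<subseteq> {0..}"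
  shows "continuous_on S w" "continuous_on S y" "continuous_on S (\<lambda>s. A *v snd (y s))"
    "continuous_on S (\<lambda>s. g (fst (y s)))" "continuous_on S (\<lambda>s. 1 + norm (y s))"
proof -
  show w: "continuous_on S w" and y: "continuous_on S y"
    using path assms unfolding langevin_path_def by (auto intro: continuous_on_subset)
  show "continuous_on S (\<lambda>s. A *v snd (y s))"
    by (intro continuous_on_matrix_vector_mult continuous_intros y)
  show "continuous_on S (\<lambda>s. g (fst (y s)))"
    by (intro continuous_on_compose2[OF continuous_on_g[of UNIV]] continuous_intros y) auto
  show "continuous_on S (\<lambda>s. 1 + norm (y s))" by (intro continuous_intros y)
qed

lemma path_increment:
  assumes "0 \<le> a" "a \<le> s"
  shows "fst (y s) - fst (y a) = integral {a..s} (\<lambda>s. A *v snd (y s))"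
    "snd (y s) - snd (y a) = \<sigma> *\<^sub>R (w s - w a) - integral {a..s} (\<lambda>s. g (fst (y s)) + \<gamma> *\<^sub>R (A *v snd (y s)))"
proof -
  have comb: "integral {0..s} f = integral {0..a} f + integral {a..s} f"
    if "continuous_on {0..s} f" for f :: "real \<Rightarrow> real^'n"
    by (rule Henstock_Kurzweil_Integration.integral_combine[symmetric]) (use assms that in \<open>auto intro: integrable_continuous_real\<close>)
  have c: "continuous_on {0..s} (\<lambda>s. A *v snd (y s))" "continuous_on {0..s} (\<lambda>s. g (fst (y s)))"
    by (rule path_continuous; auto)+
  have c': "continuous_on {a..s} (\<lambda>s. A *v snd (y s))" "continuous_on {a..s} (\<lambda>s. g (fst (y s)))"
    using assms by (auto intro: path_continuous)
  have ys: "fst (y s) = fst x + integral {0..s} (\<lambda>s. A *v snd (y s))"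
     "snd (y s) = snd x - integral {0..s} (\<lambda>s. g (fst (y s)))
       - integral {0..s} (\<lambda>s. \<gamma> *\<^sub>R (A *v snd (y s))) + \<sigma> *\<^sub>R (w s - w 0)"
    and ya: "fst (y a) = fst x + integral {0..a} (\<lambda>s. A *v snd (y s))"
     "snd (y a) = snd x - integral {0..a} (\<lambda>s. g (fst (y s)))
       - integral {0..a} (\<lambda>s. \<gamma> *\<^sub>R (A *v snd (y s))) + \<sigma> *\<^sub>R (w a - w 0)"
    using path assms unfolding langevin_path_def by auto
  show "fst (y s) - fst (y a) = integral {a..s} (\<lambda>s. A *v snd (y s))"
    using ys ya comb[OF c(1)] by simp
  have "integral {a..s} (\<lambda>s. g (fst (y s)) + \<gamma> *\<^sub>R (A *v snd (y s))) =
      integral {a..s} (\<lambda>s. g (fst (y s))) + integral {a..s} (\<lambda>s. \<gamma> *\<^sub>R (A *v snd (y s)))"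
    by (intro Henstock_Kurzweil_Integration.integral_add integrable_continuous_real continuous_intros c')
  moreover have "integral {0..s} (\<lambda>s. \<gamma> *\<^sub>R (A *v snd (y s))) = integral {0..a} (\<lambda>s. \<gamma> *\<^sub>R (A *v snd (y s))) +
      integral {a..s} (\<lambda>s. \<gamma> *\<^sub>R (A *v snd (y s)))"
    by (intro comb continuous_intros c(1))
  ultimately show "snd (y s) - snd (y a) = \<sigma> *\<^sub>R (w s - w a) - integral {a..s} (\<lambda>s. g (fst (y s)) + \<gamma> *\<^sub>R (A *v snd (y s)))"
    unfolding ys(2) ya(2) comb[OF c(2)] by (simp add: scaleR_diff_right)
qed

text \<open>Integrating up to \<open>b\<close> instead of \<open>s\<close> gives one bound for all
  \<open>s\<close> in a cell. The integral of \<open>1 + norm (y s)\<close> is kept, since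
  Minkowski's inequality controls it from moments at fixed times; a supremum over time would call
  for a maximal inequality.\<close>

lemma path_integral_bounds:
  assumes "0 \<le> a" "a \<le> s" "s \<le> b"
  shows "norm (integral {a..s} (\<lambda>s. A *v snd (y s))) \<le> norm A * integral {a..b} (\<lambda>s. 1 + norm (y s))"
    "norm (integral {a..s} (\<lambda>s. g (fst (y s)) + \<gamma> *\<^sub>R (A *v snd (y s)))) \<le>
       drift_growth * integral {a..b} (\<lambda>s. 1 + norm (y s))"
proof -
  have c: "continuous_on {a..s} (\<lambda>s. A *v snd (y s))" "continuous_on {a..s} (\<lambda>s. g (fst (y s)))"
    "continuous_on {a..s} (\<lambda>s. 1 + norm (y s))" "continuous_on {a..b} (\<lambda>s. 1 + norm (y s))"
    using assms by (auto intro: path_continuous)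
  have mono: "integral {a..s} (\<lambda>s. 1 + norm (y s)) \<le> integral {a..b} (\<lambda>s. 1 + norm (y s))"
    using assms c by (intro integral_subset_le integrable_continuous_real) auto
  have fs: "norm (fst z) \<le> norm z" "norm (snd z) \<le> norm z" for z :: "'n phase"
    using norm_fst_diff[of z 0] norm_snd_diff[of z 0] by simp_all
  have b1: "norm (A *v snd z) \<le> norm A * (1 + norm z)" for z :: "'n phase"
    using norm_matrix_vector_mult_le[of A "snd z"] mult_left_mono[OF fs(2)[of z], of "norm A"]
    by (simp add: distrib_left) (smt (verit) norm_ge_zero)
  have b2: "norm (g (fst z) + \<gamma> *\<^sub>R (A *v snd z)) \<le> drift_growth * (1 + norm z)" for z :: "'n phase"
  proof -
    have "norm (g (fst z) + \<gamma> *\<^sub>R (A *v snd z)) \<le> norm (g (fst z)) + \<gamma> * norm (A *v snd z)"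
      using norm_triangle_ineq[of "g (fst z)" "\<gamma> *\<^sub>R (A *v snd z)"] \<gamma> by simp
    also have "\<dots> \<le> (A0 * norm z + norm (g 0)) + \<gamma> * (norm A * (1 + norm z))"
    proof (intro add_mono mult_left_mono b1)
      show "norm (g (fst z)) \<le> A0 * norm z + norm (g 0)"
      proof -
        have "A0 * norm (fst z) \<le> A0 * norm z" using fs(1) A0 by (intro mult_left_mono) auto
        then show ?thesis using g_growth[of "fst z"] by linarith
      qed
    qed (use \<gamma> in auto)
    also have "\<dots> \<le> drift_growth * (1 + norm z)"
      using A0 by (simp add: drift_growth_def algebra_simps add_nonneg_nonneg)
    finally show ?thesis .
  qed
  have "norm (integral {a..s} (\<lambda>s. A *v snd (y s))) \<le> integral {a..s} (\<lambda>s. norm A * (1 + norm (y s)))"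
    by (intro integral_norm_bound_integral integrable_continuous_real continuous_intros c b1)
  also have "\<dots> = norm A * integral {a..s} (\<lambda>s. 1 + norm (y s))" by simp
  also have "\<dots> \<le> norm A * integral {a..b} (\<lambda>s. 1 + norm (y s))" by (intro mult_left_mono mono) simp
  finally show "norm (integral {a..s} (\<lambda>s. A *v snd (y s))) \<le> norm A * integral {a..b} (\<lambda>s. 1 + norm (y s))" .
  have "norm (integral {a..s} (\<lambda>s. g (fst (y s)) + \<gamma> *\<^sub>R (A *v snd (y s)))) \<le>
      integral {a..s} (\<lambda>s. drift_growth * (1 + norm (y s)))"
    by (intro integral_norm_bound_integral integrable_continuous_real continuous_intros c b2)
  also have "\<dots> = drift_growth * integral {a..s} (\<lambda>s. 1 + norm (y s))" by simp
  also have "\<dots> \<le> drift_growth * integral {a..b} (\<lambda>s. 1 + norm (y s))"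
    by (intro mult_left_mono mono drift_growth_nonneg)
  finally show "norm (integral {a..s} (\<lambda>s. g (fst (y s)) + \<gamma> *\<^sub>R (A *v snd (y s)))) \<le>
       drift_growth * integral {a..b} (\<lambda>s. 1 + norm (y s))" .
qed

text \<open>Within a cell the momentum is its initial value plus the noise plus a drift part of
  order \<open>h\<close>. Integrating it yields the position up to order \<open>h\<^sup>2\<close>
  with the correction \<open>\<sigma> *\<^sub>R (A *v I)\<close>, which the friction feeds back into
  the momentum.\<close>

lemma path_step_expansion:
  assumes a: "0 \<le> a" and h: "0 < h"
  defines "I \<equiv> integral {a..a + h} (\<lambda>s. w s - w a)"
  shows "norm (y (a + h) - (y a + h *\<^sub>R drift (y a)
      + (\<sigma> *\<^sub>R (A *v I), \<sigma> *\<^sub>R (w (a + h) - w a) - (\<gamma> * \<sigma>) *\<^sub>R (A *v I))))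
    \<le> (norm A * drift_growth + A0 * norm A + \<gamma> * (norm A * drift_growth)) *
       (h * integral {a..a + h} (\<lambda>s. 1 + norm (y s)))"
proof -
  let ?b = "a + h" and ?G = "integral {a..a + h} (\<lambda>s. 1 + norm (y s))"
  define D where "D s = integral {a..s} (\<lambda>s. g (fst (y s)) + \<gamma> *\<^sub>R (A *v snd (y s)))" for s
  have c: "continuous_on {a..?b} w" "continuous_on {a..?b} y" "continuous_on {a..?b} (\<lambda>s. A *v snd (y s))"
      "continuous_on {a..?b} (\<lambda>s. g (fst (y s)))"
    using a by (auto intro: path_continuous)
  have cD: "continuous_on {a..?b} D" unfolding D_def
    by (intro indefinite_integral_continuous_1 integrable_continuous_real continuous_intros c)
  have P: "snd (y s) = snd (y a) + \<sigma> *\<^sub>R (w s - w a) - D s" if "s \<in> {a..?b}" for s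
    using path_increment(2)[of a s] that a by (simp add: D_def algebra_simps)
  have "integral {a..?b} (\<lambda>s. snd (y s)) = integral {a..?b} (\<lambda>s. snd (y a) + \<sigma> *\<^sub>R (w s - w a) - D s)"
    by (intro Henstock_Kurzweil_Integration.integral_cong P)
  also have "\<dots> = integral {a..?b} (\<lambda>s. snd (y a)) + integral {a..?b} (\<lambda>s. \<sigma> *\<^sub>R (w s - w a)) - integral {a..?b} D"
    by (subst Henstock_Kurzweil_Integration.integral_diff Henstock_Kurzweil_Integration.integral_add;
        (intro integrable_continuous_real continuous_intros c cD)?)+ simp
  also have "\<dots> = h *\<^sub>R snd (y a) + \<sigma> *\<^sub>R I - integral {a..?b} D" using h by (simp add: I_def)
  finally have intP: "integral {a..?b} (\<lambda>s. snd (y s)) = h *\<^sub>R snd (y a) + \<sigma> *\<^sub>R I - integral {a..?b} D" .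
  have intAP: "integral {a..?b} (\<lambda>s. A *v snd (y s)) =
      h *\<^sub>R (A *v snd (y a)) + \<sigma> *\<^sub>R (A *v I) - A *v integral {a..?b} D"
    unfolding matrix_vector_mult_integral(1)[OF integrable_continuous_real[OF continuous_on_snd[OF c(2)]]] intP
    by (simp add: matrix_vector_mult_diff_distrib matrix_vector_right_distrib matrix_vector_mult_scaleR)
  have nD: "norm (integral {a..?b} D) \<le> drift_growth * ?G * h"
    using integral_bound[of a ?b D "drift_growth * ?G"] cD h path_integral_bounds(2)[of a _ ?b] a
    by (simp add: D_def)
  have R1: "norm (A *v integral {a..?b} D) \<le> norm A * drift_growth * (h * ?G)"
    using norm_matrix_vector_mult_le[of A "integral {a..?b} D"] mult_left_mono[OF nD, of "norm A"] by (simp add: mult_ac)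
  \<comment> \<open>The increment of the position is a pure time integral, so \<open>g\<close>
    varies by order \<open>h\<close> in the cell and the force leaves no stochastic term.\<close>
  have nG: "norm (integral {a..?b} (\<lambda>s. g (fst (y s)) - g (fst (y a)))) \<le> A0 * (norm A * ?G) * (?b - a)"
  proof (intro integral_bound)
    show "continuous_on {a..?b} (\<lambda>s. g (fst (y s)) - g (fst (y a)))" by (intro continuous_intros c)
    fix s assume s: "s \<in> {a..?b}"
    have "norm (g (fst (y s)) - g (fst (y a))) \<le> A0 * norm (fst (y s) - fst (y a))" by (rule lip)
    also have "\<dots> \<le> A0 * (norm A * ?G)"
      using path_increment(1)[of a s] path_integral_bounds(1)[of a s ?b] s a A0 by (intro mult_left_mono) auto
    finally show "norm (g (fst (y s)) - g (fst (y a))) \<le> A0 * (norm A * ?G)" .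
  qed (use h in auto)
  have intg: "integral {a..?b} (\<lambda>s. g (fst (y s)) - g (fst (y a))) = integral {a..?b} (\<lambda>s. g (fst (y s))) - h *\<^sub>R g (fst (y a))"
    using h by (subst Henstock_Kurzweil_Integration.integral_diff) (auto intro!: integrable_continuous_real c)
  have Db: "D ?b = integral {a..?b} (\<lambda>s. g (fst (y s))) + \<gamma> *\<^sub>R integral {a..?b} (\<lambda>s. A *v snd (y s))"
    unfolding D_def by (subst Henstock_Kurzweil_Integration.integral_add)
      (auto intro!: integrable_continuous_real continuous_intros c)
  let ?R = "(- (A *v integral {a..?b} D), - integral {a..?b} (\<lambda>s. g (fst (y s)) - g (fst (y a))) + \<gamma> *\<^sub>R (A *v integral {a..?b} D))"
  have "y ?b - (y a + h *\<^sub>R drift (y a)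
      + (\<sigma> *\<^sub>R (A *v I), \<sigma> *\<^sub>R (w ?b - w a) - (\<gamma> * \<sigma>) *\<^sub>R (A *v I))) = ?R"
  proof (rule prod_eqI)
    show "fst (y ?b - (y a + h *\<^sub>R drift (y a)
      + (\<sigma> *\<^sub>R (A *v I), \<sigma> *\<^sub>R (w ?b - w a) - (\<gamma> * \<sigma>) *\<^sub>R (A *v I)))) = fst ?R"
      using path_increment(1)[of a ?b] a h intAP by (simp add: drift_def algebra_simps)
    show "snd (y ?b - (y a + h *\<^sub>R drift (y a)
      + (\<sigma> *\<^sub>R (A *v I), \<sigma> *\<^sub>R (w ?b - w a) - (\<gamma> * \<sigma>) *\<^sub>R (A *v I)))) = snd ?R"
      using P[of ?b] h unfolding Db intg intAP by (simp add: drift_def algebra_simps)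
  qed
  also have "norm ?R \<le> norm (- (A *v integral {a..?b} D)) +
      norm (- integral {a..?b} (\<lambda>s. g (fst (y s)) - g (fst (y a))) + \<gamma> *\<^sub>R (A *v integral {a..?b} D))"
    by (rule norm_Pair_le)
  also have "\<dots> \<le> norm A * drift_growth * (h * ?G) + (A0 * (norm A * ?G) * (?b - a) + \<gamma> * (norm A * drift_growth * (h * ?G)))"
    using R1 nG mult_left_mono[OF R1, of \<gamma>] \<gamma>
    by (intro add_mono norm_triangle_mono) auto
  finally show ?thesis by (simp add: algebra_simps)
qed

text \<open>Gronwall with an inhomogeneity \<open>\<beta>\<close> made of the initial value and the
  driving path only, so that second moments of the solution reduce to those of Brownian
  motion.\<close>

lemma path_apriori_bound:
  assumes t: "t \<in> {0..T}"
  defines "\<beta> \<equiv> \<lambda>s. norm x + (norm A + drift_growth) * T + \<sigma> * norm (w s - w 0)"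
  shows "norm (y t) \<le> \<beta> t + (norm A + drift_growth) * exp ((norm A + drift_growth) * T) * integral {0..t} \<beta>"
proof -
  let ?\<Lambda> = "norm A + drift_growth"
  have \<Lambda>: "?\<Lambda> \<ge> 0" using drift_growth_nonneg by simp
  have c\<beta>: "continuous_on {0..T} \<beta>" and cy: "continuous_on {0..T} (\<lambda>s. norm (y s))"
    unfolding \<beta>_def by (auto intro!: continuous_intros path_continuous)
  have \<beta>0: "\<beta> s \<ge> 0" if "s \<in> {0..T}" for s
    using that mult_nonneg_nonneg[OF \<Lambda>, of T] \<sigma> by (simp add: \<beta>_def)
  have "norm (y t) \<le> \<beta> t + ?\<Lambda> * exp (?\<Lambda> * t) * integral {0..t} \<beta>"
  proof (rule gronwall_integral[OF cy c\<beta> \<Lambda> \<beta>0 _ t])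
    fix s assume s: "s \<in> {0..T}"
    have y0: "y 0 = x" using path unfolding langevin_path_def by (auto intro!: prod_eqI)
    let ?G = "integral {0..s} (\<lambda>s. 1 + norm (y s))"
    let ?I1 = "integral {0..s} (\<lambda>s. A *v snd (y s))"
    let ?I2 = "integral {0..s} (\<lambda>s. g (fst (y s)) + \<gamma> *\<^sub>R (A *v snd (y s)))"
    have "y s = x + (?I1, 0) + (0, - ?I2) + (0, \<sigma> *\<^sub>R (w s - w 0))"
      using path_increment[of 0 s] s y0 by (intro prod_eqI) (auto simp: algebra_simps)
    also have "norm \<dots> \<le> norm x + norm (?I1, 0 :: real^'n) + norm (0 :: real^'n, - ?I2) + norm (0 :: real^'n, \<sigma> *\<^sub>R (w s - w 0))"
      by (intro norm_triangle_mono order_refl)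
    also have "\<dots> = norm x + norm ?I1 + norm ?I2 + \<sigma> * norm (w s - w 0)" using \<sigma> by (simp add: norm_Pair)
    also have "\<dots> \<le> norm x + norm A * ?G + drift_growth * ?G + \<sigma> * norm (w s - w 0)"
      using path_integral_bounds[of 0 s s] s by (intro add_mono) auto
    also have "?G = s + integral {0..s} (\<lambda>s. norm (y s))"
      using s by (subst Henstock_Kurzweil_Integration.integral_add)
        (auto intro!: integrable_continuous_real continuous_intros path_continuous)
    also have "norm x + norm A * (s + integral {0..s} (\<lambda>s. norm (y s))) + drift_growth * (s + integral {0..s} (\<lambda>s. norm (y s)))
       + \<sigma> * norm (w s - w 0) = norm x + ?\<Lambda> * s + \<sigma> * norm (w s - w 0) + ?\<Lambda> * integral {0..s} (\<lambda>s. norm (y s))"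
      by (simp add: algebra_simps)
    also have "\<dots> \<le> \<beta> s + ?\<Lambda> * integral {0..s} (\<lambda>s. norm (y s))"
      using s \<Lambda> mult_left_mono[of s T ?\<Lambda>] by (simp add: \<beta>_def)
    finally show "norm (y s) \<le> \<beta> s + ?\<Lambda> * integral {0..s} (\<lambda>s. norm (y s))" .
  qed
  also have "?\<Lambda> * exp (?\<Lambda> * t) * integral {0..t} \<beta> \<le> ?\<Lambda> * exp (?\<Lambda> * T) * integral {0..t} \<beta>"
  proof (intro mult_right_mono mult_left_mono)
    show "exp (?\<Lambda> * t) \<le> exp (?\<Lambda> * T)" using t \<Lambda> by (simp add: mult_left_mono)
    show "0 \<le> integral {0..t} \<beta>" using t \<beta>0 by (intro integral_nonneg integrable_continuous_real continuous_on_subset[OF c\<beta>]) auto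
  qed (use \<Lambda> in auto)
  finally show ?thesis by simp
qed

end

section \<open>Accumulation of the error\<close>

definition drift_lipschitz_const :: real where
  "drift_lipschitz_const = norm A + A0 + \<gamma> * norm A"

text \<open>The constant of \<open>path_step_expansion\<close>, which vanishes for
  \<open>A = 0\<close>; the added 1 makes it positive.\<close>

definition path_step_const :: real where
  "path_step_const = norm A * drift_growth + A0 * norm A + \<gamma> * (norm A * drift_growth) + 1"

text \<open>Summing the one-step expansions keeps the noise contributions inside the norms of sums,
  where their orthogonality can be used; only the higher order remainders are summed termwise.\<close>

definition error_source ::
  "real \<Rightarrow> real \<Rightarrow> (real \<Rightarrow> real^'n) \<Rightarrow> (real \<Rightarrow> 'n phase) \<Rightarrow> (nat \<Rightarrow> real^'n) \<Rightarrow> nat \<Rightarrow> real" where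
  "error_source C h w y J k =
     \<sigma> * (norm A + 1) * h * norm (\<Sum>j<k. J j)
   + \<sigma> * (norm A + 1) * (1 + \<gamma>) * norm (\<Sum>j<k. integral {real j * h..real j * h + h} (\<lambda>s. w s - w (real j * h)))
   + \<sigma> * norm (\<Sum>j<k. J j - (w (real j * h + h) - w (real j * h)))
   + (\<Sum>j<k. C * h\<^sup>2 * ((1 + norm (y (real j * h))) + norm (J j))
        + path_step_const * h * integral {real j * h..real j * h + h} (\<lambda>s. 1 + norm (y s)))"

lemma path_step_const_pos: "path_step_const > 0"
  unfolding path_step_const_def using drift_growth_nonneg A0 \<gamma>
  by (intro add_nonneg_pos add_nonneg_nonneg mult_nonneg_nonneg) auto

lemma integral_one_plus_norm_nonneg:
  "integral S (\<lambda>s::real. 1 + norm (y s :: 'n phase)) \<ge> 0"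
  by (cases "(\<lambda>s. 1 + norm (y s)) integrable_on S") (auto intro: integral_nonneg simp: not_integrable_integral)

text \<open>The remainder of the algorithm involves \<open>norm (X j)\<close>. Bounding it by the
  error plus \<open>norm (y (real j * h))\<close> moves a multiple of the error into the Gronwall
  coefficient, which is why \<open>C\<close> joins \<open>drift_lipschitz_const\<close>; the source
  then contains the solution and the noise only.\<close>

lemma error_recursion:
  assumes path: "langevin_path x w y" and h: "0 < h" "h \<le> 1" and "C > 0"
    and X0: "X 0 = x"
    and step: "\<And>j. norm (X (Suc j) - (X j + h *\<^sub>R drift (X j) + (h *\<^sub>R \<sigma> *\<^sub>R (A *v J j), \<sigma> *\<^sub>R J j)))
         \<le> C * h\<^sup>2 * (1 + norm (X j) + norm (J j))"
  shows "norm (X k - y (real k * h)) \<le> error_source C h w y J k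
    + (drift_lipschitz_const + C) * h * (\<Sum>j<k. norm (X j - y (real j * h)))"
proof -
  define I where "I j = integral {real j * h..real j * h + h} (\<lambda>s. w s - w (real j * h))" for j
  define G where "G j = integral {real j * h..real j * h + h} (\<lambda>s. 1 + norm (y s))" for j
  define \<Delta> where "\<Delta> j = w (real j * h + h) - w (real j * h)" for j
  define e where "e j = X j - y (real j * h)" for j
  \<comment> \<open>Noise of the algorithm step minus noise of the solution step, as they stand in
    the two expansions.\<close>
  define n where "n j = (\<sigma> *\<^sub>R (A *v (h *\<^sub>R J j)) - \<sigma> *\<^sub>R (A *v I j), \<sigma> *\<^sub>R (J j - \<Delta> j) + (\<gamma> * \<sigma>) *\<^sub>R (A *v I j))" for j
  define d where "d j = h *\<^sub>R (drift (X j) - drift (y (real j * h)))" for j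
  define r where "r j = (X (Suc j) - (X j + h *\<^sub>R drift (X j) + (h *\<^sub>R \<sigma> *\<^sub>R (A *v J j), \<sigma> *\<^sub>R J j)))
     - (y (real j * h + h) - (y (real j * h) + h *\<^sub>R drift (y (real j * h)) + (\<sigma> *\<^sub>R (A *v I j), \<sigma> *\<^sub>R \<Delta> j - (\<gamma> * \<sigma>) *\<^sub>R (A *v I j))))" for j
  have y0: "y 0 = x" using path unfolding langevin_path_def by (auto intro!: prod_eqI)
  have inc: "e (Suc j) - e j = d j + n j + r j" for j
    by (rule prod_eqI) (simp_all add: e_def d_def n_def r_def \<Delta>_def algebra_simps matrix_vector_mult_scaleR)
  have "e k = (\<Sum>j<k. e (Suc j) - e j)" using sum_lessThan_telescope[of e k] by (simp add: e_def X0 y0)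
  also have "\<dots> = (\<Sum>j<k. d j) + (\<Sum>j<k. n j) + (\<Sum>j<k. r j)" unfolding inc by (simp add: sum.distrib)
  finally have ek_eq: "e k = (\<Sum>j<k. d j) + (\<Sum>j<k. n j) + (\<Sum>j<k. r j)" .
  have ek: "norm (e k) \<le> norm (\<Sum>j<k. d j) + norm (\<Sum>j<k. n j) + norm (\<Sum>j<k. r j)"
    unfolding ek_eq by (intro order_trans[OF norm_triangle_ineq] add_right_mono norm_triangle_ineq)
  have D: "norm (\<Sum>j<k. d j) \<le> (\<Sum>j<k. drift_lipschitz_const * h * norm (e j))"
  proof (rule sum_norm_le)
    fix j
    show "norm (d j) \<le> drift_lipschitz_const * h * norm (e j)"
      using drift_lipschitz[of "X j" "y (real j * h)"] mult_left_mono[OF drift_lipschitz[of "X j" "y (real j * h)"], of h] h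
      by (simp add: d_def e_def drift_lipschitz_const_def mult_ac)
  qed
  have R: "norm (\<Sum>j<k. r j) \<le> (\<Sum>j<k. C * h * norm (e j) +
      (C * h\<^sup>2 * ((1 + norm (y (real j * h))) + norm (J j)) + path_step_const * h * G j))"
  proof (rule sum_norm_le)
    fix j
    have "norm (r j) \<le> C * h\<^sup>2 * (1 + norm (X j) + norm (J j)) + path_step_const * h * G j"
    proof -
      have "norm (y (real j * h + h) - (y (real j * h) + h *\<^sub>R drift (y (real j * h))
         + (\<sigma> *\<^sub>R (A *v I j), \<sigma> *\<^sub>R \<Delta> j - (\<gamma> * \<sigma>) *\<^sub>R (A *v I j)))) \<le> (path_step_const - 1) * (h * G j)"
        using path_step_expansion[OF path _ h(1), of "real j * h"] h
        by (simp add: path_step_const_def I_def \<Delta>_def G_def)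
      also have "\<dots> \<le> path_step_const * (h * G j)"
        using h integral_one_plus_norm_nonneg by (intro mult_right_mono) (auto simp: G_def)
      finally show ?thesis unfolding r_def using step[of j]
        by (intro order_trans[OF norm_triangle_ineq4 add_mono]) (auto simp: mult.assoc)
    qed
    moreover have "C * h\<^sup>2 * (1 + norm (X j) + norm (J j)) \<le>
        C * h * norm (e j) + C * h\<^sup>2 * ((1 + norm (y (real j * h))) + norm (J j))"
    proof -
      have "norm (X j) \<le> norm (e j) + norm (y (real j * h))"
        using norm_triangle_ineq[of "e j" "y (real j * h)"] by (simp add: e_def)
      then have "C * h\<^sup>2 * (1 + norm (X j) + norm (J j)) \<le> C * h\<^sup>2 * (1 + (norm (e j) + norm (y (real j * h))) + norm (J j))"
        using \<open>C > 0\<close> by (intro mult_left_mono) auto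
      also have "\<dots> = C * h\<^sup>2 * norm (e j) + C * h\<^sup>2 * ((1 + norm (y (real j * h))) + norm (J j))"
        by (simp add: algebra_simps)
      \<comment> \<open>One factor \<open>h\<close> is given away, so that this term has the same
        form as the Lipschitz term.\<close>
      also have "C * h\<^sup>2 * norm (e j) \<le> C * h * norm (e j)"
        using h \<open>C > 0\<close> by (intro mult_right_mono mult_left_mono) (auto simp: power2_eq_square mult_le_one)
      finally show ?thesis by simp
    qed
    ultimately show "norm (r j) \<le> C * h * norm (e j) +
      (C * h\<^sup>2 * ((1 + norm (y (real j * h))) + norm (J j)) + path_step_const * h * G j)" by linarith
  qed
  have N: "norm (\<Sum>j<k. n j) \<le> \<sigma> * (norm A + 1) * h * norm (\<Sum>j<k. J j)
     + \<sigma> * (norm A + 1) * (1 + \<gamma>) * norm (\<Sum>j<k. I j) + \<sigma> * norm (\<Sum>j<k. J j - \<Delta> j)"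
  proof -
    have lin: "(\<Sum>j<k. A *v f j) = A *v (\<Sum>j<k. f j)" for f
      by (simp add: linear_sum)
    have "(\<Sum>j<k. n j) = (\<sigma> *\<^sub>R h *\<^sub>R (A *v (\<Sum>j<k. J j)) - \<sigma> *\<^sub>R (A *v (\<Sum>j<k. I j)),
        \<sigma> *\<^sub>R (\<Sum>j<k. J j - \<Delta> j) + (\<gamma> * \<sigma>) *\<^sub>R (A *v (\<Sum>j<k. I j)))"
      by (rule prod_eqI) (simp_all add: n_def fst_sum snd_sum sum.distrib sum_subtractf
          scaleR_sum_right[symmetric] lin matrix_vector_mult_scaleR)
    also have "norm \<dots> \<le> norm (\<sigma> *\<^sub>R h *\<^sub>R (A *v (\<Sum>j<k. J j))) + norm (\<sigma> *\<^sub>R (A *v (\<Sum>j<k. I j)))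
       + (norm (\<sigma> *\<^sub>R (\<Sum>j<k. J j - \<Delta> j)) + norm ((\<gamma> * \<sigma>) *\<^sub>R (A *v (\<Sum>j<k. I j))))"
      by (intro order_trans[OF norm_Pair_le] add_mono norm_triangle_ineq norm_triangle_ineq4)
    also have "\<dots> = \<sigma> * h * norm (A *v (\<Sum>j<k. J j)) + \<sigma> * (1 + \<gamma>) * norm (A *v (\<Sum>j<k. I j))
        + \<sigma> * norm (\<Sum>j<k. J j - \<Delta> j)"
      using h \<sigma> \<gamma> by (simp add: algebra_simps)
    also have "\<dots> \<le> \<sigma> * h * ((norm A + 1) * norm (\<Sum>j<k. J j)) + \<sigma> * (1 + \<gamma>) * ((norm A + 1) * norm (\<Sum>j<k. I j))
        + \<sigma> * norm (\<Sum>j<k. J j - \<Delta> j)"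
    proof -
      \<comment> \<open>The padding by 1 keeps the coefficients of the source positive for the later
        use of \<open>L2_dominated_add\<close>.\<close>
      have b: "norm (A *v v) \<le> (norm A + 1) * norm v" for v
        using norm_matrix_vector_mult_le[of A v] by (simp add: distrib_right add_increasing2)
      show ?thesis using h \<sigma> \<gamma> by (intro add_mono mult_left_mono b) auto
    qed
    finally show ?thesis by (simp add: mult_ac)
  qed
  have "norm (e k) \<le> (\<Sum>j<k. drift_lipschitz_const * h * norm (e j))
     + (\<sigma> * (norm A + 1) * h * norm (\<Sum>j<k. J j)
     + \<sigma> * (norm A + 1) * (1 + \<gamma>) * norm (\<Sum>j<k. I j) + \<sigma> * norm (\<Sum>j<k. J j - \<Delta> j))
     + (\<Sum>j<k. C * h * norm (e j) +
      (C * h\<^sup>2 * ((1 + norm (y (real j * h))) + norm (J j)) + path_step_const * h * G j))"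
    using ek D N R by linarith
  also have "\<dots> = error_source C h w y J k + (drift_lipschitz_const + C) * h * (\<Sum>j<k. norm (e j))"
    by (simp add: error_source_def sum.distrib sum_distrib_left distrib_right I_def G_def \<Delta>_def)
  finally show ?thesis by (simp add: e_def)
qed

lemma error_source_nonneg:
  assumes "C > 0" "h > 0"
  shows "error_source C h w y J k \<ge> 0"
  unfolding error_source_def using assms \<sigma> \<gamma> path_step_const_pos integral_one_plus_norm_nonneg
  by (intro add_nonneg_nonneg mult_nonneg_nonneg sum_nonneg) (auto intro: less_imp_le)

text \<open>\<open>(1 + c) ^ k \<le> exp (c * k)\<close> with \<open>c\<close> proportional to
  \<open>h\<close> makes the Gronwall factor depend on \<open>T\<close> alone. The \<open>h\<close>
  left in front of the sum compensates for its \<open>k\<close> terms.\<close>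

lemma pathwise_error_bound:
  assumes path: "langevin_path x w y" and h: "0 < h" "h \<le> 1" and "C > 0"
    and X0: "X 0 = x"
    and step: "\<And>j. norm (X (Suc j) - (X j + h *\<^sub>R drift (X j) + (h *\<^sub>R \<sigma> *\<^sub>R (A *v J j), \<sigma> *\<^sub>R J j)))
         \<le> C * h\<^sup>2 * (1 + norm (X j) + norm (J j))"
    and k: "real k * h \<le> T"
  shows "norm (X k - y (real k * h)) \<le> error_source C h w y J k
    + h * ((drift_lipschitz_const + C) * exp ((drift_lipschitz_const + C) * T)) * (\<Sum>j<k. error_source C h w y J j)"
proof -
  let ?L = "drift_lipschitz_const + C"
  have L: "?L \<ge> 0" using A0 \<gamma> \<open>C > 0\<close> by (simp add: drift_lipschitz_const_def add_nonneg_nonneg)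
  have "norm (X k - y (real k * h)) \<le> error_source C h w y J k
      + ?L * h * (1 + ?L * h) ^ k * (\<Sum>j<k. error_source C h w y J j)"
    by (rule discrete_gronwall[of _ "error_source C h w y J"])
      (use L h error_source_nonneg[OF \<open>C > 0\<close>] error_recursion[OF path h \<open>C > 0\<close> X0 step] in auto)
  also have "\<dots> \<le> error_source C h w y J k + ?L * h * exp (?L * T) * (\<Sum>j<k. error_source C h w y J j)"
  proof (intro add_left_mono mult_right_mono mult_left_mono)
    have "(1 + ?L * h) ^ k \<le> exp (?L * h) ^ k" using L h by (intro power_mono) auto
    also have "\<dots> = exp (?L * (real k * h))" by (simp add: exp_of_nat_mult[symmetric] mult_ac)
    also have "\<dots> \<le> exp (?L * T)" using k L by (simp add: mult_left_mono)
    finally show "(1 + ?L * h) ^ k \<le> exp (?L * T)" .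
  qed (use L h error_source_nonneg[OF \<open>C > 0\<close>] in \<open>auto intro: sum_nonneg\<close>)
  finally show ?thesis by (simp add: mult_ac)
qed

end

section \<open>Mean squares of Brownian increments and of their cell integrals\<close>

lemma L2_dominated_norm: "L2_dominated M f c \<Longrightarrow> L2_dominated M (\<lambda>\<omega>. norm (f \<omega>)) c"
  by (simp add: L2_dominated_def)

lemma L2_dominated_cmult:
  fixes f :: "'w \<Rightarrow> real"
  shows "L2_dominated M f c \<Longrightarrow> 0 \<le> a \<Longrightarrow> L2_dominated M (\<lambda>\<omega>. a * f \<omega>) (a * c)"
  using L2_dominated_scaleR[of M f c a] by simp

lemma L2_dominated_const:
  assumes "prob_space M" "norm v \<le> c"
  shows "L2_dominated M (\<lambda>_. v) c"
proof -
  interpret prob_space M by fact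
  have "(norm v)\<^sup>2 \<le> c\<^sup>2" using assms(2) by (intro power_mono) auto
  then show ?thesis unfolding L2_dominated_def
    by (intro exI[of _ "\<lambda>_. ennreal (c\<^sup>2)"]) (auto simp: emeasure_space_1 intro: ennreal_leI)
qed

text \<open>The Frobenius norm of the identity is the square root of the dimension, that is, the
  mean square norm of a Brownian increment over unit time; the 1 is padding that makes positivity
  immediate.\<close>

definition increment_const :: "'n::finite itself \<Rightarrow> real" where
  "increment_const _ = norm (mat 1 :: real^'n^'n) + 1"

lemma increment_const_pos: "increment_const TYPE('n::finite) > 0"
  unfolding increment_const_def by (simp add: add_nonneg_pos)

text \<open>The isometry with every matrix equal to \<open>mat 1\<close>: the total length of the
  intervals counts, not their number.\<close>

lemma L2_dominated_increments:
  fixes W :: "real \<Rightarrow> 'w \<Rightarrow> real^'n"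
  assumes BM: "brownian_motion M W" and "finite I"
    and ab: "\<And>i. i \<in> I \<Longrightarrow> 0 \<le> a i \<and> a i < b i"
    and disj: "\<And>i j. i \<in> I \<Longrightarrow> j \<in> I \<Longrightarrow> i \<noteq> j \<Longrightarrow> b i \<le> a j \<or> b j \<le> a i"
    and T: "(\<Sum>i\<in>I. b i - a i) \<le> T" "T > 0"
  shows "L2_dominated M (\<lambda>\<omega>. \<Sum>i\<in>I. W (b i) \<omega> - W (a i) \<omega>) (increment_const TYPE('n) * sqrt T)"
proof -
  let ?n = "norm (mat 1 :: real^'n^'n)"
  have "L2_dominated M (\<lambda>\<omega>. \<Sum>i\<in>I. mat 1 *v (W (b i) \<omega> - W (a i) \<omega>)) (increment_const TYPE('n) * sqrt T)"
  proof (rule L2_dominated_step[OF BM \<open>finite I\<close> ab disj])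
    have "(\<Sum>i\<in>I. ?n\<^sup>2 * (b i - a i)) = ?n\<^sup>2 * (\<Sum>i\<in>I. b i - a i)" by (simp add: sum_distrib_left)
    also have "\<dots> \<le> ?n\<^sup>2 * T" using T by (intro mult_left_mono) auto
    also have "\<dots> \<le> (increment_const TYPE('n))\<^sup>2 * T"
      using T by (intro mult_right_mono power_mono) (auto simp: increment_const_def)
    also have "\<dots> = (increment_const TYPE('n) * sqrt T)\<^sup>2" using T by (simp add: power_mult_distrib)
    finally show "(\<Sum>i\<in>I. ?n\<^sup>2 * (b i - a i)) \<le> (increment_const TYPE('n) * sqrt T)\<^sup>2" .
  qed
  then show ?thesis by simp
qed

lemma L2_dominated_increment:
  fixes W :: "real \<Rightarrow> 'w \<Rightarrow> real^'n"
  assumes BM: "brownian_motion M W" and "0 \<le> s" "s \<le> t" "t - s \<le> T" "T > 0"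
  shows "L2_dominated M (\<lambda>\<omega>. W t \<omega> - W s \<omega>) (increment_const TYPE('n) * sqrt T)"
proof (cases "s = t")
  case True
  then show ?thesis by (simp add: L2_dominated_zero)
next
  case False
  then show ?thesis
    using L2_dominated_increments[OF BM, of "{()}" "\<lambda>_. s" "\<lambda>_. t" T] assms by simp
qed

text \<open>Widths \<open>s\<close> below \<open>h\<close> occur when cell integrals are rewritten
  over \<open>[0, h]\<close>.\<close>

lemma grid_cells_disjoint:
  fixes h :: real
  assumes "h > 0" "i \<noteq> j" "s \<le> h"
  shows "real i * h + s \<le> real j * h \<or> real j * h + s \<le> real i * h"
proof -
  have "real i * h + s \<le> real j * h" if "i < j" for i j :: nat
  proof -
    have "real i * h + h = real (Suc i) * h" by (simp add: algebra_simps)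
    also have "\<dots> \<le> real j * h" using that assms by (intro mult_right_mono) auto
    finally show ?thesis using assms by simp
  qed
  then show ?thesis using assms(2) by (meson linorder_neqE_nat)
qed

text \<open>Substituting \<open>s \<mapsto> j h + s\<close> in every cell turns the sum into one integral over
  \<open>[0, h]\<close> whose integrand is, at each time, a sum of increments over disjoint intervals.\<close>

lemma L2_dominated_cell_integrals:
  fixes W :: "real \<Rightarrow> 'w \<Rightarrow> real^'n"
  assumes BM: "brownian_motion M W" and h: "h > 0" and k: "real k * h \<le> T" and "T > 0"
  shows "L2_dominated M
    (\<lambda>\<omega>. \<Sum>j<k. integral {real j * h..real j * h + h} (\<lambda>s. W s \<omega> - W (real j * h) \<omega>))
    (h * (increment_const TYPE('n) * sqrt T))"
proof -
  define Z where "Z s \<omega> = (\<Sum>j<k. W (real j * h + s) \<omega> - W (real j * h) \<omega>)" for s \<omega>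
  have c: "AE \<omega> in M. continuous_on {0..} (\<lambda>t. W t \<omega>)" by (rule brownian_motionD(3)[OF BM])
  have cj: "continuous_on {0..h} (\<lambda>s. W (real j * h + s) \<omega> - W (real j * h) \<omega>)"
    if "continuous_on {0..} (\<lambda>t. W t \<omega>)" for j \<omega>
    using h by (intro continuous_intros continuous_on_compose2[OF that]) auto
  have "L2_dominated M (\<lambda>\<omega>. integral {0..h} (\<lambda>s. Z s \<omega>)) ((h - 0) * (increment_const TYPE('n) * sqrt T))"
  proof (rule L2_dominated_integral[OF h])
    show "increment_const TYPE('n) * sqrt T > 0" using increment_const_pos[where 'n='n] \<open>T > 0\<close> by simp
    show "AE \<omega> in M. continuous_on {0..h} (\<lambda>s. Z s \<omega>)"
      using c unfolding Z_def by eventually_elim (intro continuous_on_sum cj)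
    fix s assume s: "s \<in> {0..h}"
    show "L2_dominated M (Z s) (increment_const TYPE('n) * sqrt T)"
    proof (cases "s = 0")
      case True
      then have "Z s = (\<lambda>_. 0)" by (simp add: Z_def fun_eq_iff)
      then show ?thesis by (simp add: L2_dominated_zero)
    next
      case False
      \<comment> \<open>The intervals have total length at most \<open>T\<close> whatever
        \<open>h\<close> is, so the integration over \<open>[0, h]\<close> gains a full factor
        \<open>h\<close>.\<close>
      have ks: "real k * s \<le> T" using s k mult_left_mono[of s h "real k"] by auto
      have "L2_dominated M (\<lambda>\<omega>. \<Sum>j<k. W (real j * h + s) \<omega> - W (real j * h) \<omega>) (increment_const TYPE('n) * sqrt T)"
        by (rule L2_dominated_increments[OF BM])
          (use s False h ks \<open>T > 0\<close> grid_cells_disjoint[OF h] in auto)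
      then show ?thesis unfolding Z_def .
    qed
  qed
  then have "L2_dominated M (\<lambda>\<omega>. integral {0..h} (\<lambda>s. Z s \<omega>)) (h * (increment_const TYPE('n) * sqrt T))" by simp
  then show ?thesis
  proof (rule L2_dominated_mono)
    show "AE \<omega> in M. norm (\<Sum>j<k. integral {real j * h..real j * h + h} (\<lambda>s. W s \<omega> - W (real j * h) \<omega>))
        \<le> norm (integral {0..h} (\<lambda>s. Z s \<omega>))"
      using c
    proof eventually_elim
      case (elim \<omega>)
      have "integral {real j * h..real j * h + h} (\<lambda>s. W s \<omega> - W (real j * h) \<omega>) =
          integral {0..h} (\<lambda>s. W (real j * h + s) \<omega> - W (real j * h) \<omega>)" for j
      proof -
        have "continuous_on {0 + real j * h..h + real j * h} (\<lambda>s. W s \<omega> - W (real j * h) \<omega>)"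
          using h by (intro continuous_intros continuous_on_subset[OF elim]) auto
        from integral_shift[OF this] show ?thesis by (simp add: o_def add.commute)
      qed
      then have "(\<Sum>j<k. integral {real j * h..real j * h + h} (\<lambda>s. W s \<omega> - W (real j * h) \<omega>)) =
          (\<Sum>j<k. integral {0..h} (\<lambda>s. W (real j * h + s) \<omega> - W (real j * h) \<omega>))" by simp
      also have "\<dots> = integral {0..h} (\<lambda>s. Z s \<omega>)" unfolding Z_def
        by (intro integral_sum[symmetric] integrable_continuous_real cj elim) simp
      finally show ?case by simp
    qed
  qed (use h \<open>T > 0\<close> increment_const_pos[where 'n='n] in auto)
qed

section \<open>Mean square bounds for the solution, the sources and the error\<close>

context langevin_coefficients
begin

definition growth_const :: real where "growth_const = norm A + drift_growth"

text \<open>Mean square form of the right-hand side of \<open>path_apriori_bound\<close>: the first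
  factor bounds \<open>\<beta>\<close> up to \<open>1 + norm x\<close>, the second is the Gronwall
  factor.\<close>

definition apriori_const :: "real \<Rightarrow> real" where
  "apriori_const T = (1 + growth_const * T + \<sigma> * (increment_const TYPE('n) * sqrt T))
     * (1 + growth_const * exp (growth_const * T) * T)"

lemma growth_const_pos: "growth_const > 0"
  unfolding growth_const_def drift_growth_def using A0 \<gamma>
  by (intro add_nonneg_pos add_pos_nonneg) auto

lemma apriori_const_pos: "T > 0 \<Longrightarrow> apriori_const T > 0"
  unfolding apriori_const_def using growth_const_pos \<sigma> increment_const_pos[where 'n='n]
  by (intro mult_pos_pos add_pos_nonneg) auto

text \<open>The pathwise bound is linear in the norms of Brownian increments at fixed times, so the
  finite and the integral form of Minkowski's inequality suffice.\<close>

lemma L2_dominated_solution: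
  assumes BM: "brownian_motion M W" and "T > 0" and t: "t \<in> {0..T}"
    and path: "AE \<omega> in M. langevin_path x (\<lambda>t. W t \<omega>) (\<lambda>t. Y t \<omega>)"
  shows "L2_dominated M (Y t) (apriori_const T * (1 + norm x))"
proof -
  interpret prob_space M by (rule brownian_motionD(1)[OF BM])
  define \<beta> where "\<beta> \<omega> s = norm x + growth_const * T + \<sigma> * norm (W s \<omega> - W 0 \<omega>)" for \<omega> s
  define b where "b = norm x + growth_const * T + \<sigma> * (increment_const TYPE('n) * sqrt T)"
  define c where "c = growth_const * exp (growth_const * T)"
  have pos: "growth_const * T > 0" "\<sigma> * (increment_const TYPE('n) * sqrt T) > 0" "c > 0"
    using growth_const_pos \<open>T > 0\<close> \<sigma> increment_const_pos[where 'n='n] by (auto simp: c_def)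
  have b: "b > 0" using pos by (simp add: b_def add_nonneg_pos add_pos_pos)
  have \<beta>: "L2_dominated M (\<lambda>\<omega>. \<beta> \<omega> s) b" if "s \<in> {0..T}" for s
    unfolding \<beta>_def b_def
  proof (rule L2_dominated_add)
    show "L2_dominated M (\<lambda>_. norm x + growth_const * T) (norm x + growth_const * T)"
      using pos by (intro L2_dominated_const prob_space_axioms) simp
    show "L2_dominated M (\<lambda>\<omega>. \<sigma> * norm (W s \<omega> - W 0 \<omega>)) (\<sigma> * (increment_const TYPE('n) * sqrt T))"
      using that \<sigma> \<open>T > 0\<close> by (intro L2_dominated_cmult L2_dominated_norm L2_dominated_increment[OF BM]) auto
  qed (use pos in \<open>auto simp: add_nonneg_pos\<close>)
  have c\<beta>: "AE \<omega> in M. continuous_on {0..t} (\<beta> \<omega>)"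
    using path unfolding \<beta>_def langevin_path_def
    by eventually_elim (auto intro!: continuous_intros elim!: continuous_on_subset)
  have int: "L2_dominated M (\<lambda>\<omega>. integral {0..t} (\<beta> \<omega>)) (T * b)"
  proof (cases "t = 0")
    case True
    then show ?thesis by (simp add: L2_dominated_zero)
  next
    case False
    then have "L2_dominated M (\<lambda>\<omega>. integral {0..t} (\<lambda>s. \<beta> \<omega> s)) ((t - 0) * b)"
      using t b c\<beta> \<beta> by (intro L2_dominated_integral) auto
    then show ?thesis by (rule L2_dominated_mono) (use t b in \<open>auto intro: mult_right_mono\<close>)
  qed
  have sum: "L2_dominated M (\<lambda>\<omega>. \<beta> \<omega> t + c * integral {0..t} (\<beta> \<omega>)) (b + c * (T * b))"
    using pos b \<open>T > 0\<close> t by (intro L2_dominated_add L2_dominated_cmult \<beta> int) auto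
  show ?thesis
  proof (rule L2_dominated_mono[OF sum])
    show "AE \<omega> in M. norm (Y t \<omega>) \<le> norm (\<beta> \<omega> t + c * integral {0..t} (\<beta> \<omega>))"
      using path
    proof eventually_elim
      case (elim \<omega>)
      from path_apriori_bound[OF elim t] show ?case
        by (simp add: \<beta>_def[abs_def] c_def growth_const_def)
    qed
    have "b \<le> (1 + growth_const * T + \<sigma> * (increment_const TYPE('n) * sqrt T)) * (1 + norm x)"
    proof -
      have "0 \<le> (growth_const * T + \<sigma> * (increment_const TYPE('n) * sqrt T)) * norm x" using pos by simp
      then show ?thesis by (simp add: b_def distrib_left distrib_right)
    qed
    then have "b * (1 + c * T) \<le> (1 + growth_const * T + \<sigma> * (increment_const TYPE('n) * sqrt T)) * (1 + norm x) * (1 + c * T)"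
      using pos \<open>T > 0\<close> by (intro mult_right_mono) auto
    then show "b + c * (T * b) \<le> apriori_const T * (1 + norm x)"
      unfolding apriori_const_def c_def[symmetric] by (simp add: mult_ac distrib_left)
  qed (use pos b \<open>T > 0\<close> in auto)
qed

text \<open>Mirrors the four lines of \<open>error_source\<close> with a factor \<open>h\<close>
  taken out. In \<open>3 * e + m\<close>, the part \<open>3 * e\<close> is the deviation of the
  Wiener integrals from Brownian increments and \<open>m\<close> belongs to the increments
  themselves.\<close>

definition source_const :: "real \<Rightarrow> real \<Rightarrow> real \<Rightarrow> real" where
  "source_const T C e = (let m = increment_const TYPE('n); a = 1 + apriori_const T in
     \<sigma> * (norm A + 1) * ((3 * e + m) * sqrt T) + \<sigma> * (norm A + 1) * (1 + \<gamma>) * (m * sqrt T)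
     + \<sigma> * (3 * (e * sqrt T)) + T * (C * (a + (3 * e + m)) + path_step_const * a))"

lemma source_const_pos: "T > 0 \<Longrightarrow> C > 0 \<Longrightarrow> e > 0 \<Longrightarrow> source_const T C e > 0"
proof -
  assume pos: "T > 0" "C > 0" "e > 0"
  define K where "K = norm A + 1"
  have "K > 0" by (simp add: K_def add_nonneg_pos)
  then show ?thesis
    unfolding source_const_def Let_def K_def[symmetric]
    using pos increment_const_pos[where 'n='n] apriori_const_pos[of T] path_step_const_pos \<sigma> \<gamma>
    by (intro add_pos_pos mult_pos_pos) auto
qed

text \<open>All four parts are of order \<open>h\<close>: the first carries an explicit
  \<open>h\<close>, the second gets it from the cell integrals, the third from integrands within
  \<open>e * h\<close> of the identity, and the last sums at most \<open>T / h\<close> terms of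
  order \<open>h\<^sup>2\<close>.\<close>

lemma L2_dominated_error_source:
  assumes BM: "brownian_motion M W" and "T > 0" "C > 0" "e > 0"
    and h: "0 < h" "h \<le> 1" and k: "real k * h \<le> T"
    and wi: "\<And>j. has_wiener_integral M W (f j) (real j * h) (real j * h + h) (J j)"
    and near: "\<And>j s. s \<in> {real j * h<..real j * h + h} \<Longrightarrow> norm (f j s - mat 1) \<le> e * h"
    and path: "AE \<omega> in M. langevin_path x (\<lambda>t. W t \<omega>) (\<lambda>t. Y t \<omega>)"
  shows "L2_dominated M (\<lambda>\<omega>. error_source C h (\<lambda>t. W t \<omega>) (\<lambda>t. Y t \<omega>) (\<lambda>j. J j \<omega>) k)
    (source_const T C e * (1 + norm x) * h)"
\<comment> \<open>For \<open>k = 0\<close> the constant of the remainder sum would be 0, outside the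
  reach of \<open>L2_dominated_add\<close>.\<close>
proof (cases "k = 0")
  case True
  then show ?thesis by (simp add: error_source_def L2_dominated_zero)
next
  case False
  interpret prob_space M by (rule brownian_motionD(1)[OF BM])
  define m where "m = increment_const TYPE('n)"
  define z where "z = (1 + apriori_const T) * (1 + norm x)"
  have m: "m > 0" by (simp add: m_def increment_const_pos)
  have z: "z > 0" using apriori_const_pos[OF \<open>T > 0\<close>] by (simp add: z_def add_pos_nonneg)
  have sT: "sqrt T > 0" using \<open>T > 0\<close> by simp
  have tj: "real j * h \<in> {0..T}" "{real j * h..real j * h + h} \<subseteq> {0..T}" if "j < k" for j
  proof -
    have "real (Suc j) * h \<le> real k * h" using that h by (intro mult_right_mono) auto
    then show "real j * h \<in> {0..T}" "{real j * h..real j * h + h} \<subseteq> {0..T}"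
      using k h by (auto simp: distrib_right)
  qed
  have D: "L2_dominated M (\<lambda>\<omega>. \<Sum>j<k. J j \<omega> - (W (real j * h + h) \<omega> - W (real j * h) \<omega>)) (3 * (e * h * sqrt T))"
    using h k \<open>e > 0\<close> \<open>T > 0\<close> near grid_cells_disjoint[OF h(1)]
    by (intro L2_dominated_wiener_sum[OF BM _ wi]) auto
  \<comment> \<open>A crude bound over the horizon 1 is enough, because single integrals enter only
    with the factor \<open>h\<^sup>2\<close>.\<close>
  have Jj: "L2_dominated M (J j) (3 * e + m)" for j
  proof -
    have "L2_dominated M (\<lambda>\<omega>. \<Sum>j\<in>{j}. J j \<omega> - (W (real j * h + h) \<omega> - W (real j * h) \<omega>)) (3 * (e * h * sqrt 1))"
      using h \<open>e > 0\<close> near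
      by (intro L2_dominated_wiener_sum[OF BM _ wi]) auto
    moreover have "L2_dominated M (\<lambda>\<omega>. W (real j * h + h) \<omega> - W (real j * h) \<omega>) (m * sqrt 1)"
      unfolding m_def using h by (intro L2_dominated_increment[OF BM]) auto
    ultimately have "L2_dominated M (\<lambda>\<omega>. (\<Sum>j\<in>{j}. J j \<omega> - (W (real j * h + h) \<omega> - W (real j * h) \<omega>))
        + (W (real j * h + h) \<omega> - W (real j * h) \<omega>)) (3 * (e * h * sqrt 1) + m * sqrt 1)"
      by (rule L2_dominated_add) (use h \<open>e > 0\<close> m in auto)
    then show ?thesis
      by (rule L2_dominated_mono) (use h \<open>e > 0\<close> m in auto)
  qed
  \<comment> \<open>Up to the small sum of \<open>D\<close>, the integrals add up to the telescoped
    increment of \<open>W\<close> over \<open>[0, k h]\<close>, so the bound is uniform in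
    \<open>k\<close>.\<close>
  have Jsum: "L2_dominated M (\<lambda>\<omega>. \<Sum>j<k. J j \<omega>) ((3 * e + m) * sqrt T)"
  proof -
    have W: "L2_dominated M (\<lambda>\<omega>. W (real k * h) \<omega> - W 0 \<omega>) (m * sqrt T)"
      unfolding m_def using h k \<open>T > 0\<close> by (intro L2_dominated_increment[OF BM]) auto
    have tel: "(\<Sum>j<k. W (real j * h + h) \<omega> - W (real j * h) \<omega>) = W (real k * h) \<omega> - W 0 \<omega>" for \<omega>
      using sum_lessThan_telescope[of "\<lambda>j. W (real j * h) \<omega>" k] by (simp add: distrib_right add.commute)
    have "L2_dominated M (\<lambda>\<omega>. (\<Sum>j<k. J j \<omega> - (W (real j * h + h) \<omega> - W (real j * h) \<omega>)) + (W (real k * h) \<omega> - W 0 \<omega>))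
        (3 * (e * h * sqrt T) + m * sqrt T)"
      by (rule L2_dominated_add[OF D W]) (use h \<open>e > 0\<close> m sT in auto)
    then show ?thesis
    proof (rule L2_dominated_mono)
      have "e * h * sqrt T \<le> e * 1 * sqrt T" using h \<open>e > 0\<close> sT by (intro mult_right_mono mult_left_mono) auto
      then show "3 * (e * h * sqrt T) + m * sqrt T \<le> (3 * e + m) * sqrt T" by (simp add: distrib_right)
      show "AE \<omega> in M. norm (\<Sum>j<k. J j \<omega>) \<le> norm ((\<Sum>j<k. J j \<omega> - (W (real j * h + h) \<omega> - W (real j * h) \<omega>)) + (W (real k * h) \<omega> - W 0 \<omega>))"
        unfolding tel[symmetric] sum.distrib[symmetric] by simp
    qed (use h \<open>e > 0\<close> m sT in auto)
  qed
  have Is: "L2_dominated M (\<lambda>\<omega>. \<Sum>j<k. integral {real j * h..real j * h + h} (\<lambda>s. W s \<omega> - W (real j * h) \<omega>)) (h * (m * sqrt T))"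
    unfolding m_def by (rule L2_dominated_cell_integrals[OF BM h(1) k \<open>T > 0\<close>])
  have Y: "L2_dominated M (\<lambda>\<omega>. 1 + norm (Y t \<omega>)) z" if "t \<in> {0..T}" for t
  proof -
    have "L2_dominated M (\<lambda>\<omega>. 1 + norm (Y t \<omega>)) (1 + apriori_const T * (1 + norm x))"
      using apriori_const_pos[OF \<open>T > 0\<close>]
      by (intro L2_dominated_add L2_dominated_const L2_dominated_norm L2_dominated_solution[OF BM \<open>T > 0\<close> that path] prob_space_axioms)
        (auto simp: add_pos_nonneg)
    then show ?thesis
      by (rule L2_dominated_mono) (use apriori_const_pos[OF \<open>T > 0\<close>] in \<open>auto simp: z_def distrib_right distrib_left\<close>)
  qed
  have G: "L2_dominated M (\<lambda>\<omega>. integral {real j * h..real j * h + h} (\<lambda>s. 1 + norm (Y s \<omega>))) (h * z)" if j: "j < k" for j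
  proof -
    have "L2_dominated M (\<lambda>\<omega>. integral {real j * h..real j * h + h} (\<lambda>s. 1 + norm (Y s \<omega>))) ((real j * h + h - real j * h) * z)"
    proof (rule L2_dominated_integral)
      show "AE \<omega> in M. continuous_on {real j * h..real j * h + h} (\<lambda>t. 1 + norm (Y t \<omega>))"
        using path
      proof eventually_elim
        case (elim \<omega>)
        show ?case using path_continuous(5)[OF elim, of "{real j * h..real j * h + h}"] h by auto
      qed
      show "L2_dominated M (\<lambda>\<omega>. 1 + norm (Y t \<omega>)) z" if "t \<in> {real j * h..real j * h + h}" for t
        using that tj(2)[OF j] by (intro Y) blast
    qed (use h z in auto)
    then show ?thesis by simp
  qed
  define r where "r = C * h\<^sup>2 * (z + (3 * e + m)) + path_step_const * h * (h * z)"
  have R: "L2_dominated M (\<lambda>\<omega>. \<Sum>j<k. C * h\<^sup>2 * ((1 + norm (Y (real j * h) \<omega>)) + norm (J j \<omega>))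
      + path_step_const * h * integral {real j * h..real j * h + h} (\<lambda>s. 1 + norm (Y s \<omega>))) (\<Sum>j<k. r)"
    unfolding r_def
    using h z m \<open>e > 0\<close> \<open>C > 0\<close> path_step_const_pos
    by (intro L2_dominated_sum L2_dominated_add L2_dominated_cmult L2_dominated_norm Jj Y G tj)
      (auto simp: add_pos_pos)
  have r: "r > 0" unfolding r_def using h z m \<open>e > 0\<close> \<open>C > 0\<close> path_step_const_pos by (intro add_pos_pos mult_pos_pos) auto
  define K where "K = norm A + 1"
  have K: "K > 0" by (simp add: K_def add_nonneg_pos)
  have total: "L2_dominated M (\<lambda>\<omega>. error_source C h (\<lambda>t. W t \<omega>) (\<lambda>t. Y t \<omega>) (\<lambda>j. J j \<omega>) k)
     (\<sigma> * (norm A + 1) * h * ((3 * e + m) * sqrt T) + \<sigma> * (norm A + 1) * (1 + \<gamma>) * (h * (m * sqrt T))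
      + \<sigma> * (3 * (e * h * sqrt T)) + (\<Sum>j<k. r))"
    unfolding error_source_def K_def[symmetric]
    using h m sT \<sigma> \<gamma> \<open>e > 0\<close> r False K
    by (intro L2_dominated_add L2_dominated_cmult L2_dominated_norm Jsum Is D R)
      (auto intro!: add_pos_pos mult_pos_pos)
  show ?thesis
  proof (rule L2_dominated_mono[OF total])
    show "0 \<le> \<sigma> * (norm A + 1) * h * ((3 * e + m) * sqrt T) + \<sigma> * (norm A + 1) * (1 + \<gamma>) * (h * (m * sqrt T))
      + \<sigma> * (3 * (e * h * sqrt T)) + (\<Sum>j<k. r)"
      using h m sT \<sigma> \<gamma> \<open>e > 0\<close> r by (intro add_nonneg_nonneg mult_nonneg_nonneg sum_nonneg) auto
    define u where "u = \<sigma> * (norm A + 1) * ((3 * e + m) * sqrt T) + \<sigma> * (norm A + 1) * (1 + \<gamma>) * (m * sqrt T)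
      + \<sigma> * (3 * (e * sqrt T))"
    have u: "u \<ge> 0" unfolding u_def using m sT \<sigma> \<gamma> \<open>e > 0\<close> by (intro add_nonneg_nonneg mult_nonneg_nonneg) auto
    define a where "a = 1 + apriori_const T"
    have a: "a \<ge> 0" using apriori_const_pos[OF \<open>T > 0\<close>] by (simp add: a_def)
    have "(\<Sum>j<k. r) = (real k * h) * (h * (C * (z + (3 * e + m)) + path_step_const * z))"
      by (simp add: r_def power2_eq_square algebra_simps)
    also have "\<dots> \<le> T * (h * (C * (z + (3 * e + m)) + path_step_const * z))"
      using k h z m \<open>e > 0\<close> \<open>C > 0\<close> path_step_const_pos by (intro mult_right_mono mult_nonneg_nonneg add_nonneg_nonneg) auto
    also have "\<dots> \<le> T * (h * (C * ((a + (3 * e + m)) * (1 + norm x)) + path_step_const * (a * (1 + norm x))))"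
      using h \<open>T > 0\<close> \<open>C > 0\<close> m \<open>e > 0\<close> unfolding z_def a_def[symmetric]
      by (intro mult_left_mono add_mono order_refl) (auto simp: distrib_right distrib_left)
    finally have rr: "(\<Sum>j<k. r) \<le> T * (C * (a + (3 * e + m)) + path_step_const * a) * (1 + norm x) * h"
      by (simp add: algebra_simps)
    have "\<sigma> * (norm A + 1) * h * ((3 * e + m) * sqrt T) + \<sigma> * (norm A + 1) * (1 + \<gamma>) * (h * (m * sqrt T))
      + \<sigma> * (3 * (e * h * sqrt T)) = u * 1 * h" by (simp add: u_def algebra_simps)
    also have "\<dots> \<le> u * (1 + norm x) * h" using u h by (intro mult_right_mono mult_left_mono) auto
    finally have noise: "\<sigma> * (norm A + 1) * h * ((3 * e + m) * sqrt T) + \<sigma> * (norm A + 1) * (1 + \<gamma>) * (h * (m * sqrt T))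
      + \<sigma> * (3 * (e * h * sqrt T)) \<le> u * (1 + norm x) * h" .
    show "\<sigma> * (norm A + 1) * h * ((3 * e + m) * sqrt T) + \<sigma> * (norm A + 1) * (1 + \<gamma>) * (h * (m * sqrt T))
      + \<sigma> * (3 * (e * h * sqrt T)) + (\<Sum>j<k. r) \<le> source_const T C e * (1 + norm x) * h"
    proof -
      have "source_const T C e = u + T * (C * (a + (3 * e + m)) + path_step_const * a)"
        by (simp add: source_const_def Let_def m_def a_def u_def)
      then have "source_const T C e * (1 + norm x) * h =
          u * (1 + norm x) * h + T * (C * (a + (3 * e + m)) + path_step_const * a) * (1 + norm x) * h"
        by (simp only: distrib_right)
      then show ?thesis using rr noise by linarith
    qed
  qed simp
qed

definition error_const :: "real \<Rightarrow> real \<Rightarrow> real \<Rightarrow> real" where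
  "error_const T C e = source_const T C e *
     (1 + (drift_lipschitz_const + C) * exp ((drift_lipschitz_const + C) * T) * T)"

lemma drift_lipschitz_const_pos: "drift_lipschitz_const > 0"
  unfolding drift_lipschitz_const_def using A0 \<gamma> by (intro add_pos_nonneg add_nonneg_pos) auto

lemma error_const_pos: "T > 0 \<Longrightarrow> C > 0 \<Longrightarrow> e > 0 \<Longrightarrow> error_const T C e > 0"
  unfolding error_const_def using source_const_pos[of T C e] drift_lipschitz_const_pos
  by (intro mult_pos_pos add_pos_nonneg) auto

text \<open>Minkowski's inequality applied to \<open>pathwise_error_bound\<close>: all sources have
  the same bound, and \<open>k\<close> of them times \<open>h\<close> cost at most
  \<open>T\<close>.\<close>

lemma L2_dominated_error:
  assumes BM: "brownian_motion M W" and "T > 0" "C > 0" "e > 0"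
    and h: "0 < h" "h \<le> 1" and k: "real k * h \<le> T"
    and wi: "\<And>j. has_wiener_integral M W (f j) (real j * h) (real j * h + h) (J j)"
    and near: "\<And>j s. s \<in> {real j * h<..real j * h + h} \<Longrightarrow> norm (f j s - mat 1) \<le> e * h"
    and path: "AE \<omega> in M. langevin_path x (\<lambda>t. W t \<omega>) (\<lambda>t. Y t \<omega>)"
    and X0: "AE \<omega> in M. X 0 \<omega> = x"
    and step: "AE \<omega> in M. \<forall>j. norm (X (Suc j) \<omega> - (X j \<omega> + h *\<^sub>R drift (X j \<omega>)
         + (h *\<^sub>R \<sigma> *\<^sub>R (A *v J j \<omega>), \<sigma> *\<^sub>R J j \<omega>))) \<le> C * h\<^sup>2 * (1 + norm (X j \<omega>) + norm (J j \<omega>))"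
  shows "L2_dominated M (\<lambda>\<omega>. X k \<omega> - Y (real k * h) \<omega>) (error_const T C e * (1 + norm x) * h)"
proof -
  define S where "S j \<omega> = error_source C h (\<lambda>t. W t \<omega>) (\<lambda>t. Y t \<omega>) (\<lambda>j. J j \<omega>) j" for j \<omega>
  define s where "s = source_const T C e * (1 + norm x) * h"
  define q where "q = (drift_lipschitz_const + C) * exp ((drift_lipschitz_const + C) * T)"
  have s: "s > 0" unfolding s_def using source_const_pos[OF \<open>T > 0\<close> \<open>C > 0\<close> \<open>e > 0\<close>] h
    by (intro mult_pos_pos) (auto simp: add_pos_nonneg)
  have q: "q > 0" unfolding q_def using drift_lipschitz_const_pos \<open>C > 0\<close> by simp
  have S: "L2_dominated M (S j) s" if "j \<le> k" for j
  proof -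
    have "real j * h \<le> real k * h" using that h by (intro mult_right_mono) auto
    then have "real j * h \<le> T" using k by linarith
    then show ?thesis unfolding S_def[abs_def] s_def
      by (intro L2_dominated_error_source[OF BM \<open>T > 0\<close> \<open>C > 0\<close> \<open>e > 0\<close> h _ wi near path])
  qed
  have sum: "L2_dominated M (\<lambda>\<omega>. S k \<omega> + h * q * (\<Sum>j<k. S j \<omega>)) (s + q * T * s)"
  proof (cases "k = 0")
    case True
    then show ?thesis using S[of 0] s q \<open>T > 0\<close> by (auto intro: L2_dominated_mono)
  next
    case False
    have "L2_dominated M (\<lambda>\<omega>. S k \<omega> + h * q * (\<Sum>j<k. S j \<omega>)) (s + h * q * (\<Sum>j<k. s))"
      using s q h False by (intro L2_dominated_add L2_dominated_cmult L2_dominated_sum S) auto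
    then show ?thesis
    proof (rule L2_dominated_mono)
      have "q * (real k * h) * s \<le> q * T * s" using k q s by (intro mult_right_mono mult_left_mono) auto
      then show "s + h * q * (\<Sum>j<k. s) \<le> s + q * T * s" by (simp add: mult_ac)
      show "0 \<le> s + h * q * (\<Sum>j<k. s)" using s q h by simp
    qed simp
  qed
  then have "L2_dominated M (\<lambda>\<omega>. X k \<omega> - Y (real k * h) \<omega>) (s + q * T * s)"
  proof (rule L2_dominated_mono)
    show "AE \<omega> in M. norm (X k \<omega> - Y (real k * h) \<omega>) \<le> norm (S k \<omega> + h * q * (\<Sum>j<k. S j \<omega>))"
      using path X0 step
    proof eventually_elim
      case (elim \<omega>)
      have "norm (X k \<omega> - Y (real k * h) \<omega>) \<le> S k \<omega> + h * q * (\<Sum>j<k. S j \<omega>)"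
        unfolding S_def q_def
        using pathwise_error_bound[OF elim(1) h \<open>C > 0\<close>, of "\<lambda>j. X j \<omega>" "\<lambda>j. J j \<omega>" k T] elim(2,3) k by simp
      then show ?case by simp
    qed
  qed (use s q \<open>T > 0\<close> in auto)
  moreover have "s + q * T * s = error_const T C e * (1 + norm x) * h"
    by (simp add: error_const_def s_def q_def algebra_simps)
  ultimately show ?thesis by simp
qed

end

section \<open>The Ornstein-Uhlenbeck factor, measurability, and the theorem\<close>

lemma mexp_scaled_bounds:
  fixes A :: "real^'n^'n"
  assumes "\<gamma> > 0"
  shows "\<exists>e1>0. \<exists>e2>0. \<forall>h. 0 \<le> h \<and> h \<le> 1 \<longrightarrow>
    norm (mexp (- (\<gamma> * h) *\<^sub>R A) - mat 1) \<le> e1 * h \<and>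
    norm (mexp (- (\<gamma> * h) *\<^sub>R A) - mat 1 + (\<gamma> * h) *\<^sub>R A) \<le> e2 * h\<^sup>2"
proof -
  let ?n = "norm (mat 1 :: real^'n^'n)"
  define a where "a = \<gamma> * norm A"
  define e2 where "e2 = a\<^sup>2 * (?n * exp a) + 1"
  have a: "a \<ge> 0" using assms by (simp add: a_def)
  have e2: "e2 > 0" using a by (simp add: e2_def add_nonneg_pos)
  have nb: "norm (- (\<gamma> * h) *\<^sub>R A) = a * h" if "0 \<le> h" for h
    using assms that by (simp add: a_def)
  \<comment> \<open>The value \<open>h = 0\<close> is included because the integrand of the Wiener
    integral attains it at the right end of a cell.\<close>
  have 2: "norm (mexp (- (\<gamma> * h) *\<^sub>R A) - mat 1 + (\<gamma> * h) *\<^sub>R A) \<le> e2 * h\<^sup>2" if h: "0 \<le> h" "h \<le> 1" for h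
  proof -
    have "norm (mexp (- (\<gamma> * h) *\<^sub>R A) - mat 1 - - (\<gamma> * h) *\<^sub>R A) \<le> (a * h)\<^sup>2 * (?n * exp (a * h))"
      using mexp_second_order[of "- (\<gamma> * h) *\<^sub>R A"] unfolding nb[OF h(1)] .
    also have "\<dots> \<le> (a * h)\<^sup>2 * (?n * exp a)"
      using a h by (intro mult_left_mono) (auto intro: mult_left_le)
    also have "\<dots> \<le> e2 * h\<^sup>2" by (simp add: e2_def power_mult_distrib algebra_simps)
    finally show ?thesis by simp
  qed
  have 1: "norm (mexp (- (\<gamma> * h) *\<^sub>R A) - mat 1) \<le> (a + e2) * h" if h: "0 \<le> h" "h \<le> 1" for h
  proof -
    have "norm (mexp (- (\<gamma> * h) *\<^sub>R A) - mat 1) \<le> norm (mexp (- (\<gamma> * h) *\<^sub>R A) - mat 1 + (\<gamma> * h) *\<^sub>R A) + norm (- (\<gamma> * h) *\<^sub>R A)"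
      using norm_triangle_ineq[of "mexp (- (\<gamma> * h) *\<^sub>R A) - mat 1 + (\<gamma> * h) *\<^sub>R A" "- (\<gamma> * h) *\<^sub>R A"] by simp
    also have "\<dots> \<le> e2 * h\<^sup>2 + a * h" using 2[OF h] nb[OF h(1)] by simp
    also have "e2 * h\<^sup>2 \<le> e2 * h" using h e2 by (intro mult_left_mono) (auto simp: power2_eq_square mult_left_le)
    finally show ?thesis by (simp add: algebra_simps)
  qed
  have "a + e2 > 0" using a e2 by simp
  then show ?thesis using e2 1 2 by blast
qed

lemma diffeomorphism_continuous:
  assumes "diffeomorphism f"
  shows "continuous_on UNIV f" "continuous_on UNIV (inv f)" "bij f"
  using assms unfolding diffeomorphism_def smooth_on_def by (auto dest!: spec[of _ 0])

text \<open>The discrete Hamiltonian map is the second Legendre transform after the inverse of the first.\<close>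

lemma discrete_hamiltonian_map_continuous:
  assumes "hyperregular L" "discrete_hamiltonian_map L \<theta>" "h > 0"
  shows "continuous_on UNIV (\<theta> h)"
proof -
  define F where "F = (\<lambda>(q0, q1). (q0, - D1 L q0 q1 h))"
  define G where "G = (\<lambda>(q0, q1). (q1, D2 L q0 q1 h))"
  have FG: "diffeomorphism F" "diffeomorphism G"
    using assms(1,3) unfolding hyperregular_def F_def G_def by blast+
  have "\<theta> h x = G (inv F x)" for x
  proof -
    obtain q0 q1 where q: "inv F x = (q0, q1)" by fastforce
    have "F (q0, q1) = x" using diffeomorphism_continuous(3)[OF FG(1)] q by (metis bij_inv_eq_iff)
    then have "x = (q0, - D1 L q0 q1 h)" by (simp add: F_def)
    then have "\<theta> h x = (q1, D2 L q0 q1 h)"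
      using assms(2,3) unfolding discrete_hamiltonian_map_def by blast
    then show ?thesis by (simp add: q G_def)
  qed
  then have "\<theta> h = (\<lambda>x. G (inv F x))" by blast
  then show ?thesis
    using continuous_on_compose2[OF diffeomorphism_continuous(1)[OF FG(2)] diffeomorphism_continuous(2)[OF FG(1)]]
    by simp
qed

text \<open>Passing from domination to a finite second moment requires measurability, which
  \<open>gla\<close> states only for the Wiener integrals; it propagates through the continuous step
  map.\<close>

lemma gla_measurable:
  assumes "gla M W Ma \<beta> \<gamma> \<theta> h x X" "continuous_on UNIV (\<theta> h)"
  shows "X k \<in> borel_measurable M"
proof (induction k)
  case 0
  have "X 0 \<in> borel_measurable M \<longleftrightarrow> (\<lambda>_. x) \<in> borel_measurable M"
    using assms(1) unfolding gla_def by (intro measurable_cong) auto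
  then show ?case by simp
next
  case (Suc k)
  define E where "E = mexp (- (\<gamma> * h) *\<^sub>R matrix_inv Ma)"
  obtain J where J: "J \<in> borel_measurable M"
      "\<And>\<omega>. \<omega> \<in> space M \<Longrightarrow> X (Suc k) \<omega> = \<theta> h (ou_map Ma \<beta> \<gamma> h (J \<omega>) (X k \<omega>))"
    using assms(1) unfolding gla_def has_wiener_integral_def by blast
  have th: "\<theta> h \<in> borel_measurable borel" using assms(2) by (rule borel_measurable_continuous_onI)
  have "continuous_on UNIV (\<lambda>z :: 'b phase \<times> (real^'b). (fst (fst z), E *v snd (fst z) + sqrt (2 * \<gamma> / \<beta>) *\<^sub>R snd z))"
    by (intro continuous_intros continuous_on_matrix_vector_mult)
  then have g: "(\<lambda>z :: 'b phase \<times> (real^'b). (fst (fst z), E *v snd (fst z) + sqrt (2 * \<gamma> / \<beta>) *\<^sub>R snd z)) \<in> borel_measurable borel"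
    by (rule borel_measurable_continuous_onI)
  have "(\<lambda>\<omega>. (X k \<omega>, J \<omega>)) \<in> borel_measurable M" using Suc J(1) by (rule borel_measurable_Pair)
  from measurable_compose[OF measurable_compose[OF this g] th]
  have "(\<lambda>\<omega>. \<theta> h (ou_map Ma \<beta> \<gamma> h (J \<omega>) (X k \<omega>))) \<in> borel_measurable M"
    by (simp add: ou_map_def split_def E_def)
  then show ?case using J(2) by (subst measurable_cong) auto
qed

theorem theorem2p1:
  fixes M :: "'w measure"
    and W :: "real \<Rightarrow> 'w \<Rightarrow> real^'n"
    and Ma :: "real^'n^'n"
    and U :: "real^'n \<Rightarrow> real"
    and \<beta> \<gamma> :: real
    and L :: "real^'n \<Rightarrow> real^'n \<Rightarrow> real \<Rightarrow> real"
    and \<theta> \<phi> :: "real \<Rightarrow> 'n phase \<Rightarrow> 'n phase"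
    and p :: nat
  assumes "\<beta> > 0" and "\<gamma> > 0" and "p \<ge> 1"
    and "sym_pos_def Ma"
    and "brownian_motion M W"
    and "smooth_on UNIV U"
    and U1: "\<exists>A0>0. \<forall>q0 q1. norm (grad U q0 - grad U q1) \<le> A0 * norm (q0 - q1)"
    and U2: "\<exists>A1>0. \<forall>q. U q \<ge> A1 * (1 + (norm q)\<^sup>2)"
    and flow: "hamiltonian_flow Ma U \<phi>"
    and V1: "smooth_discrete_lagrangian L" "hyperregular L" "discrete_hamiltonian_map L \<theta>"
    and V2: "\<exists>B0>0. \<exists>h0>0. \<forall>h x. 0 < h \<and> h < h0 \<longrightarrow>
               norm (\<theta> h x - \<phi> h x) \<le> B0 * sqrt (1 + (norm x)\<^sup>2) * h ^ (p + 1)"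
  shows "\<forall>T>0. \<exists>hc>0. \<exists>C>0. \<forall>h x X Y t.
           0 < h \<and> h < hc \<and> gla M W Ma \<beta> \<gamma> \<theta> h x X \<and> langevin_solution M W Ma U \<beta> \<gamma> x Y \<and>
           t \<in> {0..T} \<longrightarrow>
             integrable M (\<lambda>\<omega>. (norm (X (nat \<lfloor>t / h\<rfloor>) \<omega> - Y (real_of_int \<lfloor>t / h\<rfloor> * h) \<omega>))\<^sup>2) \<and>
             sqrt (\<integral>\<omega>. (norm (X (nat \<lfloor>t / h\<rfloor>) \<omega> - Y (real_of_int \<lfloor>t / h\<rfloor> * h) \<omega>))\<^sup>2 \<partial>M)
               \<le> C * sqrt (1 + (norm x)\<^sup>2) * h"
proof (intro allI impI)
  fix T :: real assume T: "T > 0"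
  define A where "A = matrix_inv Ma"
  define \<sigma> where "\<sigma> = sqrt (2 * \<gamma> / \<beta>)"
  define E where "E r = mexp (- (\<gamma> * r) *\<^sub>R A)" for r
  note BM = \<open>brownian_motion M W\<close>
  obtain A0 where A0: "A0 > 0" "\<And>q0 q1. norm (grad U q0 - grad U q1) \<le> A0 * norm (q0 - q1)"
    using U1 by blast
  obtain B0 h0 where B0: "B0 > 0" and h0: "h0 > 0"
    and V: "\<And>h x. 0 < h \<Longrightarrow> h < h0 \<Longrightarrow> norm (\<theta> h x - \<phi> h x) \<le> B0 * sqrt (1 + (norm x)\<^sup>2) * h ^ (p + 1)"
    using V2 by blast
  interpret langevin_coefficients A "grad U" \<gamma> \<sigma> A0
    using A0 \<open>\<gamma> > 0\<close> \<open>\<beta> > 0\<close> by unfold_locales (auto simp: \<sigma>_def)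
  obtain e1 e2 where e: "e1 > 0" "e2 > 0"
    and E1: "\<And>r. 0 \<le> r \<Longrightarrow> r \<le> 1 \<Longrightarrow> norm (E r - mat 1) \<le> e1 * r"
    and E2: "\<And>r. 0 \<le> r \<Longrightarrow> r \<le> 1 \<Longrightarrow> norm (E r - mat 1 + (\<gamma> * r) *\<^sub>R A) \<le> e2 * r\<^sup>2"
    using mexp_scaled_bounds[OF \<open>\<gamma> > 0\<close>, of A] unfolding E_def by blast
  have fl: "\<phi> 0 x = x" "((\<lambda>s. \<phi> s x) has_vector_derivative hamiltonian_drift (\<phi> t x)) (at t)" for x t
    using flow unfolding hamiltonian_flow_def hamiltonian_drift_def A_def[symmetric] by blast+
  obtain C1 h1 where C1: "C1 > 0" "h1 > 0"
    "\<And>h x. 0 < h \<Longrightarrow> h < h1 \<Longrightarrow> norm (\<phi> h x - x - h *\<^sub>R hamiltonian_drift x) \<le> C1 * h\<^sup>2 * (1 + norm x)"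
    using hamiltonian_flow_second_order[OF fl] by blast
  \<comment> \<open>The range of (V2), the absorption threshold of the flow, and 1 for comparing
    powers of \<open>h\<close>; \<open>T\<close> affects only the constant.\<close>
  define hc where "hc = min 1 (min h0 h1)"
  have hc: "hc > 0" "hc \<le> 1" "hc \<le> h0" "hc \<le> h1" using h0 C1 by (auto simp: hc_def)
  have sq: "sqrt (1 + (norm x)\<^sup>2) \<le> 1 + norm x" for x :: "'n phase"
    by (rule real_le_lsqrt) (auto simp: power2_sum)
  have \<theta>: "norm (\<theta> h x - \<phi> h x) \<le> B0 * h\<^sup>2 * (1 + norm x)" if h: "0 < h" "h < hc" for h x
  proof -
    have "norm (\<theta> h x - \<phi> h x) \<le> B0 * sqrt (1 + (norm x)\<^sup>2) * h ^ (p + 1)" using V h hc by auto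
    \<comment> \<open>The splitting already costs \<open>h\<^sup>2\<close> per step, so the
      integrator error is rounded up to the same power, using \<open>h \<le> 1\<close> and
      \<open>p \<ge> 1\<close>.\<close>
    also have "\<dots> \<le> B0 * (1 + norm x) * h\<^sup>2"
      using B0 h hc sq \<open>p \<ge> 1\<close> by (intro mult_mono power_decreasing) auto
    finally show ?thesis by (simp add: mult_ac)
  qed
  have "\<exists>C>0. \<forall>h x J. 0 < h \<and> h < hc \<and> h \<le> 1 \<longrightarrow>
       norm (\<theta> h (fst x, E h *v snd x + \<sigma> *\<^sub>R J) - (x + h *\<^sub>R drift x + (h *\<^sub>R \<sigma> *\<^sub>R (A *v J), \<sigma> *\<^sub>R J)))
         \<le> C * h\<^sup>2 * (1 + norm x + norm J)"
    by (rule splitting_step_expansion[where ?e1.0 = e1 and ?e2.0 = e2 and \<phi> = \<phi> and ?C1.0 = C1 and B = B0])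
      (use E1 E2 C1 \<theta> B0 e hc in auto)
  then obtain C where C: "C > 0"
    and step: "\<forall>h x J. 0 < h \<and> h < hc \<and> h \<le> 1 \<longrightarrow>
       norm (\<theta> h (fst x, E h *v snd x + \<sigma> *\<^sub>R J) - (x + h *\<^sub>R drift x + (h *\<^sub>R \<sigma> *\<^sub>R (A *v J), \<sigma> *\<^sub>R J)))
         \<le> C * h\<^sup>2 * (1 + norm x + norm J)"
    by (elim exE conjE) (rule that)
  \<comment> \<open>The 2 converts \<open>1 + norm x\<close> into the square root of
    \<open>1 + (norm x)\<^sup>2\<close>.\<close>
  define K where "K = 2 * error_const T C e1"
  have ec: "error_const T C e1 > 0" by (rule error_const_pos[OF T C e(1)])
  show "\<exists>hc>0. \<exists>C>0. \<forall>h x X Y t.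
           0 < h \<and> h < hc \<and> gla M W Ma \<beta> \<gamma> \<theta> h x X \<and> langevin_solution M W Ma U \<beta> \<gamma> x Y \<and>
           t \<in> {0..T} \<longrightarrow>
             integrable M (\<lambda>\<omega>. (norm (X (nat \<lfloor>t / h\<rfloor>) \<omega> - Y (real_of_int \<lfloor>t / h\<rfloor> * h) \<omega>))\<^sup>2) \<and>
             sqrt (\<integral>\<omega>. (norm (X (nat \<lfloor>t / h\<rfloor>) \<omega> - Y (real_of_int \<lfloor>t / h\<rfloor> * h) \<omega>))\<^sup>2 \<partial>M)
               \<le> C * sqrt (1 + (norm x)\<^sup>2) * h"
  proof (rule exI[of _ hc], rule conjI[OF hc(1)], rule exI[of _ K], rule conjI, goal_cases)
    case 1
    then show ?case using ec by (simp add: K_def)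
  next
    case 2
    show ?case
    proof (intro allI impI, elim conjE)
      fix h x X Y t
      assume h: "0 < h" "h < hc" and gla: "gla M W Ma \<beta> \<gamma> \<theta> h x X"
        and sol: "langevin_solution M W Ma U \<beta> \<gamma> x Y" and t: "t \<in> {0..T}"
      have h1: "h \<le> 1" using h hc by simp
      define k where "k = nat \<lfloor>t / h\<rfloor>"
      have k: "real_of_int \<lfloor>t / h\<rfloor> = real k" using t h by (simp add: k_def)
      have "real k \<le> t / h" unfolding k[symmetric] by (rule of_int_floor_le)
      then have kT: "real k * h \<le> T" using t h by (simp add: field_simps)
      have path: "AE \<omega> in M. langevin_path x (\<lambda>t. W t \<omega>) (\<lambda>t. Y t \<omega>)"
        using brownian_motionD(3)[OF BM] sol[unfolded langevin_solution_def, THEN conjunct2, THEN conjunct1]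
          sol[unfolded langevin_solution_def, THEN conjunct2, THEN conjunct2]
        by eventually_elim (simp add: langevin_path_def A_def[symmetric] \<sigma>_def[symmetric])
      have "\<forall>k. \<exists>J. has_wiener_integral M W (\<lambda>s. E (real k * h + h - s)) (real k * h) (real k * h + h) J \<and>
             (\<forall>\<omega>\<in>space M. X (Suc k) \<omega> = \<theta> h (fst (X k \<omega>), E h *v snd (X k \<omega>) + \<sigma> *\<^sub>R J \<omega>))"
        using gla unfolding gla_def ou_map_def split_def E_def A_def \<sigma>_def by (elim conjE)
      \<comment> \<open>\<open>gla\<close> provides an integral for each step separately; one family
        is fixed so that sums over steps make sense.\<close>
      from choice[OF this] obtain J where J:
        "\<forall>k. has_wiener_integral M W (\<lambda>s. E (real k * h + h - s)) (real k * h) (real k * h + h) (J k) \<and>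
           (\<forall>\<omega>\<in>space M. X (Suc k) \<omega> = \<theta> h (fst (X k \<omega>), E h *v snd (X k \<omega>) + \<sigma> *\<^sub>R J k \<omega>))" ..
      note J1 = J[THEN spec, THEN conjunct1] and J2 = J[THEN spec, THEN conjunct2, THEN bspec]
      \<comment> \<open>The argument of \<open>E\<close> is the time left until the end of the cell,
        hence between 0 and \<open>h\<close>.\<close>
      have near: "norm (E (real j * h + h - s) - mat 1) \<le> e1 * h" if "s \<in> {real j * h<..real j * h + h}" for j s
      proof -
        have "norm (E (real j * h + h - s) - mat 1) \<le> e1 * (real j * h + h - s)"
          using that h1 by (intro E1) auto
        also have "\<dots> \<le> e1 * h" using that e by (intro mult_left_mono) auto
        finally show ?thesis .
      qed
      have X0: "AE \<omega> in M. X 0 \<omega> = x" using gla unfolding gla_def by (intro AE_I2) auto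
      have st: "AE \<omega> in M. \<forall>j. norm (X (Suc j) \<omega> - (X j \<omega> + h *\<^sub>R drift (X j \<omega>)
         + (h *\<^sub>R \<sigma> *\<^sub>R (A *v J j \<omega>), \<sigma> *\<^sub>R J j \<omega>))) \<le> C * h\<^sup>2 * (1 + norm (X j \<omega>) + norm (J j \<omega>))"
        using J2 step h h1 by (intro AE_I2 allI) (simp del: split_paired_All)
      have dom: "L2_dominated M (\<lambda>\<omega>. X k \<omega> - Y (real k * h) \<omega>) (error_const T C e1 * (1 + norm x) * h)"
        by (rule L2_dominated_error[OF BM T C e(1) h(1) h1 kT J1 near path X0 st])
      have [measurable]: "X k \<in> borel_measurable M"
        by (rule gla_measurable[OF gla discrete_hamiltonian_map_continuous[OF V1(2,3) h(1)]])
      have [measurable]: "Y (real k * h) \<in> borel_measurable M" using sol h unfolding langevin_solution_def by simp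
      have meas: "(\<lambda>\<omega>. X k \<omega> - Y (real k * h) \<omega>) \<in> borel_measurable M" by measurable
      have c0: "0 \<le> error_const T C e1 * (1 + norm x) * h" using ec h by (intro mult_nonneg_nonneg) auto
      have "1 \<le> sqrt (1 + (norm x)\<^sup>2)" "norm x \<le> sqrt (1 + (norm x)\<^sup>2)"
        by (intro real_le_rsqrt; simp)+
      then have "1 + norm x \<le> 2 * sqrt (1 + (norm x)\<^sup>2)" by linarith
      then have "error_const T C e1 * (1 + norm x) * h \<le> error_const T C e1 * (2 * sqrt (1 + (norm x)\<^sup>2)) * h"
        using ec h by (intro mult_right_mono mult_left_mono) auto
      then have le: "error_const T C e1 * (1 + norm x) * h \<le> K * sqrt (1 + (norm x)\<^sup>2) * h"
        by (simp add: K_def mult_ac)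
      show "integrable M (\<lambda>\<omega>. (norm (X (nat \<lfloor>t / h\<rfloor>) \<omega> - Y (real_of_int \<lfloor>t / h\<rfloor> * h) \<omega>))\<^sup>2) \<and>
             sqrt (\<integral>\<omega>. (norm (X (nat \<lfloor>t / h\<rfloor>) \<omega> - Y (real_of_int \<lfloor>t / h\<rfloor> * h) \<omega>))\<^sup>2 \<partial>M)
               \<le> K * sqrt (1 + (norm x)\<^sup>2) * h"
        using L2_dominated_integrable[OF meas dom c0] order_trans[OF _ le] unfolding k k_def[symmetric] by blast
    qed
  qed
qed

end
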